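(* Let $\kappa_0,\kappa_\infty\in\mathbb{C}$ and consider the Hamiltonian system $y_4'=\partial H/\partial z_4$, $z_4'=-\partial H/\partial y_4$ with the Okamoto Hamiltonian $$H(y_4,z_4;x)=2\,y_4z_4^2-\left(y_4^2+2x\,y_4+\kappa_0\right)z_4+\kappa_\infty y_4.$$ Let $q=q(x)$ be a solution of $(\mathrm{P}_{\mathrm{IV}})$ with parameters $\alpha=1-\frac{\kappa_0}{2}+2\kappa_\infty$, $\beta=-\frac{\kappa_0^2}{2}$. Applying to this system the transformation $(y_4,z_4)\mapsto(y,z)$ defined by $$y_4=z+q,\qquad z_4=yz+\frac{x}{2}+\frac{q}{4}+\frac{\kappa_0+q'}{4q}$$ gives rise to a system in $(y,z)$ that is Bureau-Guillot for $(\mathrm{P}_{\mathrm{IV}})$.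
   Context: The independent variable is $x\in\mathbb{C}$ and $'=d/dx$. The fourth Painlevé equation is $$(\mathrm{P}_{\mathrm{IV}})\colon\ y''=\frac{(y')^2}{2y}+\frac32y^3+4xy^2+2(x^2-\alpha)y+\frac{\beta}{y}.$$ The Hamiltonian system with coefficients rational in $x$ associated with $(\mathrm{P}_{\mathrm{IV}})$ is the one with the Hamiltonian $H$ in the claim (its component $y_4$ satisfies $(\mathrm{P}_{\mathrm{IV}})$ with the stated parameters). Regularisation process. A system $y'=P(y,z;x)$, $z'=Q(y,z;x)$, with $P,Q$ rational in $(y,z)$ and coefficients depending on $x$, is extended to $\mathbb{P}^2$, covered by the affine charts $(y,z)$, $(u_0,v_0)$, $(U_0,V_0)$ with $[1:y:z]=[u_0:1:v_0]=[V_0:U_0:1]$. In each chart one looks for base points, i.e. points where the right-hand side of one of the (rational) equations becomes $0/0$. Each base point (in a chart $(y,z)$, at $(a,b)$) is blown up, by introducing the charts $u=y-a$, $v=\frac{z-b}{y-a}$ and $U=\frac{y-a}{z-b}$, $V=z-b$, with exceptional curve $\{u=0\}\cup\{V=0\}$; new base points on it are blown up again, which gives for each base point one or more finite sequences ("cascades") of blow-ups, until no indeterminacy is left in the final charts. The system is regularised if in every cascade it is regular on the last exceptional curve in one of the final charts. The regularising conditions are the (differential) constraints on the coefficient functions of the system which make it regular on the last exceptional curves in this sense. Definition. A system $y'=P(y,z;x)$, $z'=Q(y,z;x)$ is an analogue of the Bureau-Guillot system (Bureau-Guillot, for short) for $(\mathrm{P}_{\mathrm J})$ if: (i) it is birationally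 equivalent (by a transformation of $(y,z)$ with coefficients depending on $x$) to the Hamiltonian system with coefficients rational in $x$ associated with $(\mathrm{P}_{\mathrm J})$; (ii) it has coefficient functions both rational and meromorphic in $x$ which are functions of the Painlevé transcendent $\mathrm{P}_{\mathrm J}$ (here $q$) and its derivatives; (iii) the Painlevé equation $(\mathrm{P}_{\mathrm J})$ is obtained as a regularising condition in the regularisation process of the system, i.e., regarding $q$ as an a priori undetermined function, the regularising conditions are differential equations for $q$ that are satisfied when $q$ solves $(\mathrm{P}_{\mathrm J})$. *)

theory Defs
  imports
    "HOL-Complex_Analysis.Complex_Analysis"
    "HOL-Computational_Algebra.Computational_Algebra"
begin

definition region :: "complex set \<Rightarrow> bool" where
  "region D \<longleftrightarrow> open D \<and> connected D \<and> D \<noteq> {}"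

subsection \<open>Planar systems with right-hand sides rational in \<open>(y, z)\<close>\<close>

text \<open>
  The arguments are \<open>x\<close>, \<open>y\<close>, \<open>z\<close>, in this order. Right-hand sides are handled as functions, but
  only their generic values in \<open>(y, z)\<close> matter: a value taken where a denominator vanishes is an
  artefact of \<open>c / 0 = 0\<close> and is never looked at.
\<close>

type_synonym xyz_fun = "complex \<Rightarrow> complex \<Rightarrow> complex \<Rightarrow> complex"
type_synonym planar_system = "xyz_fun \<times> xyz_fun"

text \<open>
  Bivariate polynomials: the coefficient of \<open>y^i z^j\<close> in \<open>p\<close> is \<open>coeff (coeff p j) i\<close>.
\<close>

definition ev :: "complex poly poly \<Rightarrow> complex \<Rightarrow> complex \<Rightarrow> complex" where
  "ev p y z = poly (poly p [:z:]) y"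

definition degrees_le :: "nat \<Rightarrow> complex poly poly \<Rightarrow> bool" where
  "degrees_le N p \<longleftrightarrow> degree p \<le> N \<and> (\<forall>j. degree (coeff p j) \<le> N)"

definition generically :: "(complex \<Rightarrow> complex \<Rightarrow> bool) \<Rightarrow> bool" where
  "generically R \<longleftrightarrow> (\<exists>h::complex poly poly. h \<noteq> 0 \<and> (\<forall>y z. ev h y z \<noteq> 0 \<longrightarrow> R y z))"

definition lowest_terms ::
  "(complex \<Rightarrow> complex \<Rightarrow> complex) \<Rightarrow> complex poly poly \<Rightarrow> complex poly poly \<Rightarrow> bool" where
  "lowest_terms f n d \<longleftrightarrow>
     d \<noteq> 0 \<and> coprime n d \<and> generically (\<lambda>y z. f y z * ev d y z = ev n y z)"

definition indeterminate_at :: "(complex \<Rightarrow> complex \<Rightarrow> complex) \<Rightarrow> complex \<Rightarrow> complex \<Rightarrow> bool" where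
  "indeterminate_at f a b \<longleftrightarrow> (\<exists>n d. lowest_terms f n d \<and> ev n a b = 0 \<and> ev d a b = 0)"

definition regular_at :: "(complex \<Rightarrow> complex \<Rightarrow> complex) \<Rightarrow> complex \<Rightarrow> complex \<Rightarrow> bool" where
  "regular_at f a b \<longleftrightarrow> (\<exists>n d. lowest_terms f n d \<and> ev d a b \<noteq> 0)"

subsection \<open>Birational transformations with coefficients depending on \<open>x\<close>\<close>

definition rational_over :: "complex set \<Rightarrow> xyz_fun \<Rightarrow> bool" where
  "rational_over D f \<longleftrightarrow>
     (\<exists>(n :: complex \<Rightarrow> complex poly poly) (d :: complex \<Rightarrow> complex poly poly) N.
        (\<forall>x. degrees_le N (n x) \<and> degrees_le N (d x)) \<and>
        (\<forall>i j. (\<lambda>x. coeff (coeff (n x) j) i) meromorphic_on D \<and>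
               (\<lambda>x. coeff (coeff (d x) j) i) meromorphic_on D) \<and>
        (\<forall>\<^sub>\<approx>x\<in>D. d x \<noteq> 0 \<and> (\<forall>y z. f x y z = ev (n x) y z / ev (d x) y z)))"

text \<open>
  \<open>transforms D Y Z A B\<close>: the substitution \<open>(y\<^sub>A, z\<^sub>A) = (Y x y\<^sub>B z\<^sub>B, Z x y\<^sub>B z\<^sub>B)\<close> turns the
  system \<open>A\<close> into the system \<open>B\<close>, i.e. the chain rule holds. These two equations are linear in the
  right-hand sides of \<open>B\<close> and determine them, the Jacobian of the substitution being nonzero.
\<close>

definition transforms ::
  "complex set \<Rightarrow> xyz_fun \<Rightarrow> xyz_fun \<Rightarrow> planar_system \<Rightarrow> planar_system \<Rightarrow> bool" where
  "transforms D Y Z A B \<longleftrightarrow>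
     (\<forall>\<^sub>\<approx>x\<in>D. generically (\<lambda>y z.
        fst A x (Y x y z) (Z x y z) =
          deriv (\<lambda>t. Y t y z) x + deriv (\<lambda>t. Y x t z) y * fst B x y z
                                + deriv (\<lambda>t. Y x y t) z * snd B x y z \<and>
        snd A x (Y x y z) (Z x y z) =
          deriv (\<lambda>t. Z t y z) x + deriv (\<lambda>t. Z x t z) y * fst B x y z
                                + deriv (\<lambda>t. Z x y t) z * snd B x y z))"

definition birationally_equivalent ::
  "complex set \<Rightarrow> planar_system \<Rightarrow> planar_system \<Rightarrow> bool" where
  "birationally_equivalent D A B \<longleftrightarrow>
     (\<exists>Y Z U V.
        rational_over D Y \<and> rational_over D Z \<and> rational_over D U \<and> rational_over D V \<and>
        (\<forall>\<^sub>\<approx>x\<in>D.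
           generically (\<lambda>y z. U x (Y x y z) (Z x y z) = y \<and> V x (Y x y z) (Z x y z) = z) \<and>
           generically (\<lambda>y z. Y x (U x y z) (V x y z) = y \<and> Z x (U x y z) (V x y z) = z)) \<and>
        transforms D Y Z A B)"

subsection \<open>The regularisation process\<close>

text \<open>The charts \<open>(u\<^sub>0, v\<^sub>0)\<close> and \<open>(U\<^sub>0, V\<^sub>0)\<close> of the projective plane,
  \<open>[1 : y : z] = [u\<^sub>0 : 1 : v\<^sub>0] = [V\<^sub>0 : U\<^sub>0 : 1]\<close>.\<close>

definition chart_uv :: "planar_system \<Rightarrow> planar_system" where
  "chart_uv S =
     (\<lambda>x u v. - u\<^sup>2 * fst S x (1 / u) (v / u),
      \<lambda>x u v. u * snd S x (1 / u) (v / u) - u * v * fst S x (1 / u) (v / u))"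

definition chart_UV :: "planar_system \<Rightarrow> planar_system" where
  "chart_UV S =
     (\<lambda>x U V. V * fst S x (U / V) (1 / V) - U * V * snd S x (U / V) (1 / V),
      \<lambda>x U V. - V\<^sup>2 * snd S x (U / V) (1 / V))"

text \<open>The two charts of the blow-up of \<open>(a, b)\<close>: \<open>y = u + a\<close>, \<open>z = u v + b\<close> with exceptional
  curve \<open>u = 0\<close>, and \<open>y = U V + a\<close>, \<open>z = V + b\<close> with exceptional curve \<open>V = 0\<close>. The centre
  depends on \<open>x\<close>, so its derivative enters.\<close>

definition blowup_uv ::
  "planar_system \<Rightarrow> (complex \<Rightarrow> complex) \<Rightarrow> (complex \<Rightarrow> complex) \<Rightarrow> planar_system" where
  "blowup_uv S a b =
     (let du = (\<lambda>x u v. fst S x (u + a x) (u * v + b x) - deriv a x);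
          dw = (\<lambda>x u v. snd S x (u + a x) (u * v + b x) - deriv b x)
      in (du, \<lambda>x u v. (dw x u v - v * du x u v) / u))"

definition blowup_UV ::
  "planar_system \<Rightarrow> (complex \<Rightarrow> complex) \<Rightarrow> (complex \<Rightarrow> complex) \<Rightarrow> planar_system" where
  "blowup_UV S a b =
     (let dw = (\<lambda>x U V. fst S x (U * V + a x) (V + b x) - deriv a x);
          dV = (\<lambda>x U V. snd S x (U * V + a x) (V + b x) - deriv b x)
      in (\<lambda>x U V. (dw x U V - U * dV x U V) / V, dV))"

text \<open>A base point moves with \<open>x\<close>; it may exist as a single-valued function only over a smaller
  region than the one on which the system is given.\<close>

definition base_point ::
  "complex set \<Rightarrow> planar_system \<Rightarrow> (complex \<Rightarrow> complex) \<Rightarrow> (complex \<Rightarrow> complex) \<Rightarrow> bool" where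
  "base_point D S a b \<longleftrightarrow>
     region D \<and> a holomorphic_on D \<and> b holomorphic_on D \<and>
     ((\<forall>x\<in>D. indeterminate_at (fst S x) (a x) (b x)) \<or>
      (\<forall>x\<in>D. indeterminate_at (snd S x) (a x) (b x)))"

definition regular_on_u_axis :: "complex set \<Rightarrow> planar_system \<Rightarrow> bool" where
  "regular_on_u_axis D S \<longleftrightarrow>
     (\<forall>\<^sub>\<approx>x\<in>D. \<forall>c. regular_at (fst S x) 0 c \<and> regular_at (snd S x) 0 c)"

definition regular_on_V_axis :: "complex set \<Rightarrow> planar_system \<Rightarrow> bool" where
  "regular_on_V_axis D S \<longleftrightarrow>
     (\<forall>\<^sub>\<approx>x\<in>D. \<forall>c. regular_at (fst S x) c 0 \<and> regular_at (snd S x) c 0)"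

text \<open>
  \<open>resolved D S a b\<close>: the cascades starting at the base point \<open>(a, b)\<close> are finite and at the end of
  each of them the system is regular on the last exceptional curve in one of the two charts.
  Each point of an exceptional curve is considered once: the chart with exceptional curve \<open>V = 0\<close>
  contributes only its origin, all its other points being visible in the chart with exceptional
  curve \<open>u = 0\<close>. The definition is inductive because an infinite cascade is not a resolution.
\<close>

inductive resolved ::
  "complex set \<Rightarrow> planar_system \<Rightarrow> (complex \<Rightarrow> complex) \<Rightarrow> (complex \<Rightarrow> complex) \<Rightarrow> bool" where
  resolvedI:
  "resolved D S a b" if
    "\<And>D' c. D' \<subseteq> D \<Longrightarrow> base_point D' (blowup_uv S a b) (\<lambda>_. 0) c \<Longrightarrow>
        resolved D' (blowup_uv S a b) (\<lambda>_. 0) c"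
    "\<And>D'. D' \<subseteq> D \<Longrightarrow> base_point D' (blowup_UV S a b) (\<lambda>_. 0) (\<lambda>_. 0) \<Longrightarrow>
        resolved D' (blowup_UV S a b) (\<lambda>_. 0) (\<lambda>_. 0)"
    "(\<nexists>D' c. D' \<subseteq> D \<and> base_point D' (blowup_uv S a b) (\<lambda>_. 0) c) \<Longrightarrow>
     (\<nexists>D'. D' \<subseteq> D \<and> base_point D' (blowup_UV S a b) (\<lambda>_. 0) (\<lambda>_. 0)) \<Longrightarrow>
        regular_on_u_axis D (blowup_uv S a b) \<or> regular_on_V_axis D (blowup_UV S a b)"

text \<open>Again each point of the projective plane is considered once: the chart \<open>(u\<^sub>0, v\<^sub>0)\<close> adds the
  points with \<open>u\<^sub>0 = 0\<close> to the affine plane, and \<open>(U\<^sub>0, V\<^sub>0)\<close> adds its origin.\<close>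

definition regularised :: "complex set \<Rightarrow> planar_system \<Rightarrow> bool" where
  "regularised D S \<longleftrightarrow>
     (\<forall>D' a b. D' \<subseteq> D \<longrightarrow> base_point D' S a b \<longrightarrow> resolved D' S a b) \<and>
     (\<forall>D' c. D' \<subseteq> D \<longrightarrow> base_point D' (chart_uv S) (\<lambda>_. 0) c \<longrightarrow>
        resolved D' (chart_uv S) (\<lambda>_. 0) c) \<and>
     (\<forall>D'. D' \<subseteq> D \<longrightarrow> base_point D' (chart_UV S) (\<lambda>_. 0) (\<lambda>_. 0) \<longrightarrow>
        resolved D' (chart_UV S) (\<lambda>_. 0) (\<lambda>_. 0))"

subsection \<open>Systems whose coefficients are differential rational functions\<close>

text \<open>Differential polynomials of order at most \<open>n\<close>, with coefficients in \<open>\<complex>[x]\<close>, in an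
  undetermined function \<open>w\<close>.\<close>

inductive_set diff_poly :: "nat \<Rightarrow> ((complex \<Rightarrow> complex) \<Rightarrow> complex \<Rightarrow> complex) set"
  for n :: nat where
  const: "(\<lambda>w x. c) \<in> diff_poly n"
| indep: "(\<lambda>w x. x) \<in> diff_poly n"
| jet: "k \<le> n \<Longrightarrow> (\<lambda>w x. (deriv ^^ k) w x) \<in> diff_poly n"
| add: "F \<in> diff_poly n \<Longrightarrow> G \<in> diff_poly n \<Longrightarrow> (\<lambda>w x. F w x + G w x) \<in> diff_poly n"
| mult: "F \<in> diff_poly n \<Longrightarrow> G \<in> diff_poly n \<Longrightarrow> (\<lambda>w x. F w x * G w x) \<in> diff_poly n"

text \<open>A system depending on an undetermined function \<open>w\<close>: numerators and denominators of the two
  right-hand sides, as polynomials in \<open>(y, z)\<close>.\<close>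

record jet_system =
  numP :: "(complex \<Rightarrow> complex) \<Rightarrow> complex \<Rightarrow> complex poly poly"
  denP :: "(complex \<Rightarrow> complex) \<Rightarrow> complex \<Rightarrow> complex poly poly"
  numQ :: "(complex \<Rightarrow> complex) \<Rightarrow> complex \<Rightarrow> complex poly poly"
  denQ :: "(complex \<Rightarrow> complex) \<Rightarrow> complex \<Rightarrow> complex poly poly"

definition jet_polys :: "jet_system \<Rightarrow> ((complex \<Rightarrow> complex) \<Rightarrow> complex \<Rightarrow> complex poly poly) set" where
  "jet_polys S = {numP S, denP S, numQ S, denQ S}"

definition specialise :: "jet_system \<Rightarrow> (complex \<Rightarrow> complex) \<Rightarrow> planar_system" where
  "specialise S w =
     (\<lambda>x y z. ev (numP S w x) y z / ev (denP S w x) y z,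
      \<lambda>x y z. ev (numQ S w x) y z / ev (denQ S w x) y z)"

text \<open>
  All coefficient functions are rational functions of \<open>x\<close>, \<open>w\<close> and \<open>w'\<close> over the complex numbers
  (denominators have been cleared). Higher derivatives are not needed, since a second-order equation
  in normal form expresses them through \<open>x\<close>, \<open>w\<close>, \<open>w'\<close>. This normal form is what
  gives a meaning to regarding \<open>w\<close> as undetermined afterwards.
\<close>

definition jet_rational :: "jet_system \<Rightarrow> bool" where
  "jet_rational S \<longleftrightarrow>
     (\<forall>p\<in>jet_polys S. (\<exists>N. \<forall>w x. degrees_le N (p w x)) \<and>
        (\<forall>i j. (\<lambda>w x. coeff (coeff (p w x) j) i) \<in> diff_poly 1))"

subsection \<open>The fourth Painleve equation and Bureau-Guillot systems for it\<close>

text \<open>Meromorphic solutions; the equation makes sense only away from the zeros of \<open>q\<close>.\<close>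

definition solves_PIV ::
  "complex \<Rightarrow> complex \<Rightarrow> complex set \<Rightarrow> (complex \<Rightarrow> complex) \<Rightarrow> bool" where
  "solves_PIV \<alpha> \<beta> D q \<longleftrightarrow>
     region D \<and> q meromorphic_on D \<and>
     (\<forall>\<^sub>\<approx>x\<in>D. q x \<noteq> 0 \<and>
        deriv (deriv q) x =
          (deriv q x)\<^sup>2 / (2 * q x) + 3 / 2 * q x ^ 3 + 4 * x * (q x)\<^sup>2
          + 2 * (x\<^sup>2 - \<alpha>) * q x + \<beta> / q x)"

definition hamiltonian_system :: "xyz_fun \<Rightarrow> planar_system" where
  "hamiltonian_system H =
     (\<lambda>x y z. deriv (\<lambda>t. H x y t) z, \<lambda>x y z. - deriv (\<lambda>t. H x t z) y)"

definition okamoto_H :: "complex \<Rightarrow> complex \<Rightarrow> xyz_fun" where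
  "okamoto_H \<kappa>0 \<kappa>inf x y z = 2 * y * z\<^sup>2 - (y\<^sup>2 + 2 * x * y + \<kappa>0) * z + \<kappa>inf * y"

definition alphaIV :: "complex \<Rightarrow> complex \<Rightarrow> complex" where
  "alphaIV \<kappa>0 \<kappa>inf = 1 - \<kappa>0 / 2 + 2 * \<kappa>inf"

definition betaIV :: "complex \<Rightarrow> complex" where
  "betaIV \<kappa>0 = - \<kappa>0\<^sup>2 / 2"

text \<open>The functions that may be put for the undetermined \<open>w\<close>. Like the unknown of the Painleve
  equation itself, \<open>w\<close> may occur in denominators.\<close>

definition admissible :: "jet_system \<Rightarrow> complex set \<Rightarrow> (complex \<Rightarrow> complex) \<Rightarrow> bool" where
  "admissible S D w \<longleftrightarrow>
     region D \<and> w holomorphic_on D \<and>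
     (\<forall>x\<in>D. w x \<noteq> 0 \<and> denP S w x \<noteq> 0 \<and> denQ S w x \<noteq> 0)"

text \<open>
  The set \<open>Fs\<close> consists of the regularising conditions: nontrivial differential equations
  which together say exactly that the system is regularised, and which hold for all solutions
  of the Painleve equation.
\<close>

definition PIV_is_regularising :: "complex \<Rightarrow> complex \<Rightarrow> jet_system \<Rightarrow> bool" where
  "PIV_is_regularising \<alpha> \<beta> S \<longleftrightarrow>
     (\<exists>Fs. finite Fs \<and> Fs \<noteq> {} \<and>
        (\<forall>F\<in>Fs. (\<exists>n. F \<in> diff_poly n) \<and> (\<exists>w x. w holomorphic_on UNIV \<and> F w x \<noteq> 0)) \<and>
        (\<forall>D w. admissible S D w \<longrightarrow>
           (regularised D (specialise S w) \<longleftrightarrow> (\<forall>F\<in>Fs. \<forall>x\<in>D. F w x = 0))) \<and>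
        (\<forall>D w. solves_PIV \<alpha> \<beta> D w \<longrightarrow> (\<forall>F\<in>Fs. \<forall>\<^sub>\<approx>x\<in>D. F w x = 0)))"

definition bureau_guillot_PIV ::
  "complex \<Rightarrow> complex \<Rightarrow> jet_system \<Rightarrow> complex set \<Rightarrow> (complex \<Rightarrow> complex) \<Rightarrow> bool" where
  "bureau_guillot_PIV \<kappa>0 \<kappa>inf S D q \<longleftrightarrow>
     birationally_equivalent D (hamiltonian_system (okamoto_H \<kappa>0 \<kappa>inf)) (specialise S q) \<and>
     (jet_rational S \<and> (\<forall>\<^sub>\<approx>x\<in>D. denP S q x \<noteq> 0 \<and> denQ S q x \<noteq> 0) \<and>
      (\<forall>p\<in>jet_polys S. \<forall>i j. (\<lambda>x. coeff (coeff (p q x) j) i) meromorphic_on D)) \<and>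
     PIV_is_regularising (alphaIV \<kappa>0 \<kappa>inf) (betaIV \<kappa>0) S"

end

theory Submission
  imports Defs "HOL-Computational_Algebra.Field_as_Ring"
begin

text \<open>
  The transformed system is polynomial in \<open>(y, z)\<close>, so all its base points lie at infinity: the
  origins of the two charts \<open>(u\<^sub>0, v\<^sub>0)\<close> and \<open>(U\<^sub>0, V\<^sub>0)\<close>. The cascades over the first origin end in
  regular systems for every coefficient function \<open>w\<close>. Over the second one there are two branches,
  through \<open>(0, 2)\<close> and through the origin of the second chart of the blow-up. After the last blow-up
  the only possible pole in either branch has, as coefficient, a multiple of one differential
  polynomial \<open>F\<close> of \<open>w\<close>: up to a power of \<open>w\<close>, the derivative of the Painleve equation solved for
  \<open>\<kappa>inf\<close>. So the system is regularised if and only if \<open>F = 0\<close>, which is the case for all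
  Painleve transcendents.

  Right-hand sides are handled as quotients of polynomial functions, not necessarily in lowest
  terms. Whether a point is regular or indeterminate can still be read off, since the denominators
  that occur are powers of one coordinate times a function that does not vanish at the point.
\<close>

subsection \<open>Indeterminacy of quotients of polynomials\<close>

text \<open>The pair (\<open>q\<close>, \<open>shift\<close>) is itself the solution of the
  Hamiltonian system with y_4 = q, and the substitution is a chart of the blow-up of the phase plane
  at this moving point. The Painleve equation enters the transformation only as Hamilton's second
  equation for this pair, and it removes \<kappa>inf from the new system. Such a system cannot tell
  one \<kappa>inf from another; hence a condition of third order, with \<kappa>inf as constant of
  integration.

  All conditions on \<open>w\<close> are resonances. At a centre v = c on u = 0 the second equation
  is, to first order and up to a unit, u v' = \<lambda> (v - c), and blowing up replaces \<lambda>
  by \<lambda> - \<mu>, where \<mu> is the value of u' at the centre up to the same unit. While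
  \<lambda> is nonzero it determines the next centre; once it is 0, a constant remains that no
  choice of centre removes. Over the first origin \<lambda> runs through 4 w, 0 and through - 4 w, -
  2 w, 0, and the constant vanishes identically. Over the second origin it runs through - 6, - 4, -
  2, 0 in the branch of (0, 2) and through 2, 1, 0 in the other branch as long as g is
  nonzero.\<close>

lemma ev_simps [simp]:
  "ev 0 y z = 0" "ev 1 y z = 1" "ev (p + q) y z = ev p y z + ev q y z"
  "ev (p - q) y z = ev p y z - ev q y z" "ev (- p) y z = - ev p y z"
  "ev (p * q) y z = ev p y z * ev q y z" "ev (p ^ n) y z = ev p y z ^ n"
  by (simp_all add: ev_def)

text \<open>Each \<open>poly p [:z:]\<close> has all values 0, hence is 0, so \<open>p\<close> has
  infinitely many roots, namely all constants \<open>[:z:]\<close>.\<close>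

lemma ev_eq_0_iff: "(\<forall>y z. ev p y z = 0) \<longleftrightarrow> p = 0"
proof
  assume *: "\<forall>y z. ev p y z = 0"
  have "poly p [:z:] = 0" for z
    using * by (auto simp: ev_def poly_all_0_iff_0[symmetric])
  hence "range (\<lambda>z. [:z:]) \<subseteq> {a. poly p a = 0}"
    by auto
  moreover have "infinite (range (\<lambda>z::complex. [:z:]))"
    using infinite_UNIV_char_0 by (subst finite_image_iff) (auto intro: injI)
  ultimately show "p = 0"
    using poly_roots_finite[of p] finite_subset by blast
qed auto

lemma ev_eqI: "(\<And>y z. ev p y z = ev q y z) \<Longrightarrow> p = q"
  using ev_eq_0_iff[of "p - q"] by simp

lemma generically_mono: "generically R \<Longrightarrow> (\<And>y z. R y z \<Longrightarrow> R' y z) \<Longrightarrow> generically R'"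
  unfolding generically_def by blast

lemma generically_conj:
  assumes "generically R" "generically R'"
  shows "generically (\<lambda>y z. R y z \<and> R' y z)"
proof -
  obtain h h' where "h \<noteq> 0" "h' \<noteq> 0" "\<And>y z. ev h y z \<noteq> 0 \<Longrightarrow> R y z" "\<And>y z. ev h' y z \<noteq> 0 \<Longrightarrow> R' y z"
    using assms unfolding generically_def by blast
  thus ?thesis
    unfolding generically_def by (intro exI[of _ "h * h'"]) auto
qed

section \<open>Polynomial functions of two variables\<close>

definition polyfun :: "(complex \<Rightarrow> complex \<Rightarrow> complex) \<Rightarrow> bool" where
  "polyfun f \<longleftrightarrow> (\<exists>p. f = ev p)"

lemma polyfun_ev: "polyfun (ev p)"
  by (auto simp: polyfun_def)

lemma polyfun_const: "polyfun (\<lambda>y z. c)"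
  unfolding polyfun_def by (rule exI[of _ "[:[:c:]:]"]) (auto simp: fun_eq_iff ev_def)

lemma polyfun_fst: "polyfun (\<lambda>y z. y)"
  unfolding polyfun_def by (rule exI[of _ "[:[:0, 1:]:]"]) (auto simp: fun_eq_iff ev_def)

lemma polyfun_snd: "polyfun (\<lambda>y z. z)"
  unfolding polyfun_def by (rule exI[of _ "[:0, 1:]"]) (auto simp: fun_eq_iff ev_def)

lemma polyfun_ring:
  assumes "polyfun f" "polyfun g"
  shows polyfun_add: "polyfun (\<lambda>y z. f y z + g y z)"
    and polyfun_diff: "polyfun (\<lambda>y z. f y z - g y z)"
    and polyfun_mult: "polyfun (\<lambda>y z. f y z * g y z)"
proof -
  from assms obtain p q where [simp]: "f = ev p" "g = ev q" by (auto simp: polyfun_def)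
  show "polyfun (\<lambda>y z. f y z + g y z)"
    unfolding polyfun_def by (rule exI[of _ "p + q"]) (auto simp: fun_eq_iff)
  show "polyfun (\<lambda>y z. f y z - g y z)"
    unfolding polyfun_def by (rule exI[of _ "p - q"]) (auto simp: fun_eq_iff)
  show "polyfun (\<lambda>y z. f y z * g y z)"
    unfolding polyfun_def by (rule exI[of _ "p * q"]) (auto simp: fun_eq_iff)
qed

lemma polyfun_uminus: "polyfun f \<Longrightarrow> polyfun (\<lambda>y z. - f y z)"
  using polyfun_diff[OF polyfun_const[of 0], of f] by simp

lemma polyfun_power: "polyfun f \<Longrightarrow> polyfun (\<lambda>y z. f y z ^ n)"
  by (induction n) (auto intro: polyfun_const polyfun_mult)

lemma polyfun_scale: "polyfun f \<Longrightarrow> polyfun (\<lambda>y z. f y z / c)"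
  using polyfun_mult[OF _ polyfun_const[of "1 / c"], of f] by simp

lemmas polyfun_intros = polyfun_const polyfun_fst polyfun_snd polyfun_add polyfun_diff polyfun_mult
  polyfun_uminus polyfun_power polyfun_scale

lemma polyfun_compose:
  assumes "polyfun f" "polyfun g" "polyfun h"
  shows "polyfun (\<lambda>y z. f (g y z) (h y z))"
proof -
  obtain p where f: "f = ev p" using assms by (auto simp: polyfun_def)
  obtain q where g: "g = ev q" using assms by (auto simp: polyfun_def)
  have inner: "polyfun (\<lambda>y z. poly c (g y z))" for c :: "complex poly"
    by (induction c) (auto intro!: polyfun_intros assms)
  have "polyfun (\<lambda>y z. ev p (g y z) (h y z))"
    unfolding ev_def by (induction p) (auto intro!: polyfun_intros inner assms)
  thus ?thesis using f by simp
qed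

text \<open>A denominator is certified by one nonzero value at a convenient point, without computing
  its coefficients.\<close>

definition nz :: "(complex \<Rightarrow> complex \<Rightarrow> complex) \<Rightarrow> bool" where
  "nz f \<longleftrightarrow> polyfun f \<and> (\<exists>y z. f y z \<noteq> 0)"

lemma nzI: "polyfun f \<Longrightarrow> f a b \<noteq> 0 \<Longrightarrow> nz f"
  by (auto simp: nz_def)

lemma nz_ev [simp]: "nz (ev p) \<longleftrightarrow> p \<noteq> 0"
  using ev_eq_0_iff[of p] by (auto simp: nz_def polyfun_ev)

lemma nz_mult:
  assumes "nz f" "nz g"
  shows "nz (\<lambda>y z. f y z * g y z)"
proof -
  from assms obtain p q where "f = ev p" "g = ev q" by (auto simp: nz_def polyfun_def)
  with assms have "nz (ev (p * q))" by (auto simp del: ev_simps)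
  moreover have "ev (p * q) = (\<lambda>y z. f y z * g y z)"
    using \<open>f = ev p\<close> \<open>g = ev q\<close> by (auto simp: fun_eq_iff)
  ultimately show ?thesis by simp
qed

lemma generically_iff_nz: "generically R \<longleftrightarrow> (\<exists>h. nz h \<and> (\<forall>y z. h y z \<noteq> 0 \<longrightarrow> R y z))"
proof
  assume "generically R"
  then obtain h where "h \<noteq> 0" "\<forall>y z. ev h y z \<noteq> 0 \<longrightarrow> R y z"
    by (auto simp: generically_def)
  thus "\<exists>h. nz h \<and> (\<forall>y z. h y z \<noteq> 0 \<longrightarrow> R y z)"
    by (intro exI[of _ "ev h"]) auto
next
  assume "\<exists>h. nz h \<and> (\<forall>y z. h y z \<noteq> 0 \<longrightarrow> R y z)"
  then obtain h where h: "nz h" "\<forall>y z. h y z \<noteq> 0 \<longrightarrow> R y z" by blast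
  then obtain p where "h = ev p" by (auto simp: nz_def polyfun_def)
  with h show "generically R"
    unfolding generically_def by (intro exI[of _ p]) auto
qed

lemma generically_nz: "nz h \<Longrightarrow> generically (\<lambda>y z. h y z \<noteq> 0)"
  by (auto simp: generically_iff_nz)

text \<open>The substitution is invertible off the line \<open>y = a\<close>. Multiplying
  \<open>h\<close> by \<open>y - a\<close> yields a nonzero value of \<open>h\<close> off that line,
  which then comes from a point of the chart.\<close>

lemma nz_blowup_uv:
  assumes "nz h"
  shows "nz (\<lambda>u v. h (u + a) (u * v + b))"
proof -
  have "nz (\<lambda>y z. h y z * (y - a))"
    by (intro nz_mult assms) (auto intro!: nzI[of _ "a + 1" 0] polyfun_intros)
  then obtain y z where "h y z \<noteq> 0" "y \<noteq> a"
    by (auto simp: nz_def)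
  thus ?thesis
    using assms polyfun_compose[of h "\<lambda>u v. u + a" "\<lambda>u v. u * v + b"] polyfun_intros
    by (intro nzI[of _ "y - a" "(z - b) / (y - a)"]) (auto simp: nz_def)
qed

lemma nz_blowup_UV:
  assumes "nz h"
  shows "nz (\<lambda>u v. h (u * v + a) (v + b))"
proof -
  have "nz (\<lambda>y z. h y z * (z - b))"
    by (intro nz_mult assms) (auto intro!: nzI[of _ 0 "b + 1"] polyfun_intros)
  then obtain y z where "h y z \<noteq> 0" "z \<noteq> b"
    by (auto simp: nz_def)
  thus ?thesis
    using assms polyfun_compose[of h "\<lambda>u v. u * v + a" "\<lambda>u v. v + b"] polyfun_intros
    by (intro nzI[of _ "(y - a) / (z - b)" "z - b"]) (auto simp: nz_def)
qed

lemma generically_blowup_uv: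
  "generically R \<Longrightarrow> generically (\<lambda>u v. R (u + a) (u * v + b))"
  unfolding generically_iff_nz using nz_blowup_uv by meson

lemma generically_blowup_UV:
  "generically R \<Longrightarrow> generically (\<lambda>u v. R (u * v + a) (v + b))"
  unfolding generically_iff_nz using nz_blowup_UV by meson

section \<open>Quotients of polynomial functions compared with lowest terms\<close>

definition has_fraction ::
  "(complex \<Rightarrow> complex \<Rightarrow> complex) \<Rightarrow> (complex \<Rightarrow> complex \<Rightarrow> complex) \<Rightarrow> (complex \<Rightarrow> complex \<Rightarrow> complex) \<Rightarrow> bool"
  where "has_fraction f N D \<longleftrightarrow> polyfun N \<and> nz D \<and> generically (\<lambda>y z. f y z = N y z / D y z)"

text \<open>Both representations agree generically, so \<open>n * q = p * d\<close> as polynomials,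
  and coprimality of \<open>n\<close> and \<open>d\<close> forces \<open>d\<close> to divide
  \<open>q\<close>. The given quotient is thus the reduced one with a common factor \<open>e\<close>
  inserted: where \<open>N\<close> or \<open>D\<close> is nonzero, so is the reduced numerator or
  denominator.\<close>

lemma has_fraction_lowest_terms:
  assumes "has_fraction f N D" "lowest_terms f n d"
  obtains e where "\<And>y z. D y z = ev d y z * ev e y z" "\<And>y z. N y z = ev n y z * ev e y z"
proof -
  obtain p q where p: "N = ev p" and q: "D = ev q"
    using assms by (auto simp: has_fraction_def polyfun_def nz_def)
  have "q \<noteq> 0" using assms nz_ev[of q] unfolding has_fraction_def q by blast
  note q = q this
  have "generically (\<lambda>y z. ev (n * q) y z = ev (p * d) y z)"
    using assms generically_conj[OF _ generically_conj[OF _ generically_nz[of D]]]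
    unfolding has_fraction_def lowest_terms_def p q
  proof (elim conjE, goal_cases)
    case 1
    note g = 1(1)[OF \<open>generically (\<lambda>y z. f y z * ev d y z = ev n y z)\<close>
      \<open>generically (\<lambda>y z. f y z = ev p y z / ev q y z)\<close> \<open>nz (ev q)\<close>]
    show ?case
      by (rule generically_mono[OF g]) (auto simp: field_simps)
  qed
  then obtain h where h: "h \<noteq> 0" "\<And>y z. ev h y z \<noteq> 0 \<Longrightarrow> ev (n * q) y z = ev (p * d) y z"
    unfolding generically_def by blast
  \<comment> \<open>Where \<open>h\<close> vanishes the product is 0 anyway, so the generic equation
    becomes an identity, and \<open>h\<close> cancels in the integral domain.\<close>
  have "h * (n * q - p * d) = 0"
    using h(2) by (intro ev_eqI) fastforce
  with h(1) have eq: "n * q = p * d" by simp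
  have "coprime d n" "d \<noteq> 0"
    using assms(2) by (auto simp: lowest_terms_def coprime_commute)
  moreover have "d dvd n * q"
    using eq by simp
  ultimately have "d dvd q"
    by (simp add: coprime_dvd_mult_right_iff)
  then obtain e where e: "q = d * e" by (elim dvdE)
  with eq \<open>d \<noteq> 0\<close> have "p = n * e" by (simp add: algebra_simps)
  with e that p q show ?thesis by force
qed

lemma lowest_terms_exists:
  assumes "has_fraction f N D"
  obtains n d where "lowest_terms f n d"
proof -
  obtain p q where p: "N = ev p" and q: "D = ev q"
    using assms by (auto simp: has_fraction_def polyfun_def nz_def)
  have "q \<noteq> 0" using assms nz_ev[of q] unfolding has_fraction_def q by blast
  note q = q this
  have "gcd p q \<noteq> 0" using q by simp
  then obtain n d where nd: "p = n * gcd p q" "q = d * gcd p q" "coprime n d"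
    using gcd_coprime_exists by blast
  have "generically (\<lambda>y z. f y z = N y z / D y z \<and> ev q y z \<noteq> 0)"
    using assms generically_nz[of D] unfolding has_fraction_def q(1)
    by (intro generically_conj) auto
  hence "generically (\<lambda>y z. f y z * ev d y z = ev n y z)"
  proof (rule generically_mono)
    fix y z assume *: "f y z = N y z / D y z \<and> ev q y z \<noteq> 0"
    have "ev p y z = ev n y z * ev (gcd p q) y z" "ev q y z = ev d y z * ev (gcd p q) y z"
      using nd(1,2) ev_simps(6) by metis+
    thus "f y z * ev d y z = ev n y z" using * p q by (auto simp: field_simps)
  qed
  moreover have "d \<noteq> 0" using q nd by auto
  ultimately show ?thesis using that nd by (auto simp: lowest_terms_def)
qed

lemma has_fraction_den_nonzero:
  assumes "has_fraction f N D" "D a b \<noteq> 0"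
  shows regular_atI: "regular_at f a b" and not_indeterminate_den: "\<not> indeterminate_at f a b"
proof -
  have *: "ev d a b \<noteq> 0" if "lowest_terms f n d" for n d
    using has_fraction_lowest_terms[OF assms(1) that] assms(2) by (metis mult_zero_left)
  thus "\<not> indeterminate_at f a b" by (auto simp: indeterminate_at_def)
  show "regular_at f a b"
    using lowest_terms_exists[OF assms(1)] * unfolding regular_at_def by metis
qed

lemma not_indeterminate_num:
  assumes "has_fraction f N D" "N a b \<noteq> 0"
  shows "\<not> indeterminate_at f a b"
  unfolding indeterminate_at_def
  using has_fraction_lowest_terms[OF assms(1)] assms(2) by (metis mult_zero_left)

lemma not_regular_atI:
  assumes "has_fraction f N D" "N a b \<noteq> 0" "D a b = 0"
  shows "\<not> regular_at f a b"
proof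
  assume "regular_at f a b"
  then obtain n d where nd: "lowest_terms f n d" "ev d a b \<noteq> 0"
    by (auto simp: regular_at_def)
  obtain e where "D a b = ev d a b * ev e a b" "N a b = ev n a b * ev e a b"
    using has_fraction_lowest_terms[OF assms(1) nd(1)] by metis
  with nd assms show False by auto
qed

text \<open>The point \<open>(a', b')\<close> on the curve \<open>\<pi> = 0\<close> shows that
  \<open>\<pi>\<close> does not divide the numerator, so it does not divide the common factor
  \<open>e\<close> either. Hence \<open>e\<close> divides \<open>D\<close> and is nonzero at
  \<open>(a, b)\<close>: removing it leaves numerator and denominator both zero there.\<close>

lemma indeterminate_at_prime:
  assumes f: "has_fraction f N (\<lambda>y z. ev \<pi> y z ^ k * D y z)" and \<pi>: "prime_elem \<pi>" and D: "polyfun D"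
    and k: "k > 0" and ab: "N a b = 0" "D a b \<noteq> 0" "ev \<pi> a b = 0"
    and ab': "N a' b' \<noteq> 0" "ev \<pi> a' b' = 0"
  shows "indeterminate_at f a b"
proof -
  obtain p where p: "N = ev p" using f by (auto simp: has_fraction_def polyfun_def)
  obtain q where q: "D = ev q" using D by (auto simp: polyfun_def)
  obtain n d where nd: "lowest_terms f n d" using lowest_terms_exists[OF f] .
  obtain e where
    e: "\<And>y z. ev \<pi> y z ^ k * D y z = ev d y z * ev e y z" "\<And>y z. N y z = ev n y z * ev e y z"
    using has_fraction_lowest_terms[OF f nd] by metis
  have e1: "\<pi> ^ k * q = d * e" and e2: "p = n * e"
    using e unfolding p q by (auto intro!: ev_eqI)
  have "\<not> \<pi> dvd e"
  proof
    assume "\<pi> dvd e"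
    then obtain r where "e = \<pi> * r" by (elim dvdE)
    with e(2)[of a' b'] ab' show False by simp
  qed
  with \<pi> have "coprime e (\<pi> ^ k)"
    by (metis prime_elem_imp_coprime coprime_commute coprime_power_right_iff)
  moreover have "e dvd \<pi> ^ k * q" using e1 by simp
  ultimately have "e dvd q" by (simp add: coprime_dvd_mult_right_iff)
  then obtain t where "q = e * t" by (elim dvdE)
  with ab q have "ev e a b \<noteq> 0" by auto
  moreover have "ev d a b * ev e a b = 0" "ev n a b * ev e a b = 0"
    using e(1,2)[of a b] ab k by (auto simp: zero_power)
  ultimately show ?thesis using nd by (auto simp: indeterminate_at_def)
qed

text \<open>The general coefficient domain serves both coordinates: \<open>z\<close> is this
  polynomial over \<open>complex poly\<close>, and \<open>y\<close> is the one over
  \<open>complex\<close> lifted to a constant.\<close>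

lemma prime_elem_X: "prime_elem [:0, 1 :: 'a :: idom:]"
proof (rule prime_elemI)
  fix p q :: "'a poly" assume "[:0, 1:] dvd p * q"
  thus "[:0, 1:] dvd p \<or> [:0, 1:] dvd q"
    by (simp add: poly_eq_0_iff_dvd[of _ 0, simplified, symmetric])
qed (auto simp: is_unit_poly_iff)

lemma indeterminate_at_u_axis:
  assumes f: "has_fraction f N E" and E: "E = (\<lambda>u v. u ^ k * D u v)" and D: "polyfun D"
    and k: "k > 0" and ab: "N 0 b = 0" "D 0 b \<noteq> 0" "N 0 d \<noteq> 0"
  shows "indeterminate_at f 0 b"
proof -
  have \<pi>: "ev [:[:0, 1:]:] y z = y" for y z by (simp add: ev_def)
  show ?thesis
    by (rule indeterminate_at_prime[where \<pi> = "[:[:0, 1:]:]" and a' = 0 and b' = d and N = N and D = D and k = k])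
       (use assms in \<open>auto simp: \<pi> lift_prime_elem_poly prime_elem_X\<close>)
qed

lemma indeterminate_at_v_axis:
  assumes f: "has_fraction f N E" and E: "E = (\<lambda>u v. v ^ k * D u v)" and D: "polyfun D"
    and k: "k > 0" and ab: "N a 0 = 0" "D a 0 \<noteq> 0" "N c 0 \<noteq> 0"
  shows "indeterminate_at f a 0"
proof -
  have \<pi>: "ev [:0, 1:] y z = z" for y z by (simp add: ev_def)
  show ?thesis
    by (rule indeterminate_at_prime[where \<pi> = "[:0, 1:]" and a' = c and b' = 0 and N = N and D = D and k = k])
       (use assms in \<open>auto simp: \<pi> prime_elem_X\<close>)
qed

text \<open>The first coordinate of the centre is 0 because every base point that is blown up lies
  on the line at infinity of a projective chart or on an exceptional curve. In \<open>eq\<close> the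
  second component is expressed through the simplified first one
  \<open>N\<^sub>3 / D\<^sub>3\<close>, so each blow-up is a single rational identity, to be checked
  only where no denominator vanishes.\<close>

lemma has_fraction_blowup_uv:
  assumes P: "has_fraction (fst T x) N\<^sub>1 D\<^sub>1" and Q: "has_fraction (snd T x) N\<^sub>2 D\<^sub>2"
    and b: "b x = \<beta>" "deriv b x = \<beta>'" and poly: "polyfun N\<^sub>3" "nz D\<^sub>3" "polyfun N\<^sub>4" "nz D\<^sub>4"
    and eq: "\<And>u v. u \<noteq> 0 \<Longrightarrow> D\<^sub>1 u (u * v + \<beta>) \<noteq> 0 \<Longrightarrow> D\<^sub>2 u (u * v + \<beta>) \<noteq> 0 \<Longrightarrow> D\<^sub>3 u v \<noteq> 0 \<Longrightarrow> D\<^sub>4 u v \<noteq> 0 \<Longrightarrow>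
      N\<^sub>1 u (u * v + \<beta>) / D\<^sub>1 u (u * v + \<beta>) = N\<^sub>3 u v / D\<^sub>3 u v \<and>
      (N\<^sub>2 u (u * v + \<beta>) / D\<^sub>2 u (u * v + \<beta>) - \<beta>' - v * (N\<^sub>3 u v / D\<^sub>3 u v)) / u = N\<^sub>4 u v / D\<^sub>4 u v"
  shows "has_fraction (fst (blowup_uv T (\<lambda>_. 0) b) x) N\<^sub>3 D\<^sub>3 \<and> has_fraction (snd (blowup_uv T (\<lambda>_. 0) b) x) N\<^sub>4 D\<^sub>4"
proof -
  have 1: "generically (\<lambda>u v. fst T x u (u * v + \<beta>) = N\<^sub>1 u (u * v + \<beta>) / D\<^sub>1 u (u * v + \<beta>))"
    using P generically_blowup_uv[of "\<lambda>y z. fst T x y z = N\<^sub>1 y z / D\<^sub>1 y z" 0 \<beta>]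
    by (simp add: has_fraction_def)
  have 2: "generically (\<lambda>u v. snd T x u (u * v + \<beta>) = N\<^sub>2 u (u * v + \<beta>) / D\<^sub>2 u (u * v + \<beta>))"
    using Q generically_blowup_uv[of "\<lambda>y z. snd T x y z = N\<^sub>2 y z / D\<^sub>2 y z" 0 \<beta>]
    by (simp add: has_fraction_def)
  have 3: "generically (\<lambda>u v. D\<^sub>1 u (u * v + \<beta>) \<noteq> 0)" "generically (\<lambda>u v. D\<^sub>2 u (u * v + \<beta>) \<noteq> 0)"
    using P Q generically_nz[OF nz_blowup_uv[of D\<^sub>1 0 \<beta>]] generically_nz[OF nz_blowup_uv[of D\<^sub>2 0 \<beta>]]
    by (auto simp: has_fraction_def)
  have 4: "generically (\<lambda>u v::complex. u \<noteq> 0)"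
    by (intro generically_nz nzI[of _ 1 0]) (auto intro: polyfun_intros)
  note * = generically_conj[OF 1 generically_conj[OF 2 generically_conj[OF 3(1) generically_conj[OF 3(2)
    generically_conj[OF 4 generically_conj[OF generically_nz[OF \<open>nz D\<^sub>3\<close>] generically_nz[OF \<open>nz D\<^sub>4\<close>]]]]]]]
  show ?thesis
    unfolding has_fraction_def using poly
    by (intro conjI poly generically_mono[OF *]) (use eq in \<open>auto simp: blowup_uv_def Let_def b\<close>)
qed

lemma has_fraction_blowup_UV:
  assumes P: "has_fraction (fst T x) N\<^sub>1 D\<^sub>1" and Q: "has_fraction (snd T x) N\<^sub>2 D\<^sub>2"
    and b: "b x = \<beta>" "deriv b x = \<beta>'" and poly: "polyfun N\<^sub>3" "nz D\<^sub>3" "polyfun N\<^sub>4" "nz D\<^sub>4"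
    and eq: "\<And>U V. V \<noteq> 0 \<Longrightarrow> D\<^sub>1 (U * V) (V + \<beta>) \<noteq> 0 \<Longrightarrow> D\<^sub>2 (U * V) (V + \<beta>) \<noteq> 0 \<Longrightarrow> D\<^sub>3 U V \<noteq> 0 \<Longrightarrow> D\<^sub>4 U V \<noteq> 0 \<Longrightarrow>
      N\<^sub>2 (U * V) (V + \<beta>) / D\<^sub>2 (U * V) (V + \<beta>) - \<beta>' = N\<^sub>4 U V / D\<^sub>4 U V \<and>
      (N\<^sub>1 (U * V) (V + \<beta>) / D\<^sub>1 (U * V) (V + \<beta>) - U * (N\<^sub>4 U V / D\<^sub>4 U V)) / V = N\<^sub>3 U V / D\<^sub>3 U V"
  shows "has_fraction (fst (blowup_UV T (\<lambda>_. 0) b) x) N\<^sub>3 D\<^sub>3 \<and> has_fraction (snd (blowup_UV T (\<lambda>_. 0) b) x) N\<^sub>4 D\<^sub>4"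
proof -
  have 1: "generically (\<lambda>U V. fst T x (U * V) (V + \<beta>) = N\<^sub>1 (U * V) (V + \<beta>) / D\<^sub>1 (U * V) (V + \<beta>))"
    using P generically_blowup_UV[of "\<lambda>y z. fst T x y z = N\<^sub>1 y z / D\<^sub>1 y z" 0 \<beta>]
    by (simp add: has_fraction_def)
  have 2: "generically (\<lambda>U V. snd T x (U * V) (V + \<beta>) = N\<^sub>2 (U * V) (V + \<beta>) / D\<^sub>2 (U * V) (V + \<beta>))"
    using Q generically_blowup_UV[of "\<lambda>y z. snd T x y z = N\<^sub>2 y z / D\<^sub>2 y z" 0 \<beta>]
    by (simp add: has_fraction_def)
  have 3: "generically (\<lambda>U V. D\<^sub>1 (U * V) (V + \<beta>) \<noteq> 0)" "generically (\<lambda>U V. D\<^sub>2 (U * V) (V + \<beta>) \<noteq> 0)"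
    using P Q generically_nz[OF nz_blowup_UV[of D\<^sub>1 0 \<beta>]] generically_nz[OF nz_blowup_UV[of D\<^sub>2 0 \<beta>]]
    by (auto simp: has_fraction_def)
  have 4: "generically (\<lambda>U V::complex. V \<noteq> 0)"
    by (intro generically_nz nzI[of _ 0 1]) (auto intro: polyfun_intros)
  note * = generically_conj[OF 1 generically_conj[OF 2 generically_conj[OF 3(1) generically_conj[OF 3(2)
    generically_conj[OF 4 generically_conj[OF generically_nz[OF \<open>nz D\<^sub>3\<close>] generically_nz[OF \<open>nz D\<^sub>4\<close>]]]]]]]
  show ?thesis
    unfolding has_fraction_def using poly
    by (intro conjI poly generically_mono[OF *]) (use eq in \<open>auto simp: blowup_UV_def Let_def b\<close>)
qed

subsection \<open>Resolving base points\<close>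

lemma regular_not_indeterminate: "regular_at f a b \<Longrightarrow> \<not> indeterminate_at f a b"
proof -
  assume "regular_at f a b"
  then obtain n d where nd: "lowest_terms f n d" "ev d a b \<noteq> 0" by (auto simp: regular_at_def)
  have "generically (\<lambda>y z. f y z * ev d y z = ev n y z \<and> ev d y z \<noteq> 0)"
    using nd by (intro generically_conj) (auto simp: lowest_terms_def intro: generically_nz)
  hence "generically (\<lambda>y z. f y z = ev n y z / ev d y z)"
    by (rule generically_mono) (auto simp: field_simps)
  hence "has_fraction f (ev n) (ev d)"
    using nd by (auto simp: has_fraction_def lowest_terms_def polyfun_ev)
  thus ?thesis using nd by (intro not_indeterminate_den)
qed

lemma base_pointD:
  assumes "base_point D T a b" "x \<in> D"
  shows "indeterminate_at (fst T x) (a x) (b x) \<or> indeterminate_at (snd T x) (a x) (b x)"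
  using assms by (auto simp: base_point_def)

lemma base_point_region: "base_point D T a b \<Longrightarrow> region D"
  by (auto simp: base_point_def)

lemma not_base_point:
  assumes "region D" "\<And>x. x \<in> D \<Longrightarrow> \<not> indeterminate_at (fst T x) (a x) (b x) \<and> \<not> indeterminate_at (snd T x) (a x) (b x)"
  shows "\<not> base_point D T a b"
  using assms by (auto simp: base_point_def region_def)

lemma not_indeterminate_both:
  assumes "has_fraction f N\<^sub>1 D\<^sub>1 \<and> has_fraction f' N\<^sub>2 D\<^sub>2"
    and "N\<^sub>1 a b \<noteq> 0 \<or> D\<^sub>1 a b \<noteq> 0" "N\<^sub>2 a b \<noteq> 0 \<or> D\<^sub>2 a b \<noteq> 0"
  shows "\<not> indeterminate_at f a b \<and> \<not> indeterminate_at f' a b"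
  using assms not_indeterminate_den not_indeterminate_num by blast

lemma eventually_cosparse_all:
  assumes "open D" "\<And>x. x \<in> D \<Longrightarrow> P x"
  shows "\<forall>\<^sub>\<approx>x\<in>D. P x"
  using assms eventually_mono[OF eventually_in_cosparse[OF order.refl assms(1)]] by blast

text \<open>The end of a cascade. Regular points are not indeterminate, so no base point exists over
  any subregion and only the regularity clause of \<open>resolvedI\<close> has content.\<close>

lemma resolved_regular:
  assumes "region D"
    "\<And>x c. x \<in> D \<Longrightarrow> regular_at (fst (blowup_uv T a b) x) 0 c \<and> regular_at (snd (blowup_uv T a b) x) 0 c"
    "\<And>x. x \<in> D \<Longrightarrow> \<not> indeterminate_at (fst (blowup_UV T a b) x) 0 0 \<and> \<not> indeterminate_at (snd (blowup_UV T a b) x) 0 0"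
  shows "resolved D T a b"
proof (rule resolvedI)
  fix D' c assume D': "D' \<subseteq> D" and "base_point D' (blowup_uv T a b) (\<lambda>_. 0) c"
  moreover have "\<not> base_point D' (blowup_uv T a b) (\<lambda>_. 0) c"
    using D' base_point_region[OF calculation(2)] assms(2)
    by (intro not_base_point) (auto dest: regular_not_indeterminate)
  ultimately show "resolved D' (blowup_uv T a b) (\<lambda>_. 0) c" by blast
next
  fix D' assume D': "D' \<subseteq> D" and "base_point D' (blowup_UV T a b) (\<lambda>_. 0) (\<lambda>_. 0)"
  moreover have "\<not> base_point D' (blowup_UV T a b) (\<lambda>_. 0) (\<lambda>_. 0)"
    using D' base_point_region[OF calculation(2)] assms(3) by (intro not_base_point) auto
  ultimately show "resolved D' (blowup_UV T a b) (\<lambda>_. 0) (\<lambda>_. 0)" by blast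
next
  show "regular_on_u_axis D (blowup_uv T a b) \<or> regular_on_V_axis D (blowup_UV T a b)"
    using assms(1,2) by (auto simp: regular_on_u_axis_def region_def intro!: eventually_cosparse_all)
qed

text \<open>An inner step of a cascade with a single possible centre \<open>\<beta>\<close>. The
  premise \<open>step\<close> admits every \<open>c\<close> that agrees with \<open>\<beta>\<close>
  on the smaller region, since the values of a base point elsewhere are arbitrary. The regularity
  clause is void because \<open>\<beta>\<close> is itself a base point.\<close>

lemma resolved_through:
  assumes D: "region D" and \<beta>: "\<beta> holomorphic_on D"
    and base: "\<And>x. x \<in> D \<Longrightarrow> indeterminate_at (snd (blowup_uv T a b) x) 0 (\<beta> x)"
    and others: "\<And>x c. x \<in> D \<Longrightarrow> c \<noteq> \<beta> x \<Longrightarrow> \<not> indeterminate_at (fst (blowup_uv T a b) x) 0 c \<and> \<not> indeterminate_at (snd (blowup_uv T a b) x) 0 c"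
    and orig: "\<And>x. x \<in> D \<Longrightarrow> \<not> indeterminate_at (fst (blowup_UV T a b) x) 0 0 \<and> \<not> indeterminate_at (snd (blowup_UV T a b) x) 0 0"
    and step: "\<And>D' c. D' \<subseteq> D \<Longrightarrow> region D' \<Longrightarrow> (\<And>x. x \<in> D' \<Longrightarrow> c x = \<beta> x) \<Longrightarrow> resolved D' (blowup_uv T a b) (\<lambda>_. 0) c"
  shows "resolved D T a b"
proof (rule resolvedI)
  fix D' c assume D': "D' \<subseteq> D" and bp: "base_point D' (blowup_uv T a b) (\<lambda>_. 0) c"
  have "c x = \<beta> x" if "x \<in> D'" for x
    using base_pointD[OF bp that] others[of x "c x"] D' that by auto
  thus "resolved D' (blowup_uv T a b) (\<lambda>_. 0) c"
    using D' base_point_region[OF bp] by (intro step)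
next
  fix D' assume D': "D' \<subseteq> D" and "base_point D' (blowup_UV T a b) (\<lambda>_. 0) (\<lambda>_. 0)"
  moreover have "\<not> base_point D' (blowup_UV T a b) (\<lambda>_. 0) (\<lambda>_. 0)"
    using D' base_point_region[OF calculation(2)] orig by (intro not_base_point) auto
  ultimately show "resolved D' (blowup_UV T a b) (\<lambda>_. 0) (\<lambda>_. 0)" by blast
next
  assume "\<nexists>D' c. D' \<subseteq> D \<and> base_point D' (blowup_uv T a b) (\<lambda>_. 0) c"
  moreover have "base_point D (blowup_uv T a b) (\<lambda>_. 0) \<beta>"
    using D \<beta> base by (auto simp: base_point_def)
  ultimately show "regular_on_u_axis D (blowup_uv T a b) \<or> regular_on_V_axis D (blowup_UV T a b)"
    by blast
qed

subsection \<open>The cascades over the origin of the chart \<open>(u\<^sub>0, v\<^sub>0)\<close>\<close>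

locale cascade =
  fixes \<kappa>0 :: complex and D :: "complex set" and w :: "complex \<Rightarrow> complex"
  assumes D: "region D" and holo_w: "w holomorphic_on D" and w_nz: "\<And>x. x \<in> D \<Longrightarrow> w x \<noteq> 0"
begin

lemma open_D: "open D" using D by (simp add: region_def)

lemma restrict: "D' \<subseteq> D \<Longrightarrow> region D' \<Longrightarrow> cascade D' w"
  using holo_w w_nz by (auto simp: cascade_def intro: holomorphic_on_subset)

lemma deriv_eq_on: "(\<And>x. x \<in> D \<Longrightarrow> f x = f' x) \<Longrightarrow> x \<in> D \<Longrightarrow> deriv f x = deriv f' x"
  using open_D by (intro deriv_cong_ev) (auto simp: eventually_nhds)

definition m where "m x = (\<kappa>0 + deriv w x - w x ^ 2) / w x"
text \<open>This is \<open>shift\<close> for \<open>w\<close>, rewritten through \<open>m\<close>: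
  the z_4 that Hamilton's first equation attaches to y_4 = w.\<close>

definition g where "g x = (2 * x + 2 * w x + m x) / 4"

lemma holo_w': "deriv w holomorphic_on D"
  by (intro holomorphic_deriv holo_w open_D)

lemma holo_m: "m holomorphic_on D"
  unfolding m_def[abs_def] using w_nz by (auto intro!: holomorphic_intros holo_w holo_w')

lemma holo_g: "g holomorphic_on D"
  unfolding g_def[abs_def] by (intro holomorphic_intros holo_w holo_m) auto

lemma deriv_w: "x \<in> D \<Longrightarrow> deriv w x = w x * m x + w x ^ 2 - \<kappa>0"
  using w_nz[of x] by (simp add: m_def field_simps)

text \<open>
  With \<open>\<kappa>0\<close> eliminated in favour of \<open>m\<close>, the transformed system is
  \<open>y' = - 6 y\<^sup>2 z - 4 w y\<^sup>2 + 3 y z - 2 m y + 2 g\<close>, \<open>z' = 4 y z\<^sup>2 + 4 w y z - z\<^sup>2 + m z\<close>.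
  In the lemmas below, \<open>T\<close> is any system that agrees generically with the one displayed by its
  numerators and denominators.
\<close>

lemma resolved_zero:
  assumes T: "\<And>x. x \<in> D \<Longrightarrow>
      has_fraction (fst T x) (\<lambda>u v. 6 * v + 4 * w x - 3 * u * v + 2 * m x * u - 2 * g x * u^2) (\<lambda>u v. 1) \<and>
      has_fraction (snd T x) (\<lambda>u v. 4 * v^2 + 4 * w x * v - u * v^2 + m x * u * v) (\<lambda>u v. u)"
    and c: "\<And>x. x \<in> D \<Longrightarrow> c x = 0"
  shows "resolved D T (\<lambda>_. 0) c"
proof (rule resolved_regular[OF D])
  fix x b assume x: "x \<in> D"
  have c': "c x = 0" "deriv c x = 0"
    using c x deriv_eq_on[of c "\<lambda>_. 0" x] by auto
  have "has_fraction (fst (blowup_uv T (\<lambda>_. 0) c) x)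
          (\<lambda>u v. 6 * u * v + 4 * w x - 3 * u^2 * v + 2 * m x * u - 2 * g x * u^2) (\<lambda>u v. 1) \<and>
        has_fraction (snd (blowup_uv T (\<lambda>_. 0) c) x)
          (\<lambda>u v. - 2 * v^2 + 2 * u * v^2 - m x * v + 2 * g x * u * v) (\<lambda>u v. 1)"
    by (rule has_fraction_blowup_uv[OF T[OF x, THEN conjunct1] T[OF x, THEN conjunct2] c'])
       (auto intro!: polyfun_intros nzI simp: field_simps power2_eq_square)
  thus "regular_at (fst (blowup_uv T (\<lambda>_. 0) c) x) 0 b \<and> regular_at (snd (blowup_uv T (\<lambda>_. 0) c) x) 0 b"
    by (auto intro: regular_atI)
next
  fix x assume x: "x \<in> D"
  have c': "c x = 0" "deriv c x = 0"
    using c x deriv_eq_on[of c "\<lambda>_. 0" x] by auto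
  have "has_fraction (fst (blowup_UV T (\<lambda>_. 0) c) x)
          (\<lambda>U V. 2 - 2 * U * V + m x * U - 2 * g x * U^2 * V) (\<lambda>U V. 1) \<and>
        has_fraction (snd (blowup_UV T (\<lambda>_. 0) c) x)
          (\<lambda>U V. 4 * V + 4 * w x - V^2 * U + m x * V * U) (\<lambda>U V. U)"
    by (rule has_fraction_blowup_UV[OF T[OF x, THEN conjunct1] T[OF x, THEN conjunct2] c'])
       (auto intro!: polyfun_intros nzI[of _ 1 1] simp: field_simps power2_eq_square)
  thus "\<not> indeterminate_at (fst (blowup_UV T (\<lambda>_. 0) c) x) 0 0 \<and> \<not> indeterminate_at (snd (blowup_UV T (\<lambda>_. 0) c) x) 0 0"
    by (rule not_indeterminate_both) (use w_nz[OF x] in auto)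
qed

text \<open>This resonance costs nothing. The constant left on \<open>u = 0\<close> after the
  blow-up is - 2 c^2 - w c - m c - c', and it vanishes because the centre satisfies the Riccati
  equation c' = - c (m + w + 2 c). The latter is \<open>deriv_w\<close> rewritten for c = -
  \<kappa>0 / (2 w), so it holds for every \<open>w\<close>.\<close>

lemma resolved_last_uv:
  assumes T: "\<And>x. x \<in> D \<Longrightarrow>
      has_fraction (fst T x) (\<lambda>u v. - 2 * w x + 6 * u * v + 3 * w x * u - 3 * u^2 * v + 2 * m x * u - 2 * g x * u^2) (\<lambda>u v. 1) \<and>
      has_fraction (snd T x) (\<lambda>u v. - 2 * w x * v - \<kappa>0 + u * (- 2 * v^2 - w x * v - m x * v) + u^2 * (2 * v^2 + 2 * g x * v)) (\<lambda>u v. u)"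
    and c: "\<And>x. x \<in> D \<Longrightarrow> c x = - \<kappa>0 / (2 * w x)"
  shows "resolved D T (\<lambda>_. 0) c"
proof -
  have c': "deriv c x = - c x * (m x + w x + 2 * c x)" "\<kappa>0 = - 2 * w x * c x" if x: "x \<in> D" for x
  proof -
    have "deriv c x = deriv (\<lambda>x. - \<kappa>0 / (2 * w x)) x"
      by (rule deriv_eq_on[OF c x])
    also have "\<dots> = \<kappa>0 * deriv w x / (2 * w x ^ 2)"
      using w_nz[OF x] holomorphic_derivI[OF holo_w open_D x]
      by (intro DERIV_imp_deriv) (auto intro!: derivative_eq_intros simp: field_simps power2_eq_square)
    also have "\<dots> = - c x * (m x + w x + 2 * c x)"
      unfolding deriv_w[OF x] c[OF x] using w_nz[OF x] by (simp add: field_simps power2_eq_square)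
    finally show "deriv c x = - c x * (m x + w x + 2 * c x)" .
    show "\<kappa>0 = - 2 * w x * c x" using c[OF x] w_nz[OF x] by simp
  qed
  show ?thesis
  proof (rule resolved_regular[OF D])
    fix x b assume x: "x \<in> D"
    have "has_fraction (fst (blowup_uv T (\<lambda>_. 0) c) x)
            (\<lambda>u v. - 2 * w x + 6 * u * (u * v + c x) + 3 * w x * u - 3 * u^2 * (u * v + c x) + 2 * m x * u - 2 * g x * u^2) (\<lambda>u v. 1) \<and>
          has_fraction (snd (blowup_uv T (\<lambda>_. 0) c) x)
            (\<lambda>u v. - 4 * c x * v - (w x + m x) * v + 2 * (u * v + c x)^2 + 2 * g x * (u * v + c x) - 2 * u * v^2
              - v * (6 * (u * v + c x) + 3 * w x + 2 * m x - 2 * g x * u - 3 * u * (u * v + c x))) (\<lambda>u v. 1)"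
      by (rule has_fraction_blowup_uv[OF T[OF x, THEN conjunct1] T[OF x, THEN conjunct2] refl c'(1)[OF x]])
         (auto intro!: polyfun_intros nzI simp: c'(2)[OF x] field_simps power2_eq_square)
    thus "regular_at (fst (blowup_uv T (\<lambda>_. 0) c) x) 0 b \<and> regular_at (snd (blowup_uv T (\<lambda>_. 0) c) x) 0 b"
      by (auto intro: regular_atI)
  next
    fix x assume x: "x \<in> D"
    have "has_fraction (fst (blowup_UV T (\<lambda>_. 0) c) x)
            (\<lambda>U V. 6 * U * (V + c x) + 3 * w x * U + 2 * m x * U - 2 * g x * U^2 * V - 3 * U^2 * V * (V + c x)
              + U * (2 * (V + 2 * c x) + w x + m x) - U^2 * (2 * (V + c x)^2 + 2 * g x * (V + c x))) (\<lambda>U V. 1) \<and>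
          has_fraction (snd (blowup_UV T (\<lambda>_. 0) c) x)
            (\<lambda>U V. - 2 * w x - U * V * (2 * (V + 2 * c x) + w x + m x) + U^2 * V * (2 * (V + c x)^2 + 2 * g x * (V + c x))) (\<lambda>U V. U)"
      by (rule has_fraction_blowup_UV[OF T[OF x, THEN conjunct1] T[OF x, THEN conjunct2] refl c'(1)[OF x]])
         (auto intro!: polyfun_intros nzI[of _ 1 1] simp: c'(2)[OF x] field_simps power2_eq_square)
    thus "\<not> indeterminate_at (fst (blowup_UV T (\<lambda>_. 0) c) x) 0 0 \<and> \<not> indeterminate_at (snd (blowup_UV T (\<lambda>_. 0) c) x) 0 0"
      by (rule not_indeterminate_both) (use w_nz[OF x] in auto)
  qed
qed

text \<open>After this blow-up the numerator on \<open>u = 0\<close> is - 2 w v - \<kappa>0; as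
  \<open>w\<close> has no zeros, it has the single root - \<kappa>0 / (2 w), the next
  centre.\<close>

lemma resolved_minus_w:
  assumes T: "\<And>x. x \<in> D \<Longrightarrow>
      has_fraction (fst T x) (\<lambda>u v. 6 * v + 4 * w x - 3 * u * v + 2 * m x * u - 2 * g x * u^2) (\<lambda>u v. 1) \<and>
      has_fraction (snd T x) (\<lambda>u v. 4 * v^2 + 4 * w x * v - u * v^2 + m x * u * v) (\<lambda>u v. u)"
    and c: "\<And>x. x \<in> D \<Longrightarrow> c x = - w x"
  shows "resolved D T (\<lambda>_. 0) c"
proof -
  have c': "deriv c x = \<kappa>0 - w x * m x - w x ^ 2" if x: "x \<in> D" for x
  proof -
    have "deriv c x = deriv (\<lambda>x. - w x) x"
      by (rule deriv_eq_on[OF c x])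
    also have "\<dots> = - deriv w x"
      by (intro DERIV_imp_deriv DERIV_minus holomorphic_derivI[OF holo_w open_D x])
    finally show ?thesis using deriv_w[OF x] by simp
  qed
  have uv: "has_fraction (fst (blowup_uv T (\<lambda>_. 0) c) x)
            (\<lambda>u v. - 2 * w x + 6 * u * v + 3 * w x * u - 3 * u^2 * v + 2 * m x * u - 2 * g x * u^2) (\<lambda>u v. 1) \<and>
          has_fraction (snd (blowup_uv T (\<lambda>_. 0) c) x)
            (\<lambda>u v. - 2 * w x * v - \<kappa>0 + u * (- 2 * v^2 - w x * v - m x * v) + u^2 * (2 * v^2 + 2 * g x * v)) (\<lambda>u v. u)"
    if x: "x \<in> D" for x
    by (rule has_fraction_blowup_uv[OF T[OF x, THEN conjunct1] T[OF x, THEN conjunct2] c[OF x] c'[OF x]])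
       (auto intro!: polyfun_intros nzI[of _ 1 1] simp: field_simps power2_eq_square)
  show ?thesis
  proof (rule resolved_through[OF D, where \<beta> = "\<lambda>x. - \<kappa>0 / (2 * w x)"])
    show "(\<lambda>x. - \<kappa>0 / (2 * w x)) holomorphic_on D"
      using w_nz by (intro holomorphic_intros holo_w) auto
  next
    fix x assume x: "x \<in> D"
    \<comment> \<open>The witness \<open>d\<close> is chosen so that the numerator equals - 1 there,
      whatever \<kappa>0 is.\<close>
    show "indeterminate_at (snd (blowup_uv T (\<lambda>_. 0) c) x) 0 (- \<kappa>0 / (2 * w x))"
      by (rule indeterminate_at_u_axis[OF uv[OF x, THEN conjunct2], where k = 1 and D = "\<lambda>u v. 1" and d = "(1 - \<kappa>0) / (2 * w x)"])
         (use w_nz[OF x] in \<open>auto intro: polyfun_intros\<close>)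
    have "has_fraction (fst (blowup_UV T (\<lambda>_. 0) c) x)
            (\<lambda>U V. 2 * w x + \<kappa>0 * U + V * (2 + w x * U + m x * U) - U * V^2 * (2 + 2 * g x * U)) (\<lambda>U V. V) \<and>
          has_fraction (snd (blowup_UV T (\<lambda>_. 0) c) x)
            (\<lambda>U V. 4 * V - 4 * w x + U * (2 * w x * V + m x * V - V^2 - \<kappa>0)) (\<lambda>U V. U)"
      by (rule has_fraction_blowup_UV[OF T[OF x, THEN conjunct1] T[OF x, THEN conjunct2] c[OF x] c'[OF x]])
         (auto intro!: polyfun_intros nzI[of _ 1 1] simp: field_simps power2_eq_square)
    thus "\<not> indeterminate_at (fst (blowup_UV T (\<lambda>_. 0) c) x) 0 0 \<and> \<not> indeterminate_at (snd (blowup_UV T (\<lambda>_. 0) c) x) 0 0"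
      by (rule not_indeterminate_both) (use w_nz[OF x] in auto)
  next
    fix x b assume x: "x \<in> D" and b: "b \<noteq> - \<kappa>0 / (2 * w x)"
    show "\<not> indeterminate_at (fst (blowup_uv T (\<lambda>_. 0) c) x) 0 b \<and> \<not> indeterminate_at (snd (blowup_uv T (\<lambda>_. 0) c) x) 0 b"
      using uv[OF x] by (rule not_indeterminate_both) (use b w_nz[OF x] in \<open>auto simp: field_simps add_eq_0_iff\<close>)
  next
    fix D' b assume D': "D' \<subseteq> D" "region D'" "\<And>x. x \<in> D' \<Longrightarrow> b x = - \<kappa>0 / (2 * w x)"
    show "resolved D' (blowup_uv T (\<lambda>_. 0) c) (\<lambda>_. 0) b"
      using D' uv by (intro cascade.resolved_last_uv[OF restrict]) auto
  qed
qed

text \<open>On the first exceptional curve the pole of the second equation has coefficient 4 v (v +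
  w). Its two roots are distinct because \<open>w\<close> has no zeros, and the cascade splits into
  two branches.\<close>

lemma resolved_chart_uv:
  assumes T: "\<And>x. x \<in> D \<Longrightarrow>
      has_fraction (fst T x) (\<lambda>u v. 6 * v + 4 * w x * u - 3 * u * v + 2 * m x * u^2 - 2 * g x * u^3) (\<lambda>u v. u) \<and>
      has_fraction (snd T x) (\<lambda>u v. 10 * v^2 + 8 * w x * u * v - 4 * u * v^2 + 3 * m x * u^2 * v - 2 * g x * u^3 * v) (\<lambda>u v. u^2)"
    and c: "\<And>x. x \<in> D \<Longrightarrow> c x = 0"
  shows "resolved D T (\<lambda>_. 0) c"
proof -
  have c': "c x = 0" "deriv c x = 0" if "x \<in> D" for x
    using c that deriv_eq_on[of c "\<lambda>_. 0" x] by auto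
  have uv: "has_fraction (fst (blowup_uv T (\<lambda>_. 0) c) x)
            (\<lambda>u v. 6 * v + 4 * w x - 3 * u * v + 2 * m x * u - 2 * g x * u^2) (\<lambda>u v. 1) \<and>
          has_fraction (snd (blowup_uv T (\<lambda>_. 0) c) x)
            (\<lambda>u v. 4 * v^2 + 4 * w x * v - u * v^2 + m x * u * v) (\<lambda>u v. u)"
    if x: "x \<in> D" for x
    by (rule has_fraction_blowup_uv[OF T[OF x, THEN conjunct1] T[OF x, THEN conjunct2] c'[OF x]])
       (auto intro!: polyfun_intros nzI[of _ 1 1] simp: field_simps power2_eq_square power3_eq_cube)
  have UV: "has_fraction (fst (blowup_UV T (\<lambda>_. 0) c) x)
            (\<lambda>U V. - 4 - 4 * w x * U + U * V - m x * U^2 * V) (\<lambda>U V. U * V) \<and>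
          has_fraction (snd (blowup_UV T (\<lambda>_. 0) c) x)
            (\<lambda>U V. 10 + 8 * w x * U - 4 * U * V + 3 * m x * U^2 * V - 2 * g x * U^3 * V^2) (\<lambda>U V. U^2)"
    if x: "x \<in> D" for x
    by (rule has_fraction_blowup_UV[OF T[OF x, THEN conjunct1] T[OF x, THEN conjunct2] c'[OF x]])
       (auto intro!: polyfun_intros nzI[of _ 1 1] simp: field_simps power2_eq_square power3_eq_cube)
  have orig: "\<not> indeterminate_at (fst (blowup_UV T (\<lambda>_. 0) c) x) 0 0 \<and> \<not> indeterminate_at (snd (blowup_UV T (\<lambda>_. 0) c) x) 0 0"
    if "x \<in> D" for x
    using UV[OF that] by (rule not_indeterminate_both) auto
  show ?thesis
  proof (rule resolvedI)
    fix D' b assume D': "D' \<subseteq> D" and bp: "base_point D' (blowup_uv T (\<lambda>_. 0) c) (\<lambda>_. 0) b"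
    have reg: "region D'" and holo_b: "b holomorphic_on D'" using bp by (auto simp: base_point_def)
    have b: "b x = 0 \<or> b x = - w x" if x: "x \<in> D'" for x
    proof (rule ccontr)
      assume "\<not> (b x = 0 \<or> b x = - w x)"
      hence "4 * b x * (b x + w x) \<noteq> 0"
        by (auto simp: add_eq_0_iff2)
      hence "4 * (b x)^2 + 4 * w x * b x \<noteq> 0"
        by (simp add: algebra_simps power2_eq_square)
      hence "\<not> indeterminate_at (fst (blowup_uv T (\<lambda>_. 0) c) x) 0 (b x) \<and> \<not> indeterminate_at (snd (blowup_uv T (\<lambda>_. 0) c) x) 0 (b x)"
        using x D' by (intro not_indeterminate_both[OF uv]) auto
      thus False using base_pointD[OF bp x] by blast
    qed
    \<comment> \<open>Pointwise the centre is one of two roots, but one branch has to be followed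
      over all of \<open>D'\<close>. The quotient \<open>b / w\<close> is continuous with finitely
      many values on a connected region, hence constant.\<close>
    have "(\<lambda>x. b x / w x) ` D' \<subseteq> {0, -1}"
      using b w_nz D' by force
    hence "finite ((\<lambda>x. b x / w x) ` D')"
      by (rule finite_subset) auto
    moreover have "continuous_on D' (\<lambda>x. b x / w x)"
      using D' w_nz holo_b holomorphic_on_subset[OF holo_w]
      by (intro continuous_intros holomorphic_on_imp_continuous_on) auto
    ultimately have "(\<lambda>x. b x / w x) constant_on D'"
      using reg by (intro continuous_finite_range_constant) (auto simp: region_def)
    then obtain k where k: "\<And>x. x \<in> D' \<Longrightarrow> b x / w x = k"
      by (auto simp: constant_on_def)
    have bk: "b x = k * w x" if "x \<in> D'" for x
      using k[OF that] w_nz D' that by (auto simp: field_simps)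
    obtain x0 where x0: "x0 \<in> D'" using reg by (auto simp: region_def)
    have "k = 0 \<or> k = -1"
      using k[OF x0] b[OF x0] w_nz[of x0] x0 D' by auto
    thus "resolved D' (blowup_uv T (\<lambda>_. 0) c) (\<lambda>_. 0) b"
    proof
      assume "k = 0"
      thus ?thesis using D' uv bk by (intro cascade.resolved_zero[OF restrict[OF D' reg]]) auto
    next
      assume "k = -1"
      thus ?thesis using D' uv bk by (intro cascade.resolved_minus_w[OF restrict[OF D' reg]]) auto
    qed
  next
    fix D' assume D': "D' \<subseteq> D" and "base_point D' (blowup_UV T (\<lambda>_. 0) c) (\<lambda>_. 0) (\<lambda>_. 0)"
    moreover have "\<not> base_point D' (blowup_UV T (\<lambda>_. 0) c) (\<lambda>_. 0) (\<lambda>_. 0)"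
      using D' base_point_region[OF calculation(2)] orig by (intro not_base_point) auto
    ultimately show "resolved D' (blowup_UV T (\<lambda>_. 0) c) (\<lambda>_. 0) (\<lambda>_. 0)" by blast
  next
    assume none: "\<nexists>D' b. D' \<subseteq> D \<and> base_point D' (blowup_uv T (\<lambda>_. 0) c) (\<lambda>_. 0) b"
    have "indeterminate_at (snd (blowup_uv T (\<lambda>_. 0) c) x) 0 0" if x: "x \<in> D" for x
      by (rule indeterminate_at_u_axis[OF uv[OF x, THEN conjunct2], where k = 1 and D = "\<lambda>u v. 1" and d = "w x"])
         (use w_nz[OF x] in \<open>auto intro: polyfun_intros simp: power2_eq_square\<close>)
    hence "base_point D (blowup_uv T (\<lambda>_. 0) c) (\<lambda>_. 0) (\<lambda>_. 0)"
      using D by (auto simp: base_point_def)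
    with none show "regular_on_u_axis D (blowup_uv T (\<lambda>_. 0) c) \<or> regular_on_V_axis D (blowup_UV T (\<lambda>_. 0) c)"
      by blast
  qed
qed

end

subsection \<open>The cascade over the point \<open>(0, 2)\<close>\<close>

text \<open>
  In this cascade the second coordinate \<open>v = t\<close> of the first blow-up equals \<open>2 + u v\<close>,
  \<open>2 + u (r + u v)\<close> and so on in the later charts, and the first equation is always
  \<open>u' = (4 t - 10 + u B(t)) / t\<^sup>2\<close>. The polynomials below are \<open>B\<close>, the polynomial \<open>R\<close> that appears in
  the second equation, and their iterated difference quotients at \<open>t = 2\<close>, which make the
  cancellation of \<open>u\<close> in each blow-up explicit.
\<close>

definition polyB :: "complex \<Rightarrow> complex \<Rightarrow> complex \<Rightarrow> complex \<Rightarrow> complex" where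
  "polyB w m g t = t * (- 8 * w - 3 * m * t + 2 * g * t^2)"

definition polyB_quotient :: "complex \<Rightarrow> complex \<Rightarrow> complex \<Rightarrow> complex \<Rightarrow> complex" where
  "polyB_quotient w m g t = - 8 * w - 3 * m * (t + 2) + 2 * g * (t^2 + 2 * t + 4)"

definition polyR :: "complex \<Rightarrow> complex \<Rightarrow> complex \<Rightarrow> complex \<Rightarrow> complex" where
  "polyR w m g t = (8 * w + 8 * m - 16 * g) + t * (12 * w + 4 * m - 8 * g) + t^2 * (5 * m - 4 * g) - 4 * g * t^3"

definition polyR_quotient :: "complex \<Rightarrow> complex \<Rightarrow> complex \<Rightarrow> complex \<Rightarrow> complex" where
  "polyR_quotient w m g t = (12 * w + 4 * m - 8 * g) + (5 * m - 4 * g) * (t + 2) - 4 * g * (t^2 + 2 * t + 4)"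

definition polyR_quotient2 :: "complex \<Rightarrow> complex \<Rightarrow> complex \<Rightarrow> complex" where
  "polyR_quotient2 m g t = (5 * m - 4 * g) - 4 * g * (t + 4)"

lemma polyB_eq: "polyB w m g t = polyB w m g 2 + (t - 2) * polyB_quotient w m g t"
  unfolding polyB_def polyB_quotient_def by algebra

lemma polyR_eq: "polyR w m g t = polyR w m g 2 + (t - 2) * polyR_quotient w m g t"
  unfolding polyR_def polyR_quotient_def by algebra

lemma polyR_quotient_eq: "polyR_quotient w m g t = polyR_quotient w m g 2 + (t - 2) * polyR_quotient2 m g t"
  unfolding polyR_quotient_def polyR_quotient2_def by algebra

text \<open>After the blow-up at \<open>r\<close> the second numerator is - 2 (z - s) + u G, with G
  this polynomial and \<open>r'\<close> the derivative of the moving centre. The value of G at (s,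
  r, 2) minus 4 s' is what remains on \<open>u = 0\<close> after the next blow-up; the 4 is t^2 at t
  = 2.\<close>

definition polyG :: "complex \<Rightarrow> complex \<Rightarrow> complex \<Rightarrow> complex \<Rightarrow> complex \<Rightarrow> complex \<Rightarrow> complex \<Rightarrow> complex \<Rightarrow> complex" where
  "polyG w m g r r' z v t = z * polyR w m g 2 + v^2 * polyR_quotient w m g t - 7 * z * (v + r) - r' * v * (t + 2)
     - z * (4 * v + polyB w m g t)"

text \<open>At \<open>u = 0\<close> the left-hand side is the resonance defect, which the last
  hypothesis makes vanish. The difference quotients then display the factor \<open>u\<close>, and
  the bracket is the numerator of a regular equation.\<close>

lemma polyG_uv:
  fixes u y z v t :: complex
  assumes "z = s + u * y" "v = r + u * z" "t = 2 + u * v" "polyG w m g r r' s r 2 = 4 * s'"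
  shows "polyG w m g r r' z v t - s' * t^2 - y * u * (4 * v + polyB w m g t) =
    u * (y * polyR w m g 2 + z * (v + r) * polyR_quotient w m g t + r^2 * v * polyR_quotient2 m g t - 7 * (y * (v + r) + s * z)
      - r' * (z * (t + 2) + r * v) - 2 * y * (4 * v + polyB w m g t) - s * (4 * z + v * polyB_quotient w m g t) - s' * v * (t + 2))"
proof -
  have "t - 2 = u * v" using assms(3) by simp
  hence q: "polyR_quotient w m g t = polyR_quotient w m g 2 + u * v * polyR_quotient2 m g t" "polyB w m g t = polyB w m g 2 + u * v * polyB_quotient w m g t"
    using polyR_quotient_eq[of w m g t] polyB_eq[of w m g t] by simp_all
  show ?thesis
    using assms q unfolding polyG_def by algebra
qed

text \<open>The same expansion in the other chart, but with the defect kept as a constant term, so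
  that it also covers the non-resonant case.\<close>

lemma polyG_UV:
  fixes U V z v t :: complex
  assumes "z = s + V" "v = r + U * V * z" "t = 2 + U * V * v"
  shows "polyG w m g r r' z v t - s' * t^2 - V * (4 * v + polyB w m g t) =
    polyG w m g r r' s r 2 - 4 * s' +
    V * (polyR w m g 2 + U * z * (v + r) * polyR_quotient w m g t + r^2 * U * v * polyR_quotient2 m g t - 7 * (v + r + s * U * z)
      - r' * U * (z * (t + 2) + r * v) - 2 * (4 * v + polyB w m g t) - s * U * (4 * z + v * polyB_quotient w m g t) - s' * U * v * (t + 2))"
proof -
  have "t - 2 = U * V * v" using assms(3) by simp
  hence q: "polyR_quotient w m g t = polyR_quotient w m g 2 + U * V * v * polyR_quotient2 m g t" "polyB w m g t = polyB w m g 2 + U * V * v * polyB_quotient w m g t"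
    using polyR_quotient_eq[of w m g t] polyB_eq[of w m g t] by simp_all
  show ?thesis
    using assms q unfolding polyG_def by algebra
qed


lemma polyfun_uv: "polyfun f \<Longrightarrow> polyfun (\<lambda>u v. f u (u * v))"
  by (rule polyfun_compose[of f "\<lambda>u v. u" "\<lambda>u v. u * v"]) (auto intro!: polyfun_intros)

lemma polyfun_UV: "polyfun f \<Longrightarrow> polyfun (\<lambda>u v. f (u * v) v)"
  by (rule polyfun_compose[of f "\<lambda>u v. u * v" "\<lambda>u v. v"]) (auto intro!: polyfun_intros)

lemma polyfun_polyB: "polyfun t \<Longrightarrow> polyfun (\<lambda>y z. polyB w m g (t y z))"
  unfolding polyB_def by (intro polyfun_intros)

lemma polyfun_polyB_quotient: "polyfun t \<Longrightarrow> polyfun (\<lambda>y z. polyB_quotient w m g (t y z))"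
  unfolding polyB_quotient_def by (intro polyfun_intros)

lemma polyfun_polyR: "polyfun t \<Longrightarrow> polyfun (\<lambda>y z. polyR w m g (t y z))"
  unfolding polyR_def by (intro polyfun_intros)

lemma polyfun_polyR_quotient: "polyfun t \<Longrightarrow> polyfun (\<lambda>y z. polyR_quotient w m g (t y z))"
  unfolding polyR_quotient_def by (intro polyfun_intros)

lemma polyfun_polyR_quotient2: "polyfun t \<Longrightarrow> polyfun (\<lambda>y z. polyR_quotient2 m g (t y z))"
  unfolding polyR_quotient2_def by (intro polyfun_intros)

lemma polyfun_polyG:
  "polyfun Z \<Longrightarrow> polyfun v \<Longrightarrow> polyfun t \<Longrightarrow> polyfun (\<lambda>y z. polyG w m g r r' (Z y z) (v y z) (t y z))"
  unfolding polyG_def by (intro polyfun_intros polyfun_polyB polyfun_polyR_quotient)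

lemmas polyfun_cascade = polyfun_polyB polyfun_polyB_quotient polyfun_polyR polyfun_polyR_quotient polyfun_polyR_quotient2 polyfun_polyG

lemma quotient_uv:
  fixes u v X P N T \<beta>' :: complex
  assumes "u \<noteq> 0" "T \<noteq> 0"
  shows "X = u * T * \<beta>' + u * v * P + u * N \<Longrightarrow> (X / (u * T) - \<beta>' - v * (P / T)) / u = N / (u * T)"
    and "X = u * T * \<beta>' + u * v * P + u * u * N \<Longrightarrow> (X / (u * T) - \<beta>' - v * (P / T)) / u = N / T"
  using assms by (simp_all add: field_simps)

lemma quotient_uv_mixed:
  fixes u v X P N t :: complex
  assumes "u \<noteq> 0" "t \<noteq> 0" "X * t = u * v * P + u * N"
  shows "(X / (u * t) - v * (P / t^2)) / u = N / (u * t^2)"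
proof -
  have "X = (u * v * P + u * N) / t" using assms by (simp add: field_simps)
  thus ?thesis using assms(1,2) by (simp add: field_simps power2_eq_square)
qed

lemma quotient_UV:
  fixes U V X P N T \<beta>' :: complex
  assumes "U \<noteq> 0" "V \<noteq> 0" "T \<noteq> 0"
  shows "X = U * V * T * \<beta>' + V * N \<Longrightarrow> X / (U * V * T) - \<beta>' = N / (U * T)"
    and "(P / T - U * (N / (U * T))) / V = (P - N) / (V * T)"
    and "P - N = V * H \<Longrightarrow> (P / T - U * (N / (U * T))) / V = H / T"
  using assms by (simp_all add: field_simps)

lemma resolved_uvD: "resolved D T a b \<Longrightarrow> base_point D (blowup_uv T a b) (\<lambda>_. 0) c \<Longrightarrow> resolved D (blowup_uv T a b) (\<lambda>_. 0) c"
  by (erule resolved.cases) auto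

lemma resolved_UVD:
  "resolved D T a b \<Longrightarrow> base_point D (blowup_UV T a b) (\<lambda>_. 0) (\<lambda>_. 0) \<Longrightarrow> resolved D (blowup_UV T a b) (\<lambda>_. 0) (\<lambda>_. 0)"
  by (erule resolved.cases) auto

text \<open>Regularity is demanded only off a sparse set, so a pole is assumed over every
  \<open>x\<close>. As \<open>D\<close> is nonempty and open, its cosparse filter is proper, and one
  point where regularity was claimed gives the contradiction. Both charts must fail, since
  regularity in either would do.\<close>

lemma not_resolvedI:
  assumes "region D"
    "\<And>x c. x \<in> D \<Longrightarrow> \<not> indeterminate_at (fst (blowup_uv T a b) x) 0 c \<and> \<not> indeterminate_at (snd (blowup_uv T a b) x) 0 c"
    "\<And>x. x \<in> D \<Longrightarrow> \<not> indeterminate_at (fst (blowup_UV T a b) x) 0 0 \<and> \<not> indeterminate_at (snd (blowup_UV T a b) x) 0 0"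
    "\<And>x. x \<in> D \<Longrightarrow> \<exists>c. \<not> regular_at (snd (blowup_uv T a b) x) 0 c"
    "\<And>x. x \<in> D \<Longrightarrow> \<exists>c. \<not> regular_at (fst (blowup_UV T a b) x) c 0"
  shows "\<not> resolved D T a b"
proof
  assume "resolved D T a b"
  hence "(\<nexists>D' c. D' \<subseteq> D \<and> base_point D' (blowup_uv T a b) (\<lambda>_. 0) c) \<Longrightarrow>
     (\<nexists>D'. D' \<subseteq> D \<and> base_point D' (blowup_UV T a b) (\<lambda>_. 0) (\<lambda>_. 0)) \<Longrightarrow>
        regular_on_u_axis D (blowup_uv T a b) \<or> regular_on_V_axis D (blowup_UV T a b)"
    by (rule resolved.cases) blast
  moreover have "\<nexists>D' c. D' \<subseteq> D \<and> base_point D' (blowup_uv T a b) (\<lambda>_. 0) c"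
  proof (intro notI, elim exE conjE)
    fix D' c assume "D' \<subseteq> D" and bp: "base_point D' (blowup_uv T a b) (\<lambda>_. 0) c"
    thus False
      using not_base_point[OF base_point_region[OF bp], of "blowup_uv T a b" "\<lambda>_. 0" c] assms(2) by blast
  qed
  moreover have "\<nexists>D'. D' \<subseteq> D \<and> base_point D' (blowup_UV T a b) (\<lambda>_. 0) (\<lambda>_. 0)"
  proof (intro notI, elim exE conjE)
    fix D' assume "D' \<subseteq> D" and bp: "base_point D' (blowup_UV T a b) (\<lambda>_. 0) (\<lambda>_. 0)"
    thus False
      using not_base_point[OF base_point_region[OF bp], of "blowup_UV T a b" "\<lambda>_. 0" "\<lambda>_. 0"] assms(3) by blast
  qed
  ultimately have "regular_on_u_axis D (blowup_uv T a b) \<or> regular_on_V_axis D (blowup_UV T a b)"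
    by blast
  hence "\<forall>\<^sub>\<approx>x\<in>D. (\<forall>c. regular_at (snd (blowup_uv T a b) x) 0 c) \<or> (\<forall>c. regular_at (fst (blowup_UV T a b) x) c 0)"
    unfolding regular_on_u_axis_def regular_on_V_axis_def
    by (elim disjE) (auto elim: eventually_mono)
  moreover have "cosparse D \<noteq> bot" "\<forall>\<^sub>\<approx>x\<in>D. x \<in> D"
    using assms(1) by (auto simp: region_def intro: eventually_in_cosparse)
  ultimately have "\<exists>x. x \<in> D \<and> ((\<forall>c. regular_at (snd (blowup_uv T a b) x) 0 c) \<or> (\<forall>c. regular_at (fst (blowup_UV T a b) x) c 0))"
    by (intro eventually_happens'[of "cosparse D"] eventually_conj)
  thus False using assms(4,5) by blast
qed

context cascade
begin

text \<open>\<open>r\<close> and \<open>s\<close> are the next centres: the numerators on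
  \<open>u = 0\<close> after the blow-ups at 2 and at \<open>r\<close> are - 4 (v - r) and - 2 (z -
  s). The derivative in \<open>s\<close> comes from the motion of the centre
  \<open>r\<close>.\<close>

definition r where "r x = 4 * (w x + m x - 2 * g x)"
definition s where "s x = r x * (polyR (w x) (m x) (g x) 2 - 7 * r x) / 2 - 2 * deriv r x"

text \<open>The absence of a pole along the last exceptional curve.\<close>

definition resonant where
  "resonant x \<longleftrightarrow> polyG (w x) (m x) (g x) (r x) (deriv r x) (s x) (r x) 2 = 4 * deriv s x"

lemma holo_r: "r holomorphic_on D"
  unfolding r_def[abs_def] by (intro holomorphic_intros holo_w holo_m holo_g)

lemma holo_s: "s holomorphic_on D"
  unfolding s_def[abs_def] polyR_def by (intro holomorphic_intros holo_w holo_m holo_g holo_r open_D) auto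

text \<open>Only the constant in the first numerator, the resonance defect, matters;
  \<open>H\<close> and \<open>G\<close> remain arbitrary polynomial functions. That \<open>t\<close>
  equals 2 on both axes keeps the factor \<open>t^2\<close> of the denominators away from 0. No
  resonance is assumed, so the positive and the negative result share this chart.\<close>

definition last_chart where
  "last_chart x S H G t \<longleftrightarrow> polyfun H \<and> polyfun G \<and> polyfun t \<and> (\<forall>U. t U 0 = 2) \<and> (\<forall>V. t 0 V = 2) \<and>
     has_fraction (fst S x)
       (\<lambda>U V. - U * (polyG (w x) (m x) (g x) (r x) (deriv r x) (s x) (r x) 2 - 4 * deriv s x + V * H U V)) (\<lambda>U V. V * (t U V)^2) \<and>
     has_fraction (snd S x) (\<lambda>U V. - 2 + U * G U V) (\<lambda>U V. U * (t U V)^2)"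

lemma blowup_s_UV:
  assumes T:
      "has_fraction (fst T x) (\<lambda>u z. 4 * (u * (u * z + r x) + 2) - 10 + u * polyB (w x) (m x) (g x) (u * (u * z + r x) + 2))
         (\<lambda>u z. (u * (u * z + r x) + 2)^2)"
      "has_fraction (snd T x) (\<lambda>u z. - 2 * (z - s x) + u * polyG (w x) (m x) (g x) (r x) (deriv r x) z (u * z + r x) (u * (u * z + r x) + 2))
         (\<lambda>u z. u * (u * (u * z + r x) + 2)^2)"
    and c: "c x = s x" "deriv c x = deriv s x"
  shows "\<exists>H G t. last_chart x (blowup_UV T (\<lambda>_. 0) c) H G t"
proof -
  define t where "t = (\<lambda>U V. U * V * (U * V * (V + s x) + r x) + 2)"
  define H where "H = (\<lambda>U V. polyR (w x) (m x) (g x) 2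
     + U * (V + s x) * ((U * V * (V + s x) + r x) + r x) * polyR_quotient (w x) (m x) (g x) (t U V)
     + (r x)^2 * U * (U * V * (V + s x) + r x) * polyR_quotient2 (m x) (g x) (t U V)
     - 7 * ((U * V * (V + s x) + r x) + r x + s x * U * (V + s x))
     - deriv r x * U * ((V + s x) * (t U V + 2) + r x * (U * V * (V + s x) + r x))
     - 2 * (4 * (U * V * (V + s x) + r x) + polyB (w x) (m x) (g x) (t U V))
     - s x * U * (4 * (V + s x) + (U * V * (V + s x) + r x) * polyB_quotient (w x) (m x) (g x) (t U V))
     - deriv s x * U * (U * V * (V + s x) + r x) * (t U V + 2))"
  have "polyfun t"
    unfolding t_def by (intro polyfun_intros)
  moreover from this have "polyfun H"
    unfolding H_def by (intro polyfun_intros polyfun_cascade)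
  ultimately have poly: "polyfun t" "polyfun H"
    by blast+
  have t1: "t U 0 = 2" "t 0 V = 2" for U V by (auto simp: t_def)
  have "has_fraction (fst (blowup_UV T (\<lambda>_. 0) c) x)
       (\<lambda>U V. - U * (polyG (w x) (m x) (g x) (r x) (deriv r x) (s x) (r x) 2 - 4 * deriv s x + V * H U V)) (\<lambda>U V. V * (t U V)^2)
    \<and> has_fraction (snd (blowup_UV T (\<lambda>_. 0) c) x)
       (\<lambda>U V. - 2 + U * (polyG (w x) (m x) (g x) (r x) (deriv r x) (V + s x) (U * V * (V + s x) + r x) (t U V) - deriv s x * (t U V)^2))
       (\<lambda>U V. U * (t U V)^2)"
  proof (rule has_fraction_blowup_UV[OF T c], goal_cases)
    case 2
    show ?case by (rule nzI[of _ 0 1]) (auto intro!: polyfun_intros poly simp: t1)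
  next
    case 4
    show ?case by (rule nzI[of _ 1 0]) (auto intro!: polyfun_intros poly simp: t1)
  next
    case (5 U V)
    define z where "z = V + s x"
    define v where "v = U * V * z + r x"
    have t: "t U V = U * V * v + 2" by (simp add: t_def v_def z_def)
    have nz: "U \<noteq> 0" "V \<noteq> 0" "(t U V)^2 \<noteq> 0" using 5 by auto
    note key = polyG_UV[of z "s x" V v "r x" U "t U V" "w x" "m x" "g x" "deriv r x" "deriv s x"]
    have key': "polyG (w x) (m x) (g x) (r x) (deriv r x) z v (t U V) - deriv s x * (t U V)^2 - V * (4 * v + polyB (w x) (m x) (g x) (t U V)) =
      polyG (w x) (m x) (g x) (r x) (deriv r x) (s x) (r x) 2 - 4 * deriv s x + V * H U V"
      unfolding H_def z_def[symmetric] v_def[symmetric]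
      by (rule key) (auto simp: z_def v_def t_def add.commute)
    show ?case
      unfolding z_def[symmetric] v_def[symmetric] t[symmetric]
    proof (intro conjI)
      show "(- 2 * (z - s x) + U * V * polyG (w x) (m x) (g x) (r x) (deriv r x) z v (t U V)) / (U * V * (t U V)\<^sup>2) - deriv s x =
        (- 2 + U * (polyG (w x) (m x) (g x) (r x) (deriv r x) z v (t U V) - deriv s x * (t U V)\<^sup>2)) / (U * (t U V)\<^sup>2)"
        by (rule quotient_UV(1)[OF nz]) (simp add: z_def algebra_simps)
      show "((4 * t U V - 10 + U * V * polyB (w x) (m x) (g x) (t U V)) / (t U V)\<^sup>2 -
          U * ((- 2 + U * (polyG (w x) (m x) (g x) (r x) (deriv r x) z v (t U V) - deriv s x * (t U V)\<^sup>2)) / (U * (t U V)\<^sup>2))) / V =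
        - U * (polyG (w x) (m x) (g x) (r x) (deriv r x) (s x) (r x) 2 - 4 * deriv s x + V * H U V) / (V * (t U V)\<^sup>2)"
        unfolding quotient_UV(2)[OF nz] key'[symmetric]
        by (rule arg_cong2[of _ _ _ _ "(/)"]) (simp_all add: t algebra_simps)
    qed
  qed (intro polyfun_intros poly polyfun_cascade)+
  moreover have "polyfun (\<lambda>U V. polyG (w x) (m x) (g x) (r x) (deriv r x) (V + s x) (U * V * (V + s x) + r x) (t U V) - deriv s x * (t U V)^2)"
    by (intro polyfun_intros poly polyfun_cascade)
  ultimately have "last_chart x (blowup_UV T (\<lambda>_. 0) c) H (\<lambda>U V. polyG (w x) (m x) (g x) (r x) (deriv r x) (V + s x) (U * V * (V + s x) + r x) (t U V) - deriv s x * (t U V)^2) t"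
    using poly t1 unfolding last_chart_def by blast
  thus ?thesis by blast
qed

lemma resolved_s:
  assumes T: "\<And>x. x \<in> D \<Longrightarrow>
      has_fraction (fst T x) (\<lambda>u z. 4 * (u * (u * z + r x) + 2) - 10 + u * polyB (w x) (m x) (g x) (u * (u * z + r x) + 2))
         (\<lambda>u z. (u * (u * z + r x) + 2)^2) \<and>
      has_fraction (snd T x) (\<lambda>u z. - 2 * (z - s x) + u * polyG (w x) (m x) (g x) (r x) (deriv r x) z (u * z + r x) (u * (u * z + r x) + 2))
         (\<lambda>u z. u * (u * (u * z + r x) + 2)^2)"
    and c: "\<And>x. x \<in> D \<Longrightarrow> c x = s x"
    and res: "\<And>x. x \<in> D \<Longrightarrow> resonant x"
  shows "resolved D T (\<lambda>_. 0) c"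
proof -
  have c': "c x = s x" "deriv c x = deriv s x" if "x \<in> D" for x
    using c that deriv_eq_on[of c s x] by auto
  show ?thesis
  proof (rule resolved_regular[OF D])
    fix x b assume x: "x \<in> D"
    define H where "H = (\<lambda>u y. y * polyR (w x) (m x) (g x) 2
       + (u * y + s x) * ((u * (u * y + s x) + r x) + r x) * polyR_quotient (w x) (m x) (g x) (u * (u * (u * y + s x) + r x) + 2)
       + (r x)^2 * (u * (u * y + s x) + r x) * polyR_quotient2 (m x) (g x) (u * (u * (u * y + s x) + r x) + 2)
       - 7 * (y * ((u * (u * y + s x) + r x) + r x) + s x * (u * y + s x))
       - deriv r x * ((u * y + s x) * ((u * (u * (u * y + s x) + r x) + 2) + 2) + r x * (u * (u * y + s x) + r x))
       - 2 * y * (4 * (u * (u * y + s x) + r x) + polyB (w x) (m x) (g x) (u * (u * (u * y + s x) + r x) + 2))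
       - s x * (4 * (u * y + s x) + (u * (u * y + s x) + r x) * polyB_quotient (w x) (m x) (g x) (u * (u * (u * y + s x) + r x) + 2))
       - deriv s x * (u * (u * y + s x) + r x) * ((u * (u * (u * y + s x) + r x) + 2) + 2))"
    have "polyfun H"
      unfolding H_def by (intro polyfun_intros polyfun_cascade)
    have "has_fraction (fst (blowup_uv T (\<lambda>_. 0) c) x)
            (\<lambda>u y. 4 * (u * (u * (u * y + s x) + r x) + 2) - 10 + u * polyB (w x) (m x) (g x) (u * (u * (u * y + s x) + r x) + 2))
            (\<lambda>u y. (u * (u * (u * y + s x) + r x) + 2)^2) \<and>
          has_fraction (snd (blowup_uv T (\<lambda>_. 0) c) x) H (\<lambda>u y. (u * (u * (u * y + s x) + r x) + 2)^2)"
    proof (rule has_fraction_blowup_uv[OF T[OF x, THEN conjunct1] T[OF x, THEN conjunct2] c'[OF x]], goal_cases)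
      case (5 u y)
      define z where "z = u * y + s x"
      define v where "v = u * z + r x"
      define t where "t = u * v + 2"
      have nz: "u \<noteq> 0" "t^2 \<noteq> 0" using 5 by (auto simp: t_def v_def z_def)
      have "polyG (w x) (m x) (g x) (r x) (deriv r x) z v t - deriv s x * t^2 - y * u * (4 * v + polyB (w x) (m x) (g x) t) = u * H u y"
        unfolding H_def z_def[symmetric] v_def[symmetric] t_def[symmetric]
        by (rule polyG_uv) (use res[OF x] in \<open>auto simp: z_def v_def t_def resonant_def add.commute\<close>)
      hence key: "polyG (w x) (m x) (g x) (r x) (deriv r x) z v t = u * H u y + deriv s x * t^2 + y * u * (4 * v + polyB (w x) (m x) (g x) t)"
        by (simp add: algebra_simps)
      have zt: "z - s x = u * y" "4 * t - 10 = 4 * (u * v) - 2"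
        by (auto simp: z_def t_def)
      show ?case
        unfolding z_def[symmetric] v_def[symmetric] t_def[symmetric]
      proof (intro conjI refl quotient_uv(2)[OF nz])
        show "- 2 * (z - s x) + u * polyG (w x) (m x) (g x) (r x) (deriv r x) z v t =
          u * t^2 * deriv s x + u * y * (4 * t - 10 + u * polyB (w x) (m x) (g x) t) + u * u * H u y"
          unfolding key zt by algebra
      qed
    qed (auto intro!: polyfun_intros polyfun_cascade nzI[of _ 0 0] \<open>polyfun H\<close>)
    thus "regular_at (fst (blowup_uv T (\<lambda>_. 0) c) x) 0 b \<and> regular_at (snd (blowup_uv T (\<lambda>_. 0) c) x) 0 b"
      by (auto intro: regular_atI)
  next
    fix x assume x: "x \<in> D"
    obtain H G t where chart: "last_chart x (blowup_UV T (\<lambda>_. 0) c) H G t"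
      using blowup_s_UV[OF T[OF x, THEN conjunct1] T[OF x, THEN conjunct2] c'[OF x]] by blast
    have Ht: "polyfun H" "polyfun G" "polyfun t" "\<And>U. t U 0 = 2" "\<And>V. t 0 V = 2"
      and 1: "has_fraction (fst (blowup_UV T (\<lambda>_. 0) c) x)
         (\<lambda>U V. - U * (polyG (w x) (m x) (g x) (r x) (deriv r x) (s x) (r x) 2 - 4 * deriv s x + V * H U V)) (\<lambda>U V. V * (t U V)^2)"
      and 2: "has_fraction (snd (blowup_UV T (\<lambda>_. 0) c) x) (\<lambda>U V. - 2 + U * G U V) (\<lambda>U V. U * (t U V)^2)"
      using chart unfolding last_chart_def by auto
    \<comment> \<open>With resonance the numerator contains a factor \<open>V\<close>. It has to be
      cancelled before the origin can be judged, since numerator and denominator of the unreduced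
      quotient both vanish there.\<close>
    have "generically (\<lambda>U V. fst (blowup_UV T (\<lambda>_. 0) c) x U V = - U * (V * H U V) / (V * (t U V)^2))"
      using 1 res[OF x] by (simp add: has_fraction_def resonant_def)
    moreover have "generically (\<lambda>U V. V \<noteq> 0)"
      by (intro generically_nz nzI[of _ 0 1] polyfun_intros) auto
    ultimately have "generically (\<lambda>U V. fst (blowup_UV T (\<lambda>_. 0) c) x U V = - U * (V * H U V) / (V * (t U V)^2) \<and> V \<noteq> 0)"
      by (rule generically_conj)
    hence "generically (\<lambda>U V. fst (blowup_UV T (\<lambda>_. 0) c) x U V = (- U * H U V) / (t U V)^2)"
      by (rule generically_mono) auto
    hence "has_fraction (fst (blowup_UV T (\<lambda>_. 0) c) x) (\<lambda>U V. - U * H U V) (\<lambda>U V. (t U V)^2)"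
      by (auto simp: has_fraction_def Ht intro!: polyfun_intros nzI[of _ 0 0])
    from conjI[OF this 2] show "\<not> indeterminate_at (fst (blowup_UV T (\<lambda>_. 0) c) x) 0 0 \<and> \<not> indeterminate_at (snd (blowup_UV T (\<lambda>_. 0) c) x) 0 0"
      by (rule not_indeterminate_both) (auto simp: Ht)
  qed
qed

text \<open>
  Without resonance the origin of the last chart \<open>(U, V)\<close> is one more base point; blowing it up
  leaves poles along the exceptional curve in both charts but no further base point.
\<close>

lemma not_resolved_s:
  assumes T: "\<And>x. x \<in> D \<Longrightarrow>
      has_fraction (fst T x) (\<lambda>u z. 4 * (u * (u * z + r x) + 2) - 10 + u * polyB (w x) (m x) (g x) (u * (u * z + r x) + 2))
         (\<lambda>u z. (u * (u * z + r x) + 2)^2) \<and>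
      has_fraction (snd T x) (\<lambda>u z. - 2 * (z - s x) + u * polyG (w x) (m x) (g x) (r x) (deriv r x) z (u * z + r x) (u * (u * z + r x) + 2))
         (\<lambda>u z. u * (u * (u * z + r x) + 2)^2)"
    and c: "\<And>x. x \<in> D \<Longrightarrow> c x = s x"
    and res: "\<And>x. x \<in> D \<Longrightarrow> \<not> resonant x"
  shows "\<not> resolved D T (\<lambda>_. 0) c"
proof
  assume "resolved D T (\<lambda>_. 0) c"
  define T' where "T' = blowup_UV T (\<lambda>_. 0) c"
  define k where "k x = polyG (w x) (m x) (g x) (r x) (deriv r x) (s x) (r x) 2 - 4 * deriv s x" for x
  have k: "k x \<noteq> 0" if "x \<in> D" for x
    using res[OF that] by (simp add: k_def resonant_def)
  let ?uv = "blowup_uv T' (\<lambda>_. 0) (\<lambda>_. 0)" and ?UV = "blowup_UV T' (\<lambda>_. 0) (\<lambda>_. 0)"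
  have *: "indeterminate_at (fst T' x) 0 0 \<and>
      (\<forall>b. \<not> indeterminate_at (fst ?uv x) 0 b \<and> \<not> indeterminate_at (snd ?uv x) 0 b) \<and>
      (\<not> indeterminate_at (fst ?UV x) 0 0 \<and> \<not> indeterminate_at (snd ?UV x) 0 0) \<and>
      \<not> regular_at (snd ?uv x) 0 0 \<and> \<not> regular_at (fst ?UV x) 0 0" if x: "x \<in> D" for x
  proof -
    have c': "c x = s x" "deriv c x = deriv s x"
      using c x deriv_eq_on[of c s x] by auto
    obtain H G t where "last_chart x T' H G t"
      using blowup_s_UV[OF T[OF x, THEN conjunct1] T[OF x, THEN conjunct2] c'] unfolding T'_def by blast
    hence poly: "polyfun H" "polyfun G" "polyfun t"
      and t: "\<And>U. t U 0 = 2" "\<And>V. t 0 V = 2"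
      and T': "has_fraction (fst T' x) (\<lambda>U V. - U * (k x + V * H U V)) (\<lambda>U V. V * (t U V)^2)"
        "has_fraction (snd T' x) (\<lambda>U V. - 2 + U * G U V) (\<lambda>U V. U * (t U V)^2)"
      unfolding last_chart_def k_def by auto
    have zero: "(\<lambda>_::complex. 0::complex) x = 0" "deriv (\<lambda>_. 0::complex) x = 0"
      by simp_all
    have uv: "has_fraction (fst ?uv x)
        (\<lambda>u v. - (k x + u * v * H u (u * v))) (\<lambda>u v. v * (t u (u * v))^2) \<and>
      has_fraction (snd ?uv x)
        (\<lambda>u v. - 2 + u * G u (u * v) + u * (k x + u * v * H u (u * v))) (\<lambda>u v. u^2 * (t u (u * v))^2)"
    proof -
      have poly': "polyfun (\<lambda>u v. H u (u * v))" "polyfun (\<lambda>u v. G u (u * v))" "polyfun (\<lambda>u v. t u (u * v))"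
        by (rule polyfun_uv[OF poly(1)], rule polyfun_uv[OF poly(2)], rule polyfun_uv[OF poly(3)])
      show ?thesis
      proof (rule has_fraction_blowup_uv[OF T' zero], goal_cases)
        case (5 u v)
        hence "u \<noteq> 0" "v \<noteq> 0" "t u (u * v) \<noteq> 0" by auto
        thus ?case by (simp add: field_simps power2_eq_square)
      next
        case 2
        show ?case by (rule nzI[of _ 0 1]) (auto intro!: polyfun_intros poly' simp: t)
      next
        case 4
        have "nz (\<lambda>u v. u^2)"
          by (rule nzI[of _ 1 0]) (auto intro!: polyfun_intros)
        moreover have "nz (\<lambda>u v. (t u (u * v))^2)"
          by (rule nzI[of _ 0 0]) (auto intro!: polyfun_intros poly' simp: t)
        ultimately show ?case by (rule nz_mult)
      qed (intro polyfun_intros poly')+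
    qed
    have UV: "has_fraction (fst ?UV x)
        (\<lambda>U V. 2 - U * V * G (U * V) V - U * V * (k x + V * H (U * V) V)) (\<lambda>U V. V^2 * (t (U * V) V)^2) \<and>
      has_fraction (snd ?UV x)
        (\<lambda>U V. - 2 + U * V * G (U * V) V) (\<lambda>U V. U * V * (t (U * V) V)^2)"
    proof -
      have poly': "polyfun (\<lambda>u v. H (u * v) v)" "polyfun (\<lambda>u v. G (u * v) v)" "polyfun (\<lambda>u v. t (u * v) v)"
        by (rule polyfun_UV[OF poly(1)], rule polyfun_UV[OF poly(2)], rule polyfun_UV[OF poly(3)])
      show ?thesis
      proof (rule has_fraction_blowup_UV[OF T' zero], goal_cases)
        case (5 U V)
        hence "U \<noteq> 0" "V \<noteq> 0" "t (U * V) V \<noteq> 0" by auto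
        thus ?case by (simp add: field_simps power2_eq_square)
      next
        case 2
        show ?case by (rule nzI[of _ 0 1]) (auto intro!: polyfun_intros poly' simp: t)
      next
        case 4
        have "nz (\<lambda>u v. u * v)"
          by (rule nzI[of _ 1 1]) (auto intro!: polyfun_intros)
        moreover have "nz (\<lambda>u v. (t (u * v) v)^2)"
          by (rule nzI[of _ 0 0]) (auto intro!: polyfun_intros poly' simp: t)
        ultimately show ?case by (rule nz_mult)
      qed (intro polyfun_intros poly')+
    qed
    have "indeterminate_at (fst T' x) 0 0"
      by (rule indeterminate_at_v_axis[OF T'(1), where k = 1 and D = "\<lambda>U V. (t U V)^2" and c = 1])
         (use k[OF x] t x in \<open>auto intro!: polyfun_intros poly\<close>)
    moreover have "\<not> indeterminate_at (fst ?uv x) 0 b \<and> \<not> indeterminate_at (snd ?uv x) 0 b" for b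
      using uv by (rule not_indeterminate_both) (use k[OF x] in auto)
    moreover have "\<not> indeterminate_at (fst ?UV x) 0 0 \<and> \<not> indeterminate_at (snd ?UV x) 0 0"
      using UV by (rule not_indeterminate_both) auto
    \<comment> \<open>The numerators are - 2 and 2 at the two origins, independently of the defect
      \<open>k\<close>. The defect is what makes the origin of \<open>T'\<close> a base point and
      excludes further ones after its blow-up.\<close>
    moreover have "\<not> regular_at (snd ?uv x) 0 0" "\<not> regular_at (fst ?UV x) 0 0"
      using not_regular_atI[OF uv[THEN conjunct2], of 0 0] not_regular_atI[OF UV[THEN conjunct1], of 0 0] by auto
    ultimately show ?thesis by blast
  qed
  have "base_point D T' (\<lambda>_. 0) (\<lambda>_. 0)"
    using D * by (auto simp: base_point_def)
  with \<open>resolved D T (\<lambda>_. 0) c\<close> have "resolved D T' (\<lambda>_. 0) (\<lambda>_. 0)"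
    unfolding T'_def by (rule resolved_UVD)
  moreover have "\<not> resolved D T' (\<lambda>_. 0) (\<lambda>_. 0)"
    by (rule not_resolvedI[OF D]) (use * in blast)+
  ultimately show False by blast
qed

lemma blowup_r_uv:
  assumes T: "\<And>x. x \<in> D \<Longrightarrow>
      has_fraction (fst T x) (\<lambda>u v. 4 * (u * v + 2) - 10 + u * polyB (w x) (m x) (g x) (u * v + 2)) (\<lambda>u v. (u * v + 2)^2) \<and>
      has_fraction (snd T x) (\<lambda>u v. - 4 * (v - r x) + u * v * (polyR (w x) (m x) (g x) (u * v + 2) - 7 * v)) (\<lambda>u v. u * (u * v + 2)^2)"
    and c: "\<And>x. x \<in> D \<Longrightarrow> c x = r x" and x: "x \<in> D"
  shows "has_fraction (fst (blowup_uv T (\<lambda>_. 0) c) x)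
           (\<lambda>u z. 4 * (u * (u * z + r x) + 2) - 10 + u * polyB (w x) (m x) (g x) (u * (u * z + r x) + 2))
           (\<lambda>u z. (u * (u * z + r x) + 2)^2) \<and>
         has_fraction (snd (blowup_uv T (\<lambda>_. 0) c) x)
           (\<lambda>u z. - 2 * (z - s x) + u * polyG (w x) (m x) (g x) (r x) (deriv r x) z (u * z + r x) (u * (u * z + r x) + 2))
           (\<lambda>u z. u * (u * (u * z + r x) + 2)^2)"
proof -
  have c': "deriv c x = deriv r x" by (rule deriv_eq_on[OF c x])
  show ?thesis
  proof (rule has_fraction_blowup_uv[OF T[OF x, THEN conjunct1] T[OF x, THEN conjunct2] c[OF x] c'], goal_cases)
    case (5 u z)
    define v where "v = u * z + r x"
    define t where "t = u * v + 2"
    have nz: "u \<noteq> 0" "t^2 \<noteq> 0" using 5 by (auto simp: t_def v_def)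
    have R: "polyR (w x) (m x) (g x) t = polyR (w x) (m x) (g x) 2 + u * v * polyR_quotient (w x) (m x) (g x) t"
      using polyR_eq[of "w x" "m x" "g x" t] by (simp add: t_def)
    have s: "2 * s x = r x * (polyR (w x) (m x) (g x) 2 - 7 * r x) - 4 * deriv r x"
      by (simp add: s_def)
    show ?case
      unfolding v_def[symmetric] t_def[symmetric]
    proof (intro conjI refl quotient_uv(1)[OF nz])
      show "- 4 * (v - r x) + u * v * (polyR (w x) (m x) (g x) t - 7 * v) = u * t^2 * deriv r x
         + u * z * (4 * t - 10 + u * polyB (w x) (m x) (g x) t) + u * (- 2 * (z - s x) + u * polyG (w x) (m x) (g x) (r x) (deriv r x) z v t)"
        using s unfolding polyG_def R unfolding v_def t_def by algebra
    qed
  qed (auto intro!: polyfun_intros polyfun_cascade nzI[of _ 1 "- r x"])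
qed

lemma blowup_r_UV:
  assumes T: "\<And>x. x \<in> D \<Longrightarrow>
      has_fraction (fst T x) (\<lambda>u v. 4 * (u * v + 2) - 10 + u * polyB (w x) (m x) (g x) (u * v + 2)) (\<lambda>u v. (u * v + 2)^2) \<and>
      has_fraction (snd T x) (\<lambda>u v. - 4 * (v - r x) + u * v * (polyR (w x) (m x) (g x) (u * v + 2) - 7 * v)) (\<lambda>u v. u * (u * v + 2)^2)"
    and c: "\<And>x. x \<in> D \<Longrightarrow> c x = r x" and x: "x \<in> D"
  shows "\<not> indeterminate_at (fst (blowup_UV T (\<lambda>_. 0) c) x) 0 0 \<and> \<not> indeterminate_at (snd (blowup_UV T (\<lambda>_. 0) c) x) 0 0"
proof -
  have c': "deriv c x = deriv r x" by (rule deriv_eq_on[OF c x])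
  define t where "t = (\<lambda>U V. U * V * (V + r x) + 2)"
  define N where "N = (\<lambda>U V. - 4 + U * (V + r x) * (polyR (w x) (m x) (g x) (t U V) - 7 * (V + r x)) - U * (t U V)^2 * deriv r x)"
  have poly_t: "polyfun t"
    unfolding t_def by (intro polyfun_intros)
  hence poly_N: "polyfun N"
    unfolding N_def by (intro polyfun_intros polyfun_cascade)
  have "has_fraction (fst (blowup_UV T (\<lambda>_. 0) c) x)
      (\<lambda>U V. 4 * t U V - 10 + U * V * polyB (w x) (m x) (g x) (t U V) - N U V) (\<lambda>U V. V * (t U V)^2) \<and>
    has_fraction (snd (blowup_UV T (\<lambda>_. 0) c) x) N (\<lambda>U V. U * (t U V)^2)"
  proof (rule has_fraction_blowup_UV[OF T[OF x, THEN conjunct1] T[OF x, THEN conjunct2] c[OF x] c'], goal_cases)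
    case (5 U V)
    have t: "U * V * (V + r x) + 2 = t U V" by (simp add: t_def)
    have nz: "U \<noteq> 0" "V \<noteq> 0" "(t U V)^2 \<noteq> 0" using 5 by (auto simp: t_def)
    show ?case
      unfolding t
      by (intro conjI quotient_UV(1)[OF nz] quotient_UV(2)[OF nz]) (simp add: N_def algebra_simps)
  next
    case 2
    show ?case by (rule nzI[of _ 0 1]) (auto intro!: polyfun_intros poly_t simp del: power_eq_0_iff, simp add: t_def)
  next
    case 4
    show ?case by (rule nzI[of _ 1 0]) (auto intro!: polyfun_intros poly_t simp del: power_eq_0_iff, simp add: t_def)
  qed (intro polyfun_intros polyfun_cascade poly_t poly_N)+
  thus ?thesis
    by (rule not_indeterminate_both) (auto simp: N_def t_def)
qed

lemma blowup_two_uv: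
  assumes T: "\<And>x. x \<in> D \<Longrightarrow>
      has_fraction (fst T x) (\<lambda>u t. 4 * t - 10 + u * polyB (w x) (m x) (g x) t) (\<lambda>u t. t^2) \<and>
      has_fraction (snd T x) (\<lambda>u t. 6 - 3 * t + u * t * (4 * w x + 2 * m x * t - 2 * g x * t^2)) (\<lambda>u t. u * t)"
    and c: "\<And>x. x \<in> D \<Longrightarrow> c x = 2" and x: "x \<in> D"
  shows "has_fraction (fst (blowup_uv T (\<lambda>_. 0) c) x)
           (\<lambda>u v. 4 * (u * v + 2) - 10 + u * polyB (w x) (m x) (g x) (u * v + 2)) (\<lambda>u v. (u * v + 2)^2) \<and>
         has_fraction (snd (blowup_uv T (\<lambda>_. 0) c) x)
           (\<lambda>u v. - 4 * (v - r x) + u * v * (polyR (w x) (m x) (g x) (u * v + 2) - 7 * v)) (\<lambda>u v. u * (u * v + 2)^2)"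
proof -
  have c': "deriv c x = 0" using deriv_eq_on[of c "\<lambda>_. 2", OF c x] by simp
  show ?thesis
  proof (rule has_fraction_blowup_uv[OF T[OF x, THEN conjunct1] T[OF x, THEN conjunct2] c[OF x] c'], goal_cases)
    case (5 u v)
    define t where "t = u * v + 2"
    have nz: "u \<noteq> 0" "t \<noteq> 0" using 5 by (auto simp: t_def)
    have "(6 - 3 * t + u * t * (4 * w x + 2 * m x * t - 2 * g x * t^2)) * t =
        u * v * (4 * t - 10 + u * polyB (w x) (m x) (g x) t) + u * (- 4 * (v - r x) + u * v * (polyR (w x) (m x) (g x) t - 7 * v))"
      unfolding r_def polyB_def polyR_def t_def by algebra
    hence "((6 - 3 * t + u * t * (4 * w x + 2 * m x * t - 2 * g x * t^2)) / (u * t) - v * ((4 * t - 10 + u * polyB (w x) (m x) (g x) t) / t^2)) / u =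
      (- 4 * (v - r x) + u * v * (polyR (w x) (m x) (g x) t - 7 * v)) / (u * t^2)"
      using nz by (intro quotient_uv_mixed) auto
    thus ?case unfolding t_def diff_zero by blast
  qed (auto intro!: polyfun_intros polyfun_cascade nzI[of _ 1 0])
qed

lemma blowup_two_UV:
  assumes T: "\<And>x. x \<in> D \<Longrightarrow>
      has_fraction (fst T x) (\<lambda>u t. 4 * t - 10 + u * polyB (w x) (m x) (g x) t) (\<lambda>u t. t^2) \<and>
      has_fraction (snd T x) (\<lambda>u t. 6 - 3 * t + u * t * (4 * w x + 2 * m x * t - 2 * g x * t^2)) (\<lambda>u t. u * t)"
    and c: "\<And>x. x \<in> D \<Longrightarrow> c x = 2" and x: "x \<in> D"
  shows "\<not> indeterminate_at (fst (blowup_UV T (\<lambda>_. 0) c) x) 0 0 \<and> \<not> indeterminate_at (snd (blowup_UV T (\<lambda>_. 0) c) x) 0 0"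
proof -
  have c': "deriv c x = 0" using deriv_eq_on[of c "\<lambda>_. 2", OF c x] by simp
  define N where "N = (\<lambda>U V. - 3 + U * (V + 2) * (4 * w x + 2 * m x * (V + 2) - 2 * g x * (V + 2)^2))"
  have poly_N: "polyfun N"
    unfolding N_def by (intro polyfun_intros polyfun_cascade)
  have "has_fraction (fst (blowup_UV T (\<lambda>_. 0) c) x)
      (\<lambda>U V. 4 * (V + 2) - 10 + U * V * polyB (w x) (m x) (g x) (V + 2) - (V + 2) * N U V) (\<lambda>U V. V * (V + 2)^2) \<and>
    has_fraction (snd (blowup_UV T (\<lambda>_. 0) c) x) N (\<lambda>U V. U * (V + 2))"
  proof (rule has_fraction_blowup_UV[OF T[OF x, THEN conjunct1] T[OF x, THEN conjunct2] c[OF x] c'], goal_cases)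
    case (5 U V)
    define t where "t = V + 2"
    have nz: "U \<noteq> 0" "V \<noteq> 0" "t \<noteq> 0" using 5 by (auto simp: t_def)
    have "6 - 3 * t + U * V * t * (4 * w x + 2 * m x * t - 2 * g x * t^2) = V * N U V"
      unfolding N_def by (simp add: t_def algebra_simps)
    moreover have "(4 * t - 10 + U * V * polyB (w x) (m x) (g x) t) / t\<^sup>2 - U * (N U V / (U * t)) =
        (4 * t - 10 + U * V * polyB (w x) (m x) (g x) t - t * N U V) / t^2"
      using nz by (simp add: field_simps power2_eq_square)
    ultimately show ?case
      using nz unfolding t_def[symmetric] by simp
  qed (auto intro!: polyfun_intros polyfun_cascade poly_N nzI[of _ 1 1])
  thus ?thesis
    by (rule not_indeterminate_both) (simp_all add: N_def)
qed

lemma indeterminate_s: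
  assumes T: "\<And>x. x \<in> D \<Longrightarrow>
      has_fraction (fst T x) (\<lambda>u v. 4 * (u * v + 2) - 10 + u * polyB (w x) (m x) (g x) (u * v + 2)) (\<lambda>u v. (u * v + 2)^2) \<and>
      has_fraction (snd T x) (\<lambda>u v. - 4 * (v - r x) + u * v * (polyR (w x) (m x) (g x) (u * v + 2) - 7 * v)) (\<lambda>u v. u * (u * v + 2)^2)"
    and c: "\<And>x. x \<in> D \<Longrightarrow> c x = r x" and x: "x \<in> D"
  shows "indeterminate_at (snd (blowup_uv T (\<lambda>_. 0) c) x) 0 (s x)"
  by (rule indeterminate_at_u_axis[OF blowup_r_uv[OF T c x, THEN conjunct2], where k = 1 and d = "s x + 1" and
        D = "\<lambda>u z. (u * (u * z + r x) + 2)^2"]) (auto intro!: polyfun_intros)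

lemma indeterminate_r:
  assumes T: "\<And>x. x \<in> D \<Longrightarrow>
      has_fraction (fst T x) (\<lambda>u t. 4 * t - 10 + u * polyB (w x) (m x) (g x) t) (\<lambda>u t. t^2) \<and>
      has_fraction (snd T x) (\<lambda>u t. 6 - 3 * t + u * t * (4 * w x + 2 * m x * t - 2 * g x * t^2)) (\<lambda>u t. u * t)"
    and c: "\<And>x. x \<in> D \<Longrightarrow> c x = 2" and x: "x \<in> D"
  shows "indeterminate_at (snd (blowup_uv T (\<lambda>_. 0) c) x) 0 (r x)"
  by (rule indeterminate_at_u_axis[OF blowup_two_uv[OF T c x, THEN conjunct2], where k = 1 and d = "r x + 1" and
        D = "\<lambda>u v. (u * v + 2)^2"]) (auto intro!: polyfun_intros)

lemma resolved_r:
  assumes T: "\<And>x. x \<in> D \<Longrightarrow>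
      has_fraction (fst T x) (\<lambda>u v. 4 * (u * v + 2) - 10 + u * polyB (w x) (m x) (g x) (u * v + 2)) (\<lambda>u v. (u * v + 2)^2) \<and>
      has_fraction (snd T x) (\<lambda>u v. - 4 * (v - r x) + u * v * (polyR (w x) (m x) (g x) (u * v + 2) - 7 * v)) (\<lambda>u v. u * (u * v + 2)^2)"
    and c: "\<And>x. x \<in> D \<Longrightarrow> c x = r x" and res: "\<And>x. x \<in> D \<Longrightarrow> resonant x"
  shows "resolved D T (\<lambda>_. 0) c"
proof (rule resolved_through[OF D holo_s])
  fix x b assume x: "x \<in> D" and b: "b \<noteq> s x"
  show "\<not> indeterminate_at (fst (blowup_uv T (\<lambda>_. 0) c) x) 0 b \<and> \<not> indeterminate_at (snd (blowup_uv T (\<lambda>_. 0) c) x) 0 b"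
    using blowup_r_uv[OF T c x] by (rule not_indeterminate_both) (use b in auto)
next
  fix D' b assume D': "D' \<subseteq> D" "region D'" "\<And>x. x \<in> D' \<Longrightarrow> b x = s x"
  show "resolved D' (blowup_uv T (\<lambda>_. 0) c) (\<lambda>_. 0) b"
    using D' blowup_r_uv[OF T c] res by (intro cascade.resolved_s[OF restrict]) auto
qed (use indeterminate_s[OF T c] blowup_r_UV[OF T c] in auto)

text \<open>Failure travels back along the cascade: a resolved base point has resolved successors,
  and \<open>s\<close> is a successor over all of \<open>D\<close>.\<close>

lemma not_resolved_r:
  assumes T: "\<And>x. x \<in> D \<Longrightarrow>
      has_fraction (fst T x) (\<lambda>u v. 4 * (u * v + 2) - 10 + u * polyB (w x) (m x) (g x) (u * v + 2)) (\<lambda>u v. (u * v + 2)^2) \<and>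
      has_fraction (snd T x) (\<lambda>u v. - 4 * (v - r x) + u * v * (polyR (w x) (m x) (g x) (u * v + 2) - 7 * v)) (\<lambda>u v. u * (u * v + 2)^2)"
    and c: "\<And>x. x \<in> D \<Longrightarrow> c x = r x" and res: "\<And>x. x \<in> D \<Longrightarrow> \<not> resonant x"
  shows "\<not> resolved D T (\<lambda>_. 0) c"
proof
  assume "resolved D T (\<lambda>_. 0) c"
  moreover have "base_point D (blowup_uv T (\<lambda>_. 0) c) (\<lambda>_. 0) s"
    using D holo_s indeterminate_s[OF T c] by (auto simp: base_point_def)
  ultimately have "resolved D (blowup_uv T (\<lambda>_. 0) c) (\<lambda>_. 0) s"
    by (rule resolved_uvD)
  thus False using not_resolved_s[of "blowup_uv T (\<lambda>_. 0) c" s, OF blowup_r_uv[OF T c] refl res] by blast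
qed

lemma resolved_two:
  assumes T: "\<And>x. x \<in> D \<Longrightarrow>
      has_fraction (fst T x) (\<lambda>u t. 4 * t - 10 + u * polyB (w x) (m x) (g x) t) (\<lambda>u t. t^2) \<and>
      has_fraction (snd T x) (\<lambda>u t. 6 - 3 * t + u * t * (4 * w x + 2 * m x * t - 2 * g x * t^2)) (\<lambda>u t. u * t)"
    and c: "\<And>x. x \<in> D \<Longrightarrow> c x = 2" and res: "\<And>x. x \<in> D \<Longrightarrow> resonant x"
  shows "resolved D T (\<lambda>_. 0) c"
proof (rule resolved_through[OF D holo_r])
  fix x b assume x: "x \<in> D" and b: "b \<noteq> r x"
  show "\<not> indeterminate_at (fst (blowup_uv T (\<lambda>_. 0) c) x) 0 b \<and> \<not> indeterminate_at (snd (blowup_uv T (\<lambda>_. 0) c) x) 0 b"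
    using blowup_two_uv[OF T c x] by (rule not_indeterminate_both) (use b in auto)
next
  fix D' b assume D': "D' \<subseteq> D" "region D'" "\<And>x. x \<in> D' \<Longrightarrow> b x = r x"
  show "resolved D' (blowup_uv T (\<lambda>_. 0) c) (\<lambda>_. 0) b"
    using D' blowup_two_uv[OF T c] res by (intro cascade.resolved_r[OF restrict]) auto
qed (use indeterminate_r[OF T c] blowup_two_UV[OF T c] in auto)

lemma not_resolved_two:
  assumes T: "\<And>x. x \<in> D \<Longrightarrow>
      has_fraction (fst T x) (\<lambda>u t. 4 * t - 10 + u * polyB (w x) (m x) (g x) t) (\<lambda>u t. t^2) \<and>
      has_fraction (snd T x) (\<lambda>u t. 6 - 3 * t + u * t * (4 * w x + 2 * m x * t - 2 * g x * t^2)) (\<lambda>u t. u * t)"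
    and c: "\<And>x. x \<in> D \<Longrightarrow> c x = 2" and res: "\<And>x. x \<in> D \<Longrightarrow> \<not> resonant x"
  shows "\<not> resolved D T (\<lambda>_. 0) c"
proof
  assume "resolved D T (\<lambda>_. 0) c"
  moreover have "base_point D (blowup_uv T (\<lambda>_. 0) c) (\<lambda>_. 0) r"
    using D holo_r indeterminate_r[OF T c] by (auto simp: base_point_def)
  ultimately have "resolved D (blowup_uv T (\<lambda>_. 0) c) (\<lambda>_. 0) r"
    by (rule resolved_uvD)
  thus False using not_resolved_r[of "blowup_uv T (\<lambda>_. 0) c" r, OF blowup_two_uv[OF T c] refl res] by blast
qed

end

subsection \<open>The cascades over the origin of the chart \<open>(U\<^sub>0, V\<^sub>0)\<close>\<close>

lemma quotient_uv_den:
  fixes u v X P N t :: complex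
  assumes "u \<noteq> 0" "t \<noteq> 0" "X * t = u * t * \<beta>' + u * v * P + u * N"
  shows "(X / u - \<beta>' - v * (P / t)) / u = N / (u * t)"
proof -
  have "X = (u * t * \<beta>' + u * v * P + u * N) / t" using assms by (simp add: field_simps)
  thus ?thesis using assms(1,2) by (simp add: field_simps)
qed

lemma zero_deriv: "(\<lambda>_::complex. 0::complex) x = 0" "deriv (\<lambda>_. 0::complex) x = 0"
  by simp_all

definition polyS :: "complex \<Rightarrow> complex \<Rightarrow> complex \<Rightarrow> complex \<Rightarrow> complex" where
  "polyS w m u t = - 6 - 4 * w * t * u - 2 * m * t"

lemma polyfun_polyS: "polyfun f \<Longrightarrow> polyfun h \<Longrightarrow> polyfun (\<lambda>y z. polyS w m (f y z) (h y z))"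
  unfolding polyS_def by (intro polyfun_intros)

context cascade
begin

text \<open>The centres of the remaining branch: \<tau> is the root of - 2 - 2 g t, and after the
  blow-up at \<tau> the numerator is v - \<epsilon> on \<open>u = 0\<close>, with \<open>W\<close>
  the cofactor of u v in the rest.\<close>

definition \<tau> where "\<tau> x = - 1 / g x"
definition \<epsilon> where "\<epsilon> x = - \<tau> x * (2 + m x * \<tau> x - deriv \<tau> x)"
definition W where "W x u v t = 2 + m x * (t + \<tau> x) - deriv \<tau> x - 4 * g x * v - polyS (w x) (m x) u t"
text \<open>The resonance of this branch: after the blow-up at \<epsilon> the linear coefficient is
  0, and the equation says that the remaining constant \<epsilon> W(0, \<epsilon>, \<tau>) - \<tau>
  \<epsilon>' is 0 as well.\<close>

definition compatible where
  "compatible x \<longleftrightarrow> \<epsilon> x * (8 + 4 * m x * \<tau> x - deriv \<tau> x - 4 * g x * \<epsilon> x) = \<tau> x * deriv \<epsilon> x"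

lemma polyfun_W: "polyfun f \<Longrightarrow> polyfun f' \<Longrightarrow> polyfun f'' \<Longrightarrow> polyfun (\<lambda>y z. W x (f y z) (f' y z) (f'' y z))"
  unfolding W_def by (intro polyfun_intros polyfun_polyS)

lemma W_compatible: "compatible x \<Longrightarrow> \<epsilon> x * W x 0 (\<epsilon> x) (\<tau> x) = \<tau> x * deriv \<epsilon> x"
  unfolding compatible_def W_def polyS_def by algebra

lemma resolved_epsilon:
  assumes g: "\<And>x. x \<in> D \<Longrightarrow> g x \<noteq> 0" and T: "\<And>x. x \<in> D \<Longrightarrow>
      has_fraction (fst T x) (\<lambda>u v. 3 + 2 * g x * (u * v + \<tau> x) + u * polyS (w x) (m x) u (u * v + \<tau> x)) (\<lambda>u v. u * v + \<tau> x) \<and>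
      has_fraction (snd T x) (\<lambda>u v. v - \<epsilon> x + u * v * W x u v (u * v + \<tau> x)) (\<lambda>u v. u * (u * v + \<tau> x))"
    and c: "\<And>x. x \<in> D \<Longrightarrow> c x = \<epsilon> x" and res: "\<And>x. x \<in> D \<Longrightarrow> compatible x"
  shows "resolved D T (\<lambda>_. 0) c"
proof -
  have c': "c x = \<epsilon> x" "deriv c x = deriv \<epsilon> x" if "x \<in> D" for x
    using c that deriv_eq_on[of c \<epsilon> x] by auto
  have \<tau>: "g x * \<tau> x = - 1" "\<tau> x \<noteq> 0" if "x \<in> D" for x
    using g[OF that] by (auto simp: \<tau>_def)
  show ?thesis
  proof (rule resolved_regular[OF D])
    fix x b assume x: "x \<in> D"
    define H where "H = (\<lambda>u y. y * W x u (u * y + \<epsilon> x) (u * (u * y + \<epsilon> x) + \<tau> x)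
       + \<epsilon> x * (3 * m x * (u * y + \<epsilon> x) - 4 * g x * y + 4 * w x * (u * (u * y + \<epsilon> x) + \<tau> x))
       - deriv \<epsilon> x * (u * y + \<epsilon> x) - y * (2 * g x * (u * y + \<epsilon> x) + polyS (w x) (m x) u (u * (u * y + \<epsilon> x) + \<tau> x)))"
    have "polyfun H"
      unfolding H_def by (intro polyfun_intros polyfun_W polyfun_polyS)
    have "has_fraction (fst (blowup_uv T (\<lambda>_. 0) c) x)
        (\<lambda>u y. 3 + 2 * g x * (u * (u * y + \<epsilon> x) + \<tau> x) + u * polyS (w x) (m x) u (u * (u * y + \<epsilon> x) + \<tau> x)) (\<lambda>u y. u * (u * y + \<epsilon> x) + \<tau> x) \<and>
      has_fraction (snd (blowup_uv T (\<lambda>_. 0) c) x) H (\<lambda>u y. u * (u * y + \<epsilon> x) + \<tau> x)"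
    proof (rule has_fraction_blowup_uv[OF T[OF x, THEN conjunct1] T[OF x, THEN conjunct2] c'[OF x]], goal_cases)
      case (5 u y)
      define v where "v = u * y + \<epsilon> x"
      define t where "t = u * v + \<tau> x"
      have nz: "u \<noteq> 0" "t \<noteq> 0" using 5 by (auto simp: t_def v_def)
      have H: "H u y = y * W x u v t + \<epsilon> x * (3 * m x * v - 4 * g x * y + 4 * w x * t) - deriv \<epsilon> x * v
          - y * (2 * g x * v + polyS (w x) (m x) u t)"
        unfolding H_def v_def t_def ..
      have W: "W x u v t = W x 0 (\<epsilon> x) (\<tau> x) + u * (3 * m x * v - 4 * g x * y + 4 * w x * t)"
        unfolding W_def polyS_def v_def t_def by algebra
      show ?case
        unfolding v_def[symmetric] t_def[symmetric]
      proof (intro conjI refl quotient_uv(2)[OF nz])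
        have "v - \<epsilon> x = u * y" by (simp add: v_def)
        moreover have "2 * g x * t = 2 * g x * (u * v) - 2"
          using \<tau>(1)[OF x] unfolding t_def by algebra
        ultimately show "v - \<epsilon> x + u * v * W x u v t = u * t * deriv \<epsilon> x + u * y * (3 + 2 * g x * t + u * polyS (w x) (m x) u t) + u * u * H u y"
          using W_compatible[OF res[OF x]] W v_def t_def unfolding H by algebra
      qed
    qed (use \<tau>(2)[OF x] in \<open>auto intro!: polyfun_intros polyfun_polyS nzI[of _ 0 0] \<open>polyfun H\<close>\<close>)
    thus "regular_at (fst (blowup_uv T (\<lambda>_. 0) c) x) 0 b \<and> regular_at (snd (blowup_uv T (\<lambda>_. 0) c) x) 0 b"
      using \<tau>(2)[OF x] by (auto intro: regular_atI)
  next
    fix x assume x: "x \<in> D"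
    define t where "t = (\<lambda>U V. U * V * (V + \<epsilon> x) + \<tau> x)"
    define H where "H = (\<lambda>U V. W x (U * V) (V + \<epsilon> x) (t U V)
       + \<epsilon> x * (3 * m x * U * (V + \<epsilon> x) - 4 * g x + 4 * w x * t U V * U)
       - deriv \<epsilon> x * U * (V + \<epsilon> x) - (2 * g x * (V + \<epsilon> x) + polyS (w x) (m x) (U * V) (t U V)))"
    define N where "N = (\<lambda>U V. 1 + U * (V + \<epsilon> x) * W x (U * V) (V + \<epsilon> x) (t U V) - deriv \<epsilon> x * U * t U V)"
    have poly_t: "polyfun t"
      unfolding t_def by (intro polyfun_intros)
    have poly: "polyfun H" "polyfun N"
      unfolding H_def N_def by (intro polyfun_intros polyfun_W polyfun_polyS poly_t)+
    have "has_fraction (fst (blowup_UV T (\<lambda>_. 0) c) x) (\<lambda>U V. - U * H U V) t \<and>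
      has_fraction (snd (blowup_UV T (\<lambda>_. 0) c) x) N (\<lambda>U V. U * t U V)"
    proof (rule has_fraction_blowup_UV[OF T[OF x, THEN conjunct1] T[OF x, THEN conjunct2] c'[OF x]], goal_cases)
      case 2
      show ?case by (rule nzI[of _ 0 0]) (use \<tau>(2)[OF x] poly_t in \<open>auto simp: t_def\<close>)
    next
      case 4
      show ?case by (rule nzI[of _ 1 0]) (use \<tau>(2)[OF x] poly_t in \<open>auto simp: t_def intro!: polyfun_intros\<close>)
    next
      case (5 U V)
      define v where "v = V + \<epsilon> x"
      have t: "U * V * v + \<tau> x = t U V" by (simp add: t_def v_def)
      have nz: "U \<noteq> 0" "V \<noteq> 0" "t U V \<noteq> 0" using 5 by auto
      have H: "H U V = W x (U * V) v (t U V) + \<epsilon> x * (3 * m x * U * v - 4 * g x + 4 * w x * t U V * U)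
         - deriv \<epsilon> x * U * v - (2 * g x * v + polyS (w x) (m x) (U * V) (t U V))"
        unfolding H_def v_def ..
      have N: "N U V = 1 + U * v * W x (U * V) v (t U V) - deriv \<epsilon> x * U * t U V"
        unfolding N_def v_def ..
      have W: "W x (U * V) v (t U V) = W x 0 (\<epsilon> x) (\<tau> x) + V * (3 * m x * U * v - 4 * g x + 4 * w x * t U V * U)"
        unfolding W_def polyS_def v_def t[symmetric] by algebra
      show ?case
        unfolding v_def[symmetric] t
      proof (intro conjI quotient_UV(1)[OF nz] quotient_UV(3)[OF nz])
        show "v - \<epsilon> x + U * V * v * W x (U * V) v (t U V) = U * V * t U V * deriv \<epsilon> x + V * N U V"
          unfolding N v_def by algebra
        have "2 * g x * t U V = 2 * g x * (U * V * v) - 2"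
          using \<tau>(1)[OF x] unfolding t[symmetric] by algebra
        thus "3 + 2 * g x * t U V + U * V * polyS (w x) (m x) (U * V) (t U V) - N U V = V * (- U * H U V)"
          using W_compatible[OF res[OF x]] W v_def t unfolding H N by algebra
      qed
    qed (intro polyfun_intros poly)+
    thus "\<not> indeterminate_at (fst (blowup_UV T (\<lambda>_. 0) c) x) 0 0 \<and> \<not> indeterminate_at (snd (blowup_UV T (\<lambda>_. 0) c) x) 0 0"
      by (rule not_indeterminate_both) (use \<tau>(2)[OF x] in \<open>auto simp: N_def t_def\<close>)
  qed
qed

lemma resolved_tau:
  assumes g: "\<And>x. x \<in> D \<Longrightarrow> g x \<noteq> 0" and T: "\<And>x. x \<in> D \<Longrightarrow>
      has_fraction (fst T x) (\<lambda>u t. 3 + 2 * g x * t + u * polyS (w x) (m x) u t) (\<lambda>u t. t) \<and>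
      has_fraction (snd T x) (\<lambda>u t. - 2 - 2 * g x * t + u * (2 + m x * t)) (\<lambda>u t. u)"
    and c: "\<And>x. x \<in> D \<Longrightarrow> c x = \<tau> x" and res: "\<And>x. x \<in> D \<Longrightarrow> compatible x"
  shows "resolved D T (\<lambda>_. 0) c"
proof -
  have c': "c x = \<tau> x" "deriv c x = deriv \<tau> x" if "x \<in> D" for x
    using c that deriv_eq_on[of c \<tau> x] by auto
  have \<tau>: "g x * \<tau> x = - 1" "\<tau> x \<noteq> 0" if "x \<in> D" for x
    using g[OF that] by (auto simp: \<tau>_def)
  have holo_\<tau>: "\<tau> holomorphic_on D"
    unfolding \<tau>_def[abs_def] using g by (intro holomorphic_intros holo_g) auto
  have uv: "has_fraction (fst (blowup_uv T (\<lambda>_. 0) c) x)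
        (\<lambda>u v. 3 + 2 * g x * (u * v + \<tau> x) + u * polyS (w x) (m x) u (u * v + \<tau> x)) (\<lambda>u v. u * v + \<tau> x) \<and>
      has_fraction (snd (blowup_uv T (\<lambda>_. 0) c) x) (\<lambda>u v. v - \<epsilon> x + u * v * W x u v (u * v + \<tau> x)) (\<lambda>u v. u * (u * v + \<tau> x))"
    if x: "x \<in> D" for x
  proof (rule has_fraction_blowup_uv[OF T[OF x, THEN conjunct1] T[OF x, THEN conjunct2] c'[OF x]], goal_cases)
    case 4
    show ?case by (rule nzI[of _ 1 0]) (use \<tau>(2)[OF x] in \<open>auto intro!: polyfun_intros\<close>)
  next
    case (5 u v)
    define t where "t = u * v + \<tau> x"
    have nz: "u \<noteq> 0" "t \<noteq> 0" using 5 by (auto simp: t_def)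
    have "(- 2 - 2 * g x * t + u * (2 + m x * t)) * t = u * t * deriv \<tau> x + u * v * (3 + 2 * g x * t + u * polyS (w x) (m x) u t)
        + u * (v - \<epsilon> x + u * v * W x u v t)"
      using \<tau>(1)[OF x] unfolding W_def \<epsilon>_def t_def by algebra
    thus ?case
      unfolding t_def[symmetric] by (intro conjI refl quotient_uv_den[OF nz])
  qed (use \<tau>(2)[OF x] in \<open>auto intro!: polyfun_intros polyfun_polyS polyfun_W nzI[of _ 0 0]\<close>)
  show ?thesis
  proof (rule resolved_through[OF D, of \<epsilon>])
    show "\<epsilon> holomorphic_on D"
      unfolding \<epsilon>_def[abs_def] by (intro holomorphic_intros holo_\<tau> holo_m open_D)
  next
    fix x assume x: "x \<in> D"
    show "indeterminate_at (snd (blowup_uv T (\<lambda>_. 0) c) x) 0 (\<epsilon> x)"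
      by (rule indeterminate_at_u_axis[OF uv[OF x, THEN conjunct2], where k = 1 and d = "\<epsilon> x + 1" and D = "\<lambda>u v. u * v + \<tau> x"])
         (use \<tau>(2)[OF x] in \<open>auto intro!: polyfun_intros\<close>)
    define N where "N = (\<lambda>U V. - 2 * g x + U * (2 + m x * (V + \<tau> x) - deriv \<tau> x))"
    have "polyfun N"
      unfolding N_def by (intro polyfun_intros)
    have "has_fraction (fst (blowup_UV T (\<lambda>_. 0) c) x)
        (\<lambda>U V. 3 + 2 * g x * (V + \<tau> x) + U * V * polyS (w x) (m x) (U * V) (V + \<tau> x) - (V + \<tau> x) * N U V) (\<lambda>U V. V * (V + \<tau> x)) \<and>
      has_fraction (snd (blowup_UV T (\<lambda>_. 0) c) x) N (\<lambda>U V. U)"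
    proof (rule has_fraction_blowup_UV[OF T[OF x, THEN conjunct1] T[OF x, THEN conjunct2] c'[OF x]], goal_cases)
      case 2
      show ?case by (rule nzI[of _ 0 "\<tau> x"]) (use \<tau>(2)[OF x] in \<open>auto intro!: polyfun_intros\<close>)
    next
      case 4
      show ?case by (rule nzI[of _ 1 0]) (auto intro!: polyfun_intros)
    next
      case (5 U V)
      define t where "t = V + \<tau> x"
      have nz: "U \<noteq> 0" "V \<noteq> 0" "t \<noteq> 0" using 5 by (auto simp: t_def)
      have "- 2 - 2 * g x * t + U * V * (2 + m x * t) = V * (N U V + U * deriv \<tau> x)"
        using \<tau>(1)[OF x] unfolding N_def t_def by algebra
      thus ?case
        unfolding t_def[symmetric] using nz by (simp add: field_simps)
    qed (intro polyfun_intros polyfun_polyS \<open>polyfun N\<close>)+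
    thus "\<not> indeterminate_at (fst (blowup_UV T (\<lambda>_. 0) c) x) 0 0 \<and> \<not> indeterminate_at (snd (blowup_UV T (\<lambda>_. 0) c) x) 0 0"
      by (rule not_indeterminate_both) (use \<tau>(1)[OF x] g[OF x] in \<open>auto simp: N_def algebra_simps\<close>)
  next
    fix x b assume x: "x \<in> D" and b: "b \<noteq> \<epsilon> x"
    show "\<not> indeterminate_at (fst (blowup_uv T (\<lambda>_. 0) c) x) 0 b \<and> \<not> indeterminate_at (snd (blowup_uv T (\<lambda>_. 0) c) x) 0 b"
      using uv[OF x] by (rule not_indeterminate_both) (use b \<tau>(2)[OF x] in auto)
  next
    fix D' b assume D': "D' \<subseteq> D" "region D'" "\<And>x. x \<in> D' \<Longrightarrow> b x = \<epsilon> x"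
    show "resolved D' (blowup_uv T (\<lambda>_. 0) c) (\<lambda>_. 0) b"
      using D' uv res g by (intro cascade.resolved_epsilon[OF restrict]) auto
  qed
qed

lemma deriv_const_on: "(\<And>x. x \<in> D \<Longrightarrow> c x = k) \<Longrightarrow> x \<in> D \<Longrightarrow> deriv c x = 0"
  using deriv_eq_on[of c "\<lambda>_. k" x] by simp

text \<open>
  If \<open>g\<close> vanishes identically, the base point \<open>v = - 1 / g\<close> disappears at infinity, to the origin of
  the chart \<open>(U, V)\<close>, and so do its successors. \<open>resolved_origin\<close> separates the two situations.
\<close>

lemma resolved_degenerate_last:
  assumes T: "\<And>x. x \<in> D \<Longrightarrow>
      has_fraction (fst T x) (\<lambda>u v. u + 2 * u^2 * v^2 + 4 * w x * u^2 * v^3) (\<lambda>u v. v) \<and>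
      has_fraction (snd T x) (\<lambda>u v. 1 - 4 * u * v^2 - 4 * w x * u * v^3 - m x * v) (\<lambda>u v. 1)"
  shows "resolved D T (\<lambda>_. 0) (\<lambda>_. 0)"
proof -
  let ?uv = "blowup_uv T (\<lambda>_. 0) (\<lambda>_. 0)" and ?UV = "blowup_UV T (\<lambda>_. 0) (\<lambda>_. 0)"
  have uv: "has_fraction (fst ?uv x) (\<lambda>u v. 1 + 2 * u^3 * v^2 + 4 * w x * u^4 * v^3) (\<lambda>u v. v) \<and>
      has_fraction (snd ?uv x) (\<lambda>u v. - 6 * u^2 * v^2 - 8 * w x * u^3 * v^3 - m x * v) (\<lambda>u v. 1)"
    if x: "x \<in> D" for x
    by (rule has_fraction_blowup_uv[OF T[OF x, THEN conjunct1] T[OF x, THEN conjunct2] zero_deriv])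
       (auto intro!: polyfun_intros nzI[of _ 1 1] simp: field_simps eval_nat_numeral)
  have UV: "has_fraction (fst ?UV x) (\<lambda>U V. 6 * U^2 * V^2 + 8 * w x * U^2 * V^3 + m x * U) (\<lambda>U V. 1) \<and>
      has_fraction (snd ?UV x) (\<lambda>U V. 1 - 4 * U * V^3 - 4 * w x * U * V^4 - m x * V) (\<lambda>U V. 1)"
    if x: "x \<in> D" for x
    by (rule has_fraction_blowup_UV[OF T[OF x, THEN conjunct1] T[OF x, THEN conjunct2] zero_deriv])
       (auto intro!: polyfun_intros nzI[of _ 1 1] simp: field_simps eval_nat_numeral)
  have no_uv: "\<not> indeterminate_at (fst ?uv x) 0 b \<and> \<not> indeterminate_at (snd ?uv x) 0 b" if "x \<in> D" for x b
    using uv[OF that] by (rule not_indeterminate_both) auto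
  have reg: "regular_at (fst ?UV x) b 0 \<and> regular_at (snd ?UV x) b 0" if "x \<in> D" for x b
    using UV[OF that] by (auto intro: regular_atI)
  show ?thesis
  proof (rule resolvedI)
    fix D' c assume D': "D' \<subseteq> D" and bp: "base_point D' ?uv (\<lambda>_. 0) c"
    have "\<not> base_point D' ?uv (\<lambda>_. 0) c"
      using D' no_uv by (intro not_base_point[OF base_point_region[OF bp]]) auto
    thus "resolved D' ?uv (\<lambda>_. 0) c" using bp by blast
  next
    fix D' assume D': "D' \<subseteq> D" and bp: "base_point D' ?UV (\<lambda>_. 0) (\<lambda>_. 0)"
    have "\<not> base_point D' ?UV (\<lambda>_. 0) (\<lambda>_. 0)"
      using D' reg regular_not_indeterminate by (intro not_base_point[OF base_point_region[OF bp]]) blast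
    thus "resolved D' ?UV (\<lambda>_. 0) (\<lambda>_. 0)" using bp by blast
  next
    \<comment> \<open>Here the second alternative is the one that holds: in the chart
      \<open>(u, v)\<close> the first component still has a pole at \<open>v = 0\<close>.\<close>
    show "regular_on_u_axis D ?uv \<or> regular_on_V_axis D ?UV"
      using reg open_D by (auto simp: regular_on_V_axis_def intro!: eventually_cosparse_all)
  qed
qed

lemma resolved_degenerate:
  assumes g: "\<And>x. x \<in> D \<Longrightarrow> g x = 0" and T: "\<And>x. x \<in> D \<Longrightarrow>
      has_fraction (fst T x) (\<lambda>u v. 2 * u + 2 * g x - v * (2 * u^2 + m x * u)) (\<lambda>u v. v) \<and>
      has_fraction (snd T x) (\<lambda>u v. 1 - 4 * u * v - 4 * w x * u * v^2 - m x * v) (\<lambda>u v. 1)"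
  shows "resolved D T (\<lambda>_. 0) (\<lambda>_. 0)"
proof -
  let ?uv = "blowup_uv T (\<lambda>_. 0) (\<lambda>_. 0)" and ?UV = "blowup_UV T (\<lambda>_. 0) (\<lambda>_. 0)"
  have uv: "has_fraction (fst ?uv x) (\<lambda>u v. 2 - v * (2 * u^2 + m x * u)) (\<lambda>u v. v) \<and>
      has_fraction (snd ?uv x) (\<lambda>u v. - 1 - 2 * u^2 * v - 4 * w x * u^3 * v^2) (\<lambda>u v. u)"
    if x: "x \<in> D" for x
    by (rule has_fraction_blowup_uv[OF T[OF x, THEN conjunct1] T[OF x, THEN conjunct2] zero_deriv])
       (auto intro!: polyfun_intros nzI[of _ 1 1] simp: g[OF x] field_simps eval_nat_numeral)
  have UV: "has_fraction (fst ?UV x) (\<lambda>U V. U + 2 * U^2 * V^2 + 4 * w x * U^2 * V^3) (\<lambda>U V. V) \<and>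
      has_fraction (snd ?UV x) (\<lambda>U V. 1 - 4 * U * V^2 - 4 * w x * U * V^3 - m x * V) (\<lambda>U V. 1)"
    if x: "x \<in> D" for x
    by (rule has_fraction_blowup_UV[OF T[OF x, THEN conjunct1] T[OF x, THEN conjunct2] zero_deriv])
       (auto intro!: polyfun_intros nzI[of _ 1 1] simp: g[OF x] field_simps eval_nat_numeral)
  have no_uv: "\<not> indeterminate_at (fst ?uv x) 0 b \<and> \<not> indeterminate_at (snd ?uv x) 0 b" if "x \<in> D" for x b
    using uv[OF that] by (rule not_indeterminate_both) auto
  show ?thesis
  proof (rule resolvedI)
    fix D' c assume D': "D' \<subseteq> D" and bp: "base_point D' ?uv (\<lambda>_. 0) c"
    have "\<not> base_point D' ?uv (\<lambda>_. 0) c"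
      using D' no_uv by (intro not_base_point[OF base_point_region[OF bp]]) auto
    thus "resolved D' ?uv (\<lambda>_. 0) c" using bp by blast
  next
    fix D' assume D': "D' \<subseteq> D" and bp: "base_point D' ?UV (\<lambda>_. 0) (\<lambda>_. 0)"
    show "resolved D' ?UV (\<lambda>_. 0) (\<lambda>_. 0)"
      using D' UV by (intro cascade.resolved_degenerate_last[OF restrict[OF D' base_point_region[OF bp]]]) auto
  next
    assume "\<nexists>D'. D' \<subseteq> D \<and> base_point D' ?UV (\<lambda>_. 0) (\<lambda>_. 0)"
    moreover have "indeterminate_at (fst ?UV x) 0 0" if x: "x \<in> D" for x
      by (rule indeterminate_at_v_axis[OF UV[OF x, THEN conjunct1], where k = 1 and D = "\<lambda>U V. 1" and c = 1])
         (auto intro!: polyfun_intros)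
    hence "base_point D ?UV (\<lambda>_. 0) (\<lambda>_. 0)"
      using D by (auto simp: base_point_def)
    ultimately show "regular_on_u_axis D ?uv \<or> regular_on_V_axis D ?UV" by blast
  qed
qed

lemma resolved_origin:
  assumes T: "\<And>x. x \<in> D \<Longrightarrow>
      has_fraction (fst T x) (\<lambda>u v. - 6 * u^2 + 3 * u - 4 * w x * u^2 * v - 2 * m x * u * v + 2 * g x * v) (\<lambda>u v. v) \<and>
      has_fraction (snd T x) (\<lambda>u v. 1 - 4 * u - 4 * w x * u * v - m x * v) (\<lambda>u v. 1)"
    and res: "\<And>x. x \<in> D \<Longrightarrow> g x \<noteq> 0 \<Longrightarrow> compatible x"
  shows "resolved D T (\<lambda>_. 0) (\<lambda>_. 0)"
proof -
  let ?uv = "blowup_uv T (\<lambda>_. 0) (\<lambda>_. 0)" and ?UV = "blowup_UV T (\<lambda>_. 0) (\<lambda>_. 0)"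
  have uv: "has_fraction (fst ?uv x) (\<lambda>u t. 3 + 2 * g x * t + u * polyS (w x) (m x) u t) (\<lambda>u t. t) \<and>
      has_fraction (snd ?uv x) (\<lambda>u t. - 2 - 2 * g x * t + u * (2 + m x * t)) (\<lambda>u t. u)"
    if x: "x \<in> D" for x
    by (rule has_fraction_blowup_uv[OF T[OF x, THEN conjunct1] T[OF x, THEN conjunct2] zero_deriv])
       (auto intro!: polyfun_intros polyfun_polyS nzI[of _ 1 1] simp: polyS_def field_simps power2_eq_square)
  have UV: "has_fraction (fst ?UV x) (\<lambda>U V. 2 * U + 2 * g x - V * (2 * U^2 + m x * U)) (\<lambda>U V. V) \<and>
      has_fraction (snd ?UV x) (\<lambda>U V. 1 - 4 * U * V - 4 * w x * U * V^2 - m x * V) (\<lambda>U V. 1)"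
    if x: "x \<in> D" for x
    by (rule has_fraction_blowup_UV[OF T[OF x, THEN conjunct1] T[OF x, THEN conjunct2] zero_deriv])
       (auto intro!: polyfun_intros nzI[of _ 1 1] simp: field_simps power2_eq_square)
  have indet_uv: "indeterminate_at (snd ?uv x) 0 (\<tau> x)" if x: "x \<in> D" "g x \<noteq> 0" for x
    by (rule indeterminate_at_u_axis[OF uv[OF x(1), THEN conjunct2], where k = 1 and D = "\<lambda>u t. 1" and d = 0])
       (use x(2) in \<open>auto intro!: polyfun_intros simp: \<tau>_def\<close>)
  show ?thesis
  proof (rule resolvedI)
    fix D' c assume D': "D' \<subseteq> D" and bp: "base_point D' ?uv (\<lambda>_. 0) c"
    have c: "g x * c x = - 1" if x: "x \<in> D'" for x
    proof (rule ccontr)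
      assume "g x * c x \<noteq> - 1"
      hence "- 2 - 2 * g x * c x \<noteq> 0" by algebra
      hence "\<not> indeterminate_at (fst ?uv x) 0 (c x) \<and> \<not> indeterminate_at (snd ?uv x) 0 (c x)"
        using x D' by (intro not_indeterminate_both[OF uv]) auto
      thus False using base_pointD[OF bp x] by auto
    qed
    \<comment> \<open>A base point on this curve exists only over regions free of zeros of
      \<open>g\<close>, so isolated zeros need no separate treatment.\<close>
    have g: "g x \<noteq> 0" if "x \<in> D'" for x using c[OF that] by auto
    moreover have "c x = \<tau> x" if "x \<in> D'" for x
      using c[OF that] g[OF that] by (simp add: \<tau>_def field_simps)
    ultimately show "resolved D' ?uv (\<lambda>_. 0) c"
      using D' uv res by (intro cascade.resolved_tau[OF restrict[OF D' base_point_region[OF bp]]]) auto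
  next
    fix D' assume D': "D' \<subseteq> D" and bp: "base_point D' ?UV (\<lambda>_. 0) (\<lambda>_. 0)"
    have "g x = 0" if x: "x \<in> D'" for x
    proof (rule ccontr)
      assume "g x \<noteq> 0"
      hence "\<not> indeterminate_at (fst ?UV x) 0 0 \<and> \<not> indeterminate_at (snd ?UV x) 0 0"
        using x D' by (intro not_indeterminate_both[OF UV]) auto
      thus False using base_pointD[OF bp x] by auto
    qed
    thus "resolved D' ?UV (\<lambda>_. 0) (\<lambda>_. 0)"
      using D' UV by (intro cascade.resolved_degenerate[OF restrict[OF D' base_point_region[OF bp]]]) auto
  next
    assume none: "\<nexists>D' c. D' \<subseteq> D \<and> base_point D' ?uv (\<lambda>_. 0) c" "\<nexists>D'. D' \<subseteq> D \<and> base_point D' ?UV (\<lambda>_. 0) (\<lambda>_. 0)"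
    \<comment> \<open>The assumptions contradict each other. A nonzero value of \<open>g\<close>
      would make \<tau> a base point over a small ball, so \<open>g\<close> vanishes on
      \<open>D\<close>; but then the origin of the other chart is a base point over
      \<open>D\<close>.\<close>
    have "g x = 0" if x: "x \<in> D" for x
    proof (rule ccontr)
      assume gx: "g x \<noteq> 0"
      have "isCont g x"
        using holomorphic_on_imp_continuous_on[OF holo_g] open_D x by (simp add: continuous_on_eq_continuous_at)
      hence "\<forall>\<^sub>F y in nhds x. g y \<noteq> 0"
        using gx by (simp add: isCont_def tendsto_nhds_iff tendsto_imp_eventually_ne)
      moreover have "\<forall>\<^sub>F y in nhds x. y \<in> D"
        using open_D x by (rule eventually_nhds_in_open)
      ultimately have "\<forall>\<^sub>F y in nhds x. g y \<noteq> 0 \<and> y \<in> D"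
        by (rule eventually_conj)
      then obtain e where e: "e > 0" "\<And>y. y \<in> ball x e \<Longrightarrow> g y \<noteq> 0 \<and> y \<in> D"
        by (auto simp: eventually_nhds_metric dist_commute)
      have "\<tau> holomorphic_on ball x e"
        unfolding \<tau>_def[abs_def] using e(2) by (intro holomorphic_intros holomorphic_on_subset[OF holo_g]) auto
      hence "base_point (ball x e) ?uv (\<lambda>_. 0) \<tau>"
        using e indet_uv by (auto simp: base_point_def region_def)
      moreover have "ball x e \<subseteq> D" using e(2) by auto
      ultimately show False using none(1) by blast
    qed
    hence "indeterminate_at (fst ?UV x) 0 0" if x: "x \<in> D" for x
      by (intro indeterminate_at_v_axis[OF UV[OF x, THEN conjunct1], where k = 1 and D = "\<lambda>U V. 1" and c = 1])
         (use x in \<open>auto intro!: polyfun_intros\<close>)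
    hence "base_point D ?UV (\<lambda>_. 0) (\<lambda>_. 0)"
      using D by (auto simp: base_point_def)
    with none show "regular_on_u_axis D ?uv \<or> regular_on_V_axis D ?UV" by blast
  qed
qed

lemma blowup_chart_UV_uv:
  assumes T: "\<And>x. x \<in> D \<Longrightarrow>
      has_fraction (fst T x) (\<lambda>U V. - 10 * U^2 - 8 * w x * U^2 * V + 4 * U * V - 3 * m x * U * V^2 + 2 * g x * V^3) (\<lambda>U V. V^2) \<and>
      has_fraction (snd T x) (\<lambda>U V. - 4 * U - 4 * w x * U * V + V - m x * V^2) (\<lambda>U V. V)"
    and x: "x \<in> D"
  shows "has_fraction (fst (blowup_uv T (\<lambda>_. 0) (\<lambda>_. 0)) x) (\<lambda>u t. 4 * t - 10 + u * polyB (w x) (m x) (g x) t) (\<lambda>u t. t^2) \<and>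
      has_fraction (snd (blowup_uv T (\<lambda>_. 0) (\<lambda>_. 0)) x) (\<lambda>u t. 6 - 3 * t + u * t * (4 * w x + 2 * m x * t - 2 * g x * t^2)) (\<lambda>u t. u * t)"
  by (rule has_fraction_blowup_uv[OF T[OF x, THEN conjunct1] T[OF x, THEN conjunct2] zero_deriv])
     (auto intro!: polyfun_intros polyfun_cascade nzI[of _ 1 1] simp: polyB_def field_simps eval_nat_numeral)

lemma indeterminate_two:
  assumes T: "\<And>x. x \<in> D \<Longrightarrow>
      has_fraction (fst T x) (\<lambda>U V. - 10 * U^2 - 8 * w x * U^2 * V + 4 * U * V - 3 * m x * U * V^2 + 2 * g x * V^3) (\<lambda>U V. V^2) \<and>
      has_fraction (snd T x) (\<lambda>U V. - 4 * U - 4 * w x * U * V + V - m x * V^2) (\<lambda>U V. V)"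
    and x: "x \<in> D"
  shows "indeterminate_at (snd (blowup_uv T (\<lambda>_. 0) (\<lambda>_. 0)) x) 0 2"
  by (rule indeterminate_at_u_axis[OF blowup_chart_UV_uv[OF T x, THEN conjunct2], where k = 1 and D = "\<lambda>u t. t" and d = 0])
     (auto intro!: polyfun_intros)

lemma resolved_chart_UV:
  assumes T: "\<And>x. x \<in> D \<Longrightarrow>
      has_fraction (fst T x) (\<lambda>U V. - 10 * U^2 - 8 * w x * U^2 * V + 4 * U * V - 3 * m x * U * V^2 + 2 * g x * V^3) (\<lambda>U V. V^2) \<and>
      has_fraction (snd T x) (\<lambda>U V. - 4 * U - 4 * w x * U * V + V - m x * V^2) (\<lambda>U V. V)"
    and res: "\<And>x. x \<in> D \<Longrightarrow> resonant x" "\<And>x. x \<in> D \<Longrightarrow> g x \<noteq> 0 \<Longrightarrow> compatible x"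
  shows "resolved D T (\<lambda>_. 0) (\<lambda>_. 0)"
proof -
  let ?uv = "blowup_uv T (\<lambda>_. 0) (\<lambda>_. 0)" and ?UV = "blowup_UV T (\<lambda>_. 0) (\<lambda>_. 0)"
  have UV: "has_fraction (fst ?UV x) (\<lambda>u v. - 6 * u^2 + 3 * u - 4 * w x * u^2 * v - 2 * m x * u * v + 2 * g x * v) (\<lambda>u v. v) \<and>
      has_fraction (snd ?UV x) (\<lambda>u v. 1 - 4 * u - 4 * w x * u * v - m x * v) (\<lambda>u v. 1)"
    if x: "x \<in> D" for x
    by (rule has_fraction_blowup_UV[OF T[OF x, THEN conjunct1] T[OF x, THEN conjunct2] zero_deriv])
       (auto intro!: polyfun_intros nzI[of _ 1 1] simp: field_simps eval_nat_numeral)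
  show ?thesis
  proof (rule resolvedI)
    fix D' c assume D': "D' \<subseteq> D" and bp: "base_point D' ?uv (\<lambda>_. 0) c"
    have "c x = 2" if x: "x \<in> D'" for x
    proof (rule ccontr)
      assume "c x \<noteq> 2"
      moreover have "6 - 3 * c x = 3 * (2 - c x)" by simp
      ultimately have "6 - 3 * c x \<noteq> 0" by simp
      hence "\<not> indeterminate_at (fst ?uv x) 0 (c x) \<and> \<not> indeterminate_at (snd ?uv x) 0 (c x)"
        using x D' by (intro not_indeterminate_both[OF blowup_chart_UV_uv[OF T]]) auto
      thus False using base_pointD[OF bp x] by auto
    qed
    thus "resolved D' ?uv (\<lambda>_. 0) c"
      using D' blowup_chart_UV_uv[OF T] res by (intro cascade.resolved_two[OF restrict[OF D' base_point_region[OF bp]]]) auto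
  next
    fix D' assume D': "D' \<subseteq> D" and bp: "base_point D' ?UV (\<lambda>_. 0) (\<lambda>_. 0)"
    show "resolved D' ?UV (\<lambda>_. 0) (\<lambda>_. 0)"
      using D' UV res by (intro cascade.resolved_origin[OF restrict[OF D' base_point_region[OF bp]]]) auto
  next
    assume "\<nexists>D' c. D' \<subseteq> D \<and> base_point D' ?uv (\<lambda>_. 0) c"
    moreover have "base_point D ?uv (\<lambda>_. 0) (\<lambda>_. 2)"
      using D indeterminate_two[OF T] by (auto simp: base_point_def)
    ultimately show "regular_on_u_axis D ?uv \<or> regular_on_V_axis D ?UV" by blast
  qed
qed

text \<open>One failing branch is enough. The branch through 2 is available over every region,
  unlike the one that requires \<open>g\<close> to be nonzero.\<close>

lemma not_resolved_chart_UV: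
  assumes T: "\<And>x. x \<in> D \<Longrightarrow>
      has_fraction (fst T x) (\<lambda>U V. - 10 * U^2 - 8 * w x * U^2 * V + 4 * U * V - 3 * m x * U * V^2 + 2 * g x * V^3) (\<lambda>U V. V^2) \<and>
      has_fraction (snd T x) (\<lambda>U V. - 4 * U - 4 * w x * U * V + V - m x * V^2) (\<lambda>U V. V)"
    and res: "\<And>x. x \<in> D \<Longrightarrow> \<not> resonant x"
  shows "\<not> resolved D T (\<lambda>_. 0) (\<lambda>_. 0)"
proof
  assume "resolved D T (\<lambda>_. 0) (\<lambda>_. 0)"
  moreover have "base_point D (blowup_uv T (\<lambda>_. 0) (\<lambda>_. 0)) (\<lambda>_. 0) (\<lambda>_. 2)"
    using D indeterminate_two[OF T] by (auto simp: base_point_def)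
  ultimately have "resolved D (blowup_uv T (\<lambda>_. 0) (\<lambda>_. 0)) (\<lambda>_. 0) (\<lambda>_. 2)"
    by (rule resolved_uvD)
  thus False using not_resolved_two[of "blowup_uv T (\<lambda>_. 0) (\<lambda>_. 0)" "\<lambda>_. 2", OF blowup_chart_UV_uv[OF T] refl res] by blast
qed

end

subsection \<open>The regularising condition\<close>

text \<open>
  Solved for \<open>\<kappa>inf\<close>, the Painleve equation says that
  \<open>(2 w w'' - w'\<^sup>2 + 4 w\<^sup>2 + (\<kappa>0 + 2 x w + w\<^sup>2) (\<kappa>0 - 2 x w - 3 w\<^sup>2)) / w\<^sup>2\<close> equals \<open>- 8 \<kappa>inf\<close>.
  The condition is the vanishing of \<open>w\<^sup>3 / 2\<close> times the derivative of this expression.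
\<close>

definition regularising_condition :: "complex \<Rightarrow> (complex \<Rightarrow> complex) \<Rightarrow> complex \<Rightarrow> complex" where
  "regularising_condition \<kappa>0 w x = w x ^ 2 * (deriv ^^ 3) w x - 2 * w x * deriv w x * (deriv ^^ 2) w x + deriv w x ^ 3
     - 4 * x * w x ^ 3 - 4 * w x ^ 4 - 4 * x * w x ^ 3 * deriv w x - 3 * w x ^ 4 * deriv w x - \<kappa>0 ^ 2 * deriv w x"

text \<open>The assumptions are m w = \<kappa>0 + w' - w^2 and its first two derivatives. They
  eliminate \<kappa>0 and the higher derivatives of \<open>w\<close>, after which F is w^3 times an
  expression in \<open>m\<close>, \<open>w\<close> and \<open>x\<close> without
  denominators.\<close>

lemma condition_identity:
  fixes k w w1 w2 w3 m m1 m2 x :: complex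
  assumes "k = m * w - w1 + w ^ 2"
    and "w2 = m1 * w + m * w1 + 2 * w * w1"
    and "w3 = m2 * w + 2 * m1 * w1 + m * w2 + 2 * w1 ^ 2 + 2 * w * w2"
  shows "w ^ 2 * w3 - 2 * w * w1 * w2 + w1 ^ 3 - 4 * x * w ^ 3 - 4 * w ^ 4 - 4 * x * w ^ 3 * w1 - 3 * w ^ 4 * w1 - k ^ 2 * w1 =
    w ^ 3 * (m2 + m * m1 + 2 * m1 * w + 2 * m * w1 - 4 * x * w1 - 4 * (w + x))"
  unfolding assms(3) unfolding assms(2) unfolding assms(1) by algebra

text \<open>Here r = 2 m - 4 x, and the other arguments are r', s and s' written out. Eliminating
  \<open>m\<close> through \<open>g\<close> makes both sides polynomials; the defect is a constant
  times F / w^3.\<close>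

lemma resonance_identity:
  fixes g m m1 m2 w w1 x :: complex
  assumes "g = (2 * x + 2 * w + m) / 4"
  shows "4 * ((2 * m - 4 * x) * (2 * m1 - 4) - 4 * (2 * m1 - 4) * (w + x) - 4 * (2 * m - 4 * x) * (w1 + 1) - 4 * m2)
      - polyG w m g (2 * m - 4 * x) (2 * m1 - 4)
          ((2 * m - 4 * x) ^ 2 / 2 - 4 * (2 * m - 4 * x) * (w + x) - 2 * (2 * m1 - 4)) (2 * m - 4 * x) 2 =
    - 16 * (m2 + m * m1 + 2 * m1 * w + 2 * m * w1 - 4 * x * w1 - 4 * (w + x))"
proof -
  have "4 * g = 2 * x + 2 * w + m" unfolding assms by simp
  hence m: "m = 4 * g - 2 * x - 2 * w" by algebra
  have sq: "(2 * m - 4 * x) ^ 2 / 2 = 2 * (m - 2 * x) ^ 2" by (simp add: power2_eq_square field_simps)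
  show ?thesis unfolding sq polyG_def polyR_def polyR_quotient_def polyB_def unfolding m by algebra
qed

text \<open>Put E = 2 g^2 - m g - g', so that \<epsilon> = E / g^3. The identity is
  \<open>compatible\<close> with the \<epsilon>' that results from E' = 0.\<close>

lemma compatible_identity:
  fixes g g1 m :: complex
  assumes "g \<noteq> 0"
  shows "(2 * g ^ 2 - m * g - g1) / g ^ 3 * (8 + 4 * m * (- 1 / g) - g1 / g ^ 2 - 4 * g * ((2 * g ^ 2 - m * g - g1) / g ^ 3)) =
    - 1 / g * (- 3 * g1 * (2 * g ^ 2 - m * g - g1) / g ^ 4)"
proof -
  have "8 + 4 * m * (- 1 / g) - g1 / g ^ 2 - 4 * g * ((2 * g ^ 2 - m * g - g1) / g ^ 3) = 3 * g1 / g ^ 2"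
    using assms by (simp add: field_simps eval_nat_numeral)
  thus ?thesis using assms by (simp add: field_simps eval_nat_numeral)
qed

text \<open>The left-hand side is 4 E' for E = 2 g^2 - m g - g', so F = 0 says that E is constant.
  For a Painleve transcendent the constant is \<kappa>inf, by Hamilton's second equation. This is
  the link between the conditions of the two branches.\<close>

lemma condition_identity_g:
  fixes g g1 g2 m m1 m2 w w1 w2 x :: complex
  assumes "m = 4 * g - 2 * x - 2 * w" "m1 = 4 * g1 - 2 - 2 * w1" "m2 = 4 * g2 - 2 * w2"
    and "w2 = m1 * w + m * w1 + 2 * w * w1"
  shows "4 * (4 * g * g1 - m1 * g - m * g1 - g2) =
    - (m2 + m * m1 + 2 * m1 * w + 2 * m * w1 - 4 * x * w1 - 4 * (w + x))"
  unfolding assms(3) unfolding assms(4) unfolding assms(2) unfolding assms(1) by algebra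

context cascade
begin

lemma DERIV_on: "f holomorphic_on D \<Longrightarrow> x \<in> D \<Longrightarrow> (f has_field_derivative deriv f x) (at x)"
  using holomorphic_derivI[OF _ open_D] .

lemma deriv_const_zero:
  assumes "\<And>x. x \<in> D \<Longrightarrow> f x = 0" "x \<in> D" "(f has_field_derivative d) (at x)"
  shows "d = 0"
  using DERIV_imp_deriv[OF assms(3)] deriv_const_on[OF assms(1,2)] by simp

text \<open>Derivatives are taken of the polynomial relation m w = \<kappa>0 + w' - w^2, which holds
  on an open set, and not of the quotient that defines \<open>m\<close>.\<close>

lemma jet_relations:
  assumes x: "x \<in> D"
  shows "m x * w x = \<kappa>0 + deriv w x - w x ^ 2"
    and "deriv m x * w x + m x * deriv w x = deriv (deriv w) x - 2 * w x * deriv w x"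
    and "deriv (deriv m) x * w x + 2 * deriv m x * deriv w x + m x * deriv (deriv w) x =
           deriv (deriv (deriv w)) x - 2 * deriv w x ^ 2 - 2 * w x * deriv (deriv w) x"
proof -
  have rel: "m x * w x - (\<kappa>0 + deriv w x - w x ^ 2) = 0" if "x \<in> D" for x
    using w_nz[OF that] by (simp add: m_def)
  from rel[OF x] show "m x * w x = \<kappa>0 + deriv w x - w x ^ 2" by simp
  have holo: "deriv (deriv w) holomorphic_on D" "deriv m holomorphic_on D"
    by (intro holomorphic_deriv holo_w' holo_m open_D)+
  have rel': "deriv m x * w x + m x * deriv w x - (deriv (deriv w) x - 2 * w x * deriv w x) = 0" if x: "x \<in> D" for x
    by (rule deriv_const_zero[OF rel x])
       (use DERIV_on[OF holo_m x] DERIV_on[OF holo_w x] DERIV_on[OF holo_w' x] in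
         \<open>auto intro!: derivative_eq_intros simp: power2_eq_square algebra_simps\<close>)
  from rel'[OF x] show "deriv m x * w x + m x * deriv w x = deriv (deriv w) x - 2 * w x * deriv w x" by simp
  have "deriv (deriv m) x * w x + 2 * deriv m x * deriv w x + m x * deriv (deriv w) x -
           (deriv (deriv (deriv w)) x - 2 * deriv w x ^ 2 - 2 * w x * deriv (deriv w) x) = 0"
    by (rule deriv_const_zero[OF rel' x])
       (use DERIV_on[OF holo_m x] DERIV_on[OF holo_w x] DERIV_on[OF holo_w' x] DERIV_on[OF holo(1) x] DERIV_on[OF holo(2) x] in
         \<open>auto intro!: derivative_eq_intros simp: power2_eq_square algebra_simps\<close>)
  thus "deriv (deriv m) x * w x + 2 * deriv m x * deriv w x + m x * deriv (deriv w) x =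
           deriv (deriv (deriv w)) x - 2 * deriv w x ^ 2 - 2 * w x * deriv (deriv w) x" by simp
qed

lemma condition_jet:
  assumes x: "x \<in> D"
  shows "regularising_condition \<kappa>0 w x / w x ^ 3 =
    deriv (deriv m) x + m x * deriv m x + 2 * deriv m x * w x + 2 * m x * deriv w x - 4 * x * deriv w x - 4 * (w x + x)"
proof -
  define a b where "a = deriv (deriv w) x" and "b = deriv (deriv (deriv w)) x"
  have 1: "\<kappa>0 = m x * w x - deriv w x + w x ^ 2"
    and 2: "a = deriv m x * w x + m x * deriv w x + 2 * w x * deriv w x"
    and 3: "b = deriv (deriv m) x * w x + 2 * deriv m x * deriv w x + m x * a + 2 * deriv w x ^ 2 + 2 * w x * a"
    using jet_relations[OF x] by (simp_all add: a_def b_def)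
  have "regularising_condition \<kappa>0 w x = w x ^ 2 * b - 2 * w x * deriv w x * a + deriv w x ^ 3
     - 4 * x * w x ^ 3 - 4 * w x ^ 4 - 4 * x * w x ^ 3 * deriv w x - 3 * w x ^ 4 * deriv w x - \<kappa>0 ^ 2 * deriv w x"
    by (simp add: regularising_condition_def a_def b_def eval_nat_numeral)
  also have "\<dots> = w x ^ 3 * (deriv (deriv m) x + m x * deriv m x + 2 * deriv m x * w x + 2 * m x * deriv w x - 4 * x * deriv w x - 4 * (w x + x))"
    by (rule condition_identity[OF 1 2 3])
  finally show ?thesis using w_nz[OF x] by (simp add: field_simps)
qed

lemma resonant_iff:
  assumes x: "x \<in> D"
  shows "resonant x \<longleftrightarrow> regularising_condition \<kappa>0 w x = 0"
proof -
  have holo: "deriv m holomorphic_on D"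
    by (intro holomorphic_deriv holo_m open_D)
  \<comment> \<open>This removes \<open>g\<close>, and with it \<open>w\<close>, from
    \<open>r\<close>, so that r' and s' need no derivative of \<open>g\<close>.\<close>
  have r: "r x = 2 * m x - 4 * x" for x
  proof -
    have "4 * g x = 2 * x + 2 * w x + m x" unfolding g_def by simp
    thus ?thesis unfolding r_def by algebra
  qed
  have r': "deriv r x = 2 * deriv m x - 4" if x: "x \<in> D" for x
    unfolding r[abs_def]
    by (rule DERIV_imp_deriv) (use DERIV_on[OF holo_m x] in \<open>auto intro!: derivative_eq_intros\<close>)
  have s: "s x = (2 * m x - 4 * x) ^ 2 / 2 - 4 * (2 * m x - 4 * x) * (w x + x) - 2 * (2 * deriv m x - 4)" if x: "x \<in> D" for x
  proof -
    have "r x * (polyR (w x) (m x) (g x) 2 - 7 * r x) / 2 = (2 * m x - 4 * x) ^ 2 / 2 - 4 * (2 * m x - 4 * x) * (w x + x)"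
    proof -
      have R: "polyR (w x) (m x) (g x) 2 - 7 * (2 * m x - 4 * x) = (2 * m x - 4 * x) - 8 * (w x + x)"
        unfolding polyR_def g_def by (simp add: field_simps)
      show ?thesis unfolding r R by (simp add: field_simps power2_eq_square)
    qed
    thus ?thesis unfolding s_def r'[OF x] by simp
  qed
  have s': "deriv s x = (2 * m x - 4 * x) * (2 * deriv m x - 4) - 4 * (2 * deriv m x - 4) * (w x + x)
      - 4 * (2 * m x - 4 * x) * (deriv w x + 1) - 4 * deriv (deriv m) x" (is "_ = ?d")
  proof (rule trans[OF deriv_eq_on[OF _ x] DERIV_imp_deriv])
    show "s y = (2 * m y - 4 * y) ^ 2 / 2 - 4 * (2 * m y - 4 * y) * (w y + y) - 2 * (2 * deriv m y - 4)" if "y \<in> D" for y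
      by (rule s[OF that])
    show "((\<lambda>y. (2 * m y - 4 * y) ^ 2 / 2 - 4 * (2 * m y - 4 * y) * (w y + y) - 2 * (2 * deriv m y - 4)) has_field_derivative ?d) (at x)"
      using DERIV_on[OF holo_m x] DERIV_on[OF holo_w x] DERIV_on[OF holo x]
      by (auto intro!: derivative_eq_intros simp: field_simps power2_eq_square)
  qed
  have "4 * deriv s x - polyG (w x) (m x) (g x) (r x) (deriv r x) (s x) (r x) 2 =
    - 16 * (deriv (deriv m) x + m x * deriv m x + 2 * deriv m x * w x + 2 * m x * deriv w x - 4 * x * deriv w x - 4 * (w x + x))"
    unfolding s' s[OF x] r'[OF x] r by (rule resonance_identity) (simp add: g_def)
  also have "\<dots> = - 16 * (regularising_condition \<kappa>0 w x / w x ^ 3)"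
    unfolding condition_jet[OF x] ..
  finally show ?thesis
    using w_nz[OF x] by (auto simp: resonant_def)
qed

lemma compatible_if:
  assumes x: "x \<in> D" and gx: "g x \<noteq> 0" and cond: "regularising_condition \<kappa>0 w x = 0"
  shows "compatible x"
proof -
  \<comment> \<open>The formula for \<epsilon> in terms of g and g' is valid only off the zeros of
    \<open>g\<close>; openness of this set allows it to be differentiated.\<close>
  define D' where "D' = {x \<in> D. g x \<noteq> 0}"
  have "D' = D \<inter> g -` (- {0})" by (auto simp: D'_def)
  hence "open D'"
    using continuous_open_preimage[OF holomorphic_on_imp_continuous_on[OF holo_g] open_D, of "- {0}"] by (simp add: open_Compl)
  have "x \<in> D'" using x gx by (simp add: D'_def)
  have holo: "deriv m holomorphic_on D" "deriv g holomorphic_on D"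
    by (intro holomorphic_deriv holo_m holo_g open_D)+
  have g1: "deriv g x = (2 + 2 * deriv w x + deriv m x) / 4" if x: "x \<in> D" for x
    unfolding g_def[abs_def]
    by (rule DERIV_imp_deriv) (use DERIV_on[OF holo_m x] DERIV_on[OF holo_w x] in \<open>auto intro!: derivative_eq_intros\<close>)
  have g2: "deriv (deriv g) x = (2 * deriv (deriv w) x + deriv (deriv m) x) / 4"
  proof (rule trans[OF deriv_eq_on[OF _ x] DERIV_imp_deriv])
    show "deriv g y = (2 + 2 * deriv w y + deriv m y) / 4" if "y \<in> D" for y
      by (rule g1[OF that])
    show "((\<lambda>y. (2 + 2 * deriv w y + deriv m y) / 4) has_field_derivative (2 * deriv (deriv w) x + deriv (deriv m) x) / 4) (at x)"
      using DERIV_on[OF holo(1) x] DERIV_on[OF holo_w' x] by (auto intro!: derivative_eq_intros)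
  qed
  have \<tau>1: "deriv \<tau> x = deriv g x / g x ^ 2" if "x \<in> D'" for x
    unfolding \<tau>_def[abs_def]
    by (rule DERIV_imp_deriv)
       (use that DERIV_on[OF holo_g, of x] in \<open>auto intro!: derivative_eq_intros simp: D'_def power2_eq_square\<close>)
  have \<epsilon>: "\<epsilon> x = (2 * g x ^ 2 - m x * g x - deriv g x) / g x ^ 3" if "x \<in> D'" for x
    using that unfolding \<epsilon>_def \<tau>1[OF that] by (simp add: \<tau>_def D'_def field_simps eval_nat_numeral)
  have "4 * (4 * g x * deriv g x - deriv m x * g x - m x * deriv g x - deriv (deriv g) x) =
    - (deriv (deriv m) x + m x * deriv m x + 2 * deriv m x * w x + 2 * m x * deriv w x - 4 * x * deriv w x - 4 * (w x + x))"
  proof (rule condition_identity_g)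
    have "4 * g x = 2 * x + 2 * w x + m x" unfolding g_def by simp
    thus "m x = 4 * g x - 2 * x - 2 * w x" by algebra
    have "4 * deriv g x = 2 + 2 * deriv w x + deriv m x" unfolding g1[OF x] by simp
    thus "deriv m x = 4 * deriv g x - 2 - 2 * deriv w x" by algebra
    have "4 * deriv (deriv g) x = 2 * deriv (deriv w) x + deriv (deriv m) x" unfolding g2 by simp
    thus "deriv (deriv m) x = 4 * deriv (deriv g) x - 2 * deriv (deriv w) x" by algebra
    show "deriv (deriv w) x = deriv m x * w x + m x * deriv w x + 2 * w x * deriv w x"
      using jet_relations(2)[OF x] by algebra
  qed
  also have "\<dots> = 0"
    using condition_jet[OF x] cond by simp
  \<comment> \<open>This is E' = 0 for E = 2 g^2 - m g - g', so \<epsilon> = E / g^3 is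
    differentiated as if E were constant.\<close>
  finally have e0: "deriv (deriv g) x = 4 * g x * deriv g x - deriv m x * g x - m x * deriv g x" by algebra
  have "deriv \<epsilon> x = deriv (\<lambda>x. (2 * g x ^ 2 - m x * g x - deriv g x) / g x ^ 3) x"
    using \<epsilon> \<open>open D'\<close> \<open>x \<in> D'\<close> by (intro deriv_cong_ev) (auto simp: eventually_nhds)
  also have "\<dots> = - 3 * deriv g x * (2 * g x ^ 2 - m x * g x - deriv g x) / g x ^ 4"
    by (rule DERIV_imp_deriv)
       (use gx e0 DERIV_on[OF holo_g x] DERIV_on[OF holo_m x] DERIV_on[OF holo(2) x] in
         \<open>auto intro!: derivative_eq_intros simp: field_simps eval_nat_numeral\<close>)
  finally have \<epsilon>1: "deriv \<epsilon> x = - 3 * deriv g x * (2 * g x ^ 2 - m x * g x - deriv g x) / g x ^ 4" .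
  show ?thesis
    unfolding compatible_def \<epsilon>1 \<epsilon>[OF \<open>x \<in> D'\<close>] \<tau>1[OF \<open>x \<in> D'\<close>] \<tau>_def
    by (rule compatible_identity[OF gx])
qed

lemma holo_condition: "regularising_condition \<kappa>0 w holomorphic_on D"
  unfolding regularising_condition_def[abs_def]
  by (intro holomorphic_intros holo_w holo_w' holomorphic_higher_deriv open_D)

end

text \<open>The denominators 2 w and w are cleared to make all coefficients differential polynomials
  of order 1. Outer lists run over powers of z, inner ones over powers of y. \<kappa>inf has
  disappeared together with the second derivative of \<open>q\<close>.\<close>

definition bg_system :: "complex \<Rightarrow> jet_system" where
  "bg_system \<kappa>0 =
     \<lparr>numP = \<lambda>w x. [:[:\<kappa>0 + deriv w x + 2 * x * w x + w x ^ 2, - 4 * (\<kappa>0 + deriv w x - w x ^ 2), - 8 * w x ^ 2:],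
                     [:0, 6 * w x, - 12 * w x:]:],
      denP = \<lambda>w x. [:[:2 * w x:]:],
      numQ = \<lambda>w x. [:0, [:\<kappa>0 + deriv w x - w x ^ 2, 4 * w x ^ 2:], [:- w x, 4 * w x:]:],
      denQ = \<lambda>w x. [:[:w x:]:]\<rparr>"

context cascade
begin

abbreviation S where "S \<equiv> specialise (bg_system \<kappa>0) w"

lemma bg_system_eq:
  assumes "x \<in> D"
  shows "fst S x y z = - 6 * y^2 * z - 4 * w x * y^2 + 3 * y * z - 2 * m x * y + 2 * g x"
    and "snd S x y z = 4 * y * z^2 + 4 * w x * y * z - z^2 + m x * z"
  using w_nz[OF assms]
  by (simp_all add: specialise_def bg_system_def ev_def m_def g_def field_simps eval_nat_numeral)

lemma chart_uv_fraction:
  assumes x: "x \<in> D"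
  shows "has_fraction (fst (chart_uv S) x) (\<lambda>u v. 6 * v + 4 * w x * u - 3 * u * v + 2 * m x * u^2 - 2 * g x * u^3) (\<lambda>u v. u) \<and>
      has_fraction (snd (chart_uv S) x) (\<lambda>u v. 10 * v^2 + 8 * w x * u * v - 4 * u * v^2 + 3 * m x * u^2 * v - 2 * g x * u^3 * v) (\<lambda>u v. u^2)"
proof -
  have nz: "nz (\<lambda>u v. u)" "nz (\<lambda>u v. u^2)"
    by (auto intro!: nzI[of _ 1 1] polyfun_intros)
  have "generically (\<lambda>u v. fst (chart_uv S) x u v = (6 * v + 4 * w x * u - 3 * u * v + 2 * m x * u^2 - 2 * g x * u^3) / u)"
  proof (rule generically_mono[OF generically_nz[OF nz(1)]], goal_cases)
    case (1 u v)
    thus ?case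
      unfolding chart_uv_def fst_conv snd_conv bg_system_eq[OF x]
      by (simp add: field_simps power2_eq_square power3_eq_cube)
  qed
  moreover have "generically (\<lambda>u v. snd (chart_uv S) x u v =
      (10 * v^2 + 8 * w x * u * v - 4 * u * v^2 + 3 * m x * u^2 * v - 2 * g x * u^3 * v) / u^2)"
  proof (rule generically_mono[OF generically_nz[OF nz(1)]], goal_cases)
    case (1 u v)
    thus ?case
      unfolding chart_uv_def fst_conv snd_conv bg_system_eq[OF x]
      by (simp add: field_simps power2_eq_square power3_eq_cube)
  qed
  ultimately show ?thesis
    unfolding has_fraction_def using nz by (intro conjI polyfun_intros) auto
qed

lemma chart_UV_fraction:
  assumes x: "x \<in> D"
  shows "has_fraction (fst (chart_UV S) x) (\<lambda>U V. - 10 * U^2 - 8 * w x * U^2 * V + 4 * U * V - 3 * m x * U * V^2 + 2 * g x * V^3) (\<lambda>U V. V^2) \<and>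
      has_fraction (snd (chart_UV S) x) (\<lambda>U V. - 4 * U - 4 * w x * U * V + V - m x * V^2) (\<lambda>U V. V)"
proof -
  have nz: "nz (\<lambda>U V. V)" "nz (\<lambda>U V. V^2)"
    by (auto intro!: nzI[of _ 1 1] polyfun_intros)
  have "generically (\<lambda>U V. fst (chart_UV S) x U V =
      (- 10 * U^2 - 8 * w x * U^2 * V + 4 * U * V - 3 * m x * U * V^2 + 2 * g x * V^3) / V^2)"
  proof (rule generically_mono[OF generically_nz[OF nz(1)]], goal_cases)
    case (1 U V)
    thus ?case
      unfolding chart_UV_def fst_conv snd_conv bg_system_eq[OF x]
      by (simp add: field_simps power2_eq_square power3_eq_cube)
  qed
  moreover have "generically (\<lambda>U V. snd (chart_UV S) x U V = (- 4 * U - 4 * w x * U * V + V - m x * V^2) / V)"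
  proof (rule generically_mono[OF generically_nz[OF nz(1)]], goal_cases)
    case (1 U V)
    thus ?case
      unfolding chart_UV_def fst_conv snd_conv bg_system_eq[OF x]
      by (simp add: field_simps power2_eq_square power3_eq_cube)
  qed
  ultimately show ?thesis
    unfolding has_fraction_def using nz by (intro conjI polyfun_intros) auto
qed

lemma regularised_iff:
  "regularised D S \<longleftrightarrow> (\<forall>x\<in>D. regularising_condition \<kappa>0 w x = 0)"
proof
  assume cond: "\<forall>x\<in>D. regularising_condition \<kappa>0 w x = 0"
  show "regularised D S"
    unfolding regularised_def
  proof (intro conjI allI impI)
    fix D' a b assume D': "D' \<subseteq> D" and bp: "base_point D' S a b"
    have "\<not> indeterminate_at (fst S x) y z \<and> \<not> indeterminate_at (snd S x) y z" if x: "x \<in> D" for x y z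
    proof -
      have "nz (\<lambda>y z. 1)" by (auto intro!: nzI polyfun_intros)
      moreover have "generically (\<lambda>y z. True)" using generically_nz[OF calculation] by simp
      ultimately have "has_fraction (fst S x) (\<lambda>y z. - 6 * y^2 * z - 4 * w x * y^2 + 3 * y * z - 2 * m x * y + 2 * g x) (\<lambda>y z. 1) \<and>
          has_fraction (snd S x) (\<lambda>y z. 4 * y * z^2 + 4 * w x * y * z - z^2 + m x * z) (\<lambda>y z. 1)"
        using x unfolding has_fraction_def by (auto simp: bg_system_eq intro!: polyfun_intros)
      thus ?thesis by (rule not_indeterminate_both) auto
    qed
    hence "\<not> base_point D' S a b"
      using D' by (intro not_base_point[OF base_point_region[OF bp]]) blast
    thus "resolved D' S a b" using bp by blast
  next
    fix D' c assume D': "D' \<subseteq> D" and bp: "base_point D' (chart_uv S) (\<lambda>_. 0) c"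
    have "c x = 0" if x: "x \<in> D'" for x
    proof (rule ccontr)
      assume "c x \<noteq> 0"
      hence "\<not> indeterminate_at (fst (chart_uv S) x) 0 (c x) \<and> \<not> indeterminate_at (snd (chart_uv S) x) 0 (c x)"
        using x D' by (intro not_indeterminate_both[OF chart_uv_fraction]) auto
      thus False using base_pointD[OF bp x] by auto
    qed
    thus "resolved D' (chart_uv S) (\<lambda>_. 0) c"
      using D' chart_uv_fraction by (intro cascade.resolved_chart_uv[OF restrict[OF D' base_point_region[OF bp]]]) auto
  next
    fix D' assume D': "D' \<subseteq> D" and bp: "base_point D' (chart_UV S) (\<lambda>_. 0) (\<lambda>_. 0)"
    show "resolved D' (chart_UV S) (\<lambda>_. 0) (\<lambda>_. 0)"
      using D' chart_UV_fraction cond resonant_iff compatible_if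
      by (intro cascade.resolved_chart_UV[OF restrict[OF D' base_point_region[OF bp]]]) auto
  qed
next
  assume reg: "regularised D S"
  show "\<forall>x\<in>D. regularising_condition \<kappa>0 w x = 0"
  proof (intro ballI, rule ccontr)
    fix x assume x: "x \<in> D" and cond: "regularising_condition \<kappa>0 w x \<noteq> 0"
    \<comment> \<open>By continuity F has no zero on a whole ball. The negative result needs this,
      as it assumes that resonance fails at every point of its region.\<close>
    have "isCont (regularising_condition \<kappa>0 w) x"
      using holomorphic_on_imp_continuous_on[OF holo_condition] open_D x by (simp add: continuous_on_eq_continuous_at)
    hence "\<forall>\<^sub>F y in nhds x. regularising_condition \<kappa>0 w y \<noteq> 0"
      using cond by (simp add: isCont_def tendsto_nhds_iff tendsto_imp_eventually_ne)
    moreover have "\<forall>\<^sub>F y in nhds x. y \<in> D"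
      using open_D x by (rule eventually_nhds_in_open)
    ultimately have "\<forall>\<^sub>F y in nhds x. regularising_condition \<kappa>0 w y \<noteq> 0 \<and> y \<in> D"
      by (rule eventually_conj)
    then obtain e where e: "e > 0" "\<And>y. y \<in> ball x e \<Longrightarrow> regularising_condition \<kappa>0 w y \<noteq> 0 \<and> y \<in> D"
      by (auto simp: eventually_nhds_metric dist_commute)
    have sub: "ball x e \<subseteq> D" and ball: "region (ball x e)"
      using e by (auto simp: region_def)
    have "indeterminate_at (snd (chart_UV S) x) 0 0" if "x \<in> D" for x
      by (rule indeterminate_at_v_axis[OF chart_UV_fraction[OF that, THEN conjunct2], where k = 1 and D = "\<lambda>U V. 1" and c = 1])
         (auto intro!: polyfun_intros)
    hence "base_point (ball x e) (chart_UV S) (\<lambda>_. 0) (\<lambda>_. 0)"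
      using ball sub by (auto simp: base_point_def)
    hence "resolved (ball x e) (chart_UV S) (\<lambda>_. 0) (\<lambda>_. 0)"
      using reg sub by (auto simp: regularised_def)
    moreover have "\<not> resolved (ball x e) (chart_UV S) (\<lambda>_. 0) (\<lambda>_. 0)"
      using chart_UV_fraction sub e resonant_iff by (intro cascade.not_resolved_chart_UV[OF restrict[OF sub ball]]) auto
    ultimately show False by blast
  qed
qed

end

section \<open>Differential polynomials\<close>

lemma diff_poly_intros:
  shows diff_poly_w: "(\<lambda>w x. w x) \<in> diff_poly n"
    and diff_poly_deriv: "1 \<le> n \<Longrightarrow> (\<lambda>w x. deriv w x) \<in> diff_poly n"
    and diff_poly_uminus: "F \<in> diff_poly n \<Longrightarrow> (\<lambda>w x. - F w x) \<in> diff_poly n"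
    and diff_poly_diff: "F \<in> diff_poly n \<Longrightarrow> G \<in> diff_poly n \<Longrightarrow> (\<lambda>w x. F w x - G w x) \<in> diff_poly n"
    and diff_poly_power: "F \<in> diff_poly n \<Longrightarrow> (\<lambda>w x. F w x ^ k) \<in> diff_poly n"
proof -
  show "(\<lambda>w x. w x) \<in> diff_poly n"
    using diff_poly.jet[of 0 n] by (simp add: id_def)
  show "1 \<le> n \<Longrightarrow> (\<lambda>w x. deriv w x) \<in> diff_poly n"
    using diff_poly.jet[of 1 n] by simp
  have uminus: "(\<lambda>w x. - F w x) \<in> diff_poly n" if "F \<in> diff_poly n" for F
    using diff_poly.mult[OF diff_poly.const[of "- 1"] that] by simp
  thus "F \<in> diff_poly n \<Longrightarrow> (\<lambda>w x. - F w x) \<in> diff_poly n" .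
  show "F \<in> diff_poly n \<Longrightarrow> G \<in> diff_poly n \<Longrightarrow> (\<lambda>w x. F w x - G w x) \<in> diff_poly n"
    using diff_poly.add[OF _ uminus[of G], of F] by simp
  show "F \<in> diff_poly n \<Longrightarrow> (\<lambda>w x. F w x ^ k) \<in> diff_poly n"
    by (induction k) (auto intro: diff_poly.const diff_poly.mult)
qed

lemma regularising_condition_diff_poly: "regularising_condition \<kappa>0 \<in> diff_poly 3"
  unfolding regularising_condition_def[abs_def]
  by (intro diff_poly.const diff_poly.indep diff_poly.jet diff_poly.add diff_poly.mult diff_poly_intros) auto

lemma regularising_condition_nontrivial:
  "\<exists>w x. w holomorphic_on UNIV \<and> regularising_condition \<kappa>0 w x \<noteq> 0"
  \<comment> \<open>For constant w = 1 the condition has the value - 4 x - 4.\<close>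
  by (intro exI[of _ "\<lambda>_. 1"] exI[of _ 0]) (simp add: regularising_condition_def)

lemma nat_cases_3: "n = 0 \<or> n = Suc 0 \<or> n = Suc (Suc 0) \<or> (\<exists>k. n = Suc (Suc (Suc k)))"
  by presburger

lemma jet_rational_bg_system: "jet_rational (bg_system \<kappa>0)"
  unfolding jet_rational_def
proof (intro ballI conjI allI)
  fix p assume "p \<in> jet_polys (bg_system \<kappa>0)"
  hence p: "p = numP (bg_system \<kappa>0) \<or> p = denP (bg_system \<kappa>0) \<or> p = numQ (bg_system \<kappa>0) \<or> p = denQ (bg_system \<kappa>0)"
    by (auto simp: jet_polys_def)
  have "degrees_le 2 (p w x)" for w x
    using p by (auto simp: degrees_le_def bg_system_def coeff_pCons split: nat.split intro!: degree_le)
  thus "\<exists>N. \<forall>w x. degrees_le N (p w x)" by blast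
  show "(\<lambda>w x. coeff (coeff (p w x) j) i) \<in> diff_poly 1" for i j
    using p nat_cases_3[of i] nat_cases_3[of j]
    by (auto simp: bg_system_def intro!: diff_poly.const diff_poly.indep diff_poly.add diff_poly.mult diff_poly_intros)
qed

section \<open>Painleve transcendents satisfy the condition\<close>

lemma eventually_cosparse_nhds:
  assumes "open D" "\<forall>\<^sub>\<approx>x\<in>D. P x"
  shows "\<forall>\<^sub>\<approx>x\<in>D. P x \<and> (\<forall>\<^sub>F y in nhds x. P y)"
proof -
  have "\<forall>\<^sub>\<approx>x\<in>D. P x \<and> x \<in> D"
    by (rule eventually_conj[OF assms(2) eventually_in_cosparse[OF order.refl assms(1)]])
  thus ?thesis
  proof (rule eventually_mono)
    fix x assume x: "P x \<and> x \<in> D"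
    have "\<forall>\<^sub>F y in at x. P y"
      using assms x by (simp add: eventually_cosparse_open_eq)
    thus "P x \<and> (\<forall>\<^sub>F y in nhds x. P y)"
      using x by (auto simp: eventually_at_filter elim: eventually_mono)
  qed
qed

text \<open>The equation is given only pointwise off a sparse set. To be differentiated at
  \<open>x\<close> it has to hold near \<open>x\<close>, with \<open>q\<close> analytic there, and
  this too is true off a sparse set.\<close>

lemma solves_PIV_cosparse:
  assumes "solves_PIV \<alpha> \<beta> D q"
  shows "\<forall>\<^sub>\<approx>x\<in>D. \<forall>\<^sub>F y in nhds x. q analytic_on {y} \<and> q y \<noteq> 0 \<and>
      deriv (deriv q) y = (deriv q y)\<^sup>2 / (2 * q y) + 3 / 2 * q y ^ 3 + 4 * y * (q y)\<^sup>2
          + 2 * (y\<^sup>2 - \<alpha>) * q y + \<beta> / q y"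
proof -
  have "\<forall>\<^sub>\<approx>x\<in>D. q analytic_on {x}"
    using assms meromorphic_on_imp_analytic_cosparse[of q D] by (simp add: solves_PIV_def)
  moreover have "open D" using assms by (simp add: solves_PIV_def region_def)
  ultimately show ?thesis
    using assms eventually_cosparse_nhds[of D "\<lambda>x. q analytic_on {x} \<and> q x \<noteq> 0 \<and>
      deriv (deriv q) x = (deriv q x)\<^sup>2 / (2 * q x) + 3 / 2 * q x ^ 3 + 4 * x * (q x)\<^sup>2
          + 2 * (x\<^sup>2 - \<alpha>) * q x + \<beta> / q x"]
    by (auto simp: solves_PIV_def eventually_conj_iff elim: eventually_mono)
qed

lemma DERIV_analytic: "f analytic_on {x} \<Longrightarrow> (f has_field_derivative deriv f x) (at x)"
  by (simp add: DERIV_deriv_iff_field_differentiable analytic_on_imp_differentiable_at)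

lemma PIV_polynomial:
  fixes q q1 q2 y :: complex
  assumes "q \<noteq> 0" "q2 = q1\<^sup>2 / (2 * q) + 3 / 2 * q ^ 3 + 4 * y * q\<^sup>2
      + 2 * (y\<^sup>2 - (1 - \<kappa>0 / 2 + 2 * \<kappa>inf)) * q + - \<kappa>0\<^sup>2 / 2 / q"
  shows "2 * q * q2 - q1 ^ 2 + 4 * q ^ 2 + \<kappa>0 ^ 2 - 2 * \<kappa>0 * q ^ 2
      - 4 * y ^ 2 * q ^ 2 - 8 * y * q ^ 3 - 3 * q ^ 4 + 8 * \<kappa>inf * q ^ 2 = 0"
proof -
  have "2 * q * (q1\<^sup>2 / (2 * q)) = q1\<^sup>2" "2 * q * (- \<kappa>0\<^sup>2 / 2 / q) = - \<kappa>0\<^sup>2" "2 * q * (3 / 2 * q ^ 3) = 3 * q ^ 4"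
    "2 * q * (2 * (y\<^sup>2 - (1 - \<kappa>0 / 2 + 2 * \<kappa>inf)) * q) = 4 * (y\<^sup>2 - 1 - 2 * \<kappa>inf) * q\<^sup>2 + 2 * \<kappa>0 * q\<^sup>2"
    using assms(1) by (simp_all add: field_simps eval_nat_numeral)
  hence "2 * q * q2 = q1\<^sup>2 + 3 * q ^ 4 + 2 * q * (4 * y * q\<^sup>2)
      + (4 * (y\<^sup>2 - 1 - 2 * \<kappa>inf) * q\<^sup>2 + 2 * \<kappa>0 * q\<^sup>2) + - \<kappa>0\<^sup>2"
    unfolding assms(2) distrib_left by (simp only:)
  thus ?thesis by algebra
qed

lemma PIV_imp_condition:
  assumes q: "\<forall>\<^sub>F y in nhds x. q analytic_on {y} \<and> q y \<noteq> 0 \<and>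
      deriv (deriv q) y = (deriv q y)\<^sup>2 / (2 * q y) + 3 / 2 * q y ^ 3 + 4 * y * (q y)\<^sup>2
          + 2 * (y\<^sup>2 - alphaIV \<kappa>0 \<kappa>inf) * q y + betaIV \<kappa>0 / q y"
  shows "regularising_condition \<kappa>0 q x = 0"
proof -
  define \<Phi> where "\<Phi> y = 2 * q y * deriv (deriv q) y - deriv q y ^ 2 + 4 * q y ^ 2 + \<kappa>0 ^ 2 - 2 * \<kappa>0 * q y ^ 2
      - 4 * y ^ 2 * q y ^ 2 - 8 * y * q y ^ 3 - 3 * q y ^ 4 + 8 * \<kappa>inf * q y ^ 2" for y
  have \<Phi>: "\<forall>\<^sub>F y in nhds x. \<Phi> y = 0"
    using q by eventually_elim (unfold \<Phi>_def alphaIV_def betaIV_def, rule PIV_polynomial, auto)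
  have an: "q analytic_on {x}"
    using eventually_nhds_x_imp_x[OF q] by blast
  have an': "deriv q analytic_on {x}" "deriv (deriv q) analytic_on {x}"
    by (intro analytic_deriv an)+
  define q3 where "q3 = deriv (deriv (deriv q)) x"
  have "(\<Phi> has_field_derivative 2 * q x * q3 + 8 * q x * deriv q x - 4 * \<kappa>0 * q x * deriv q x - 8 * x * q x ^ 2
      - 8 * x ^ 2 * q x * deriv q x - 8 * q x ^ 3 - 24 * x * q x ^ 2 * deriv q x - 12 * q x ^ 3 * deriv q x
      + 16 * \<kappa>inf * q x * deriv q x) (at x)"
    unfolding \<Phi>_def[abs_def] q3_def
    using DERIV_analytic[OF an] DERIV_analytic[OF an'(1)] DERIV_analytic[OF an'(2)]
    by (auto intro!: derivative_eq_intros simp: field_simps eval_nat_numeral)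
  hence "2 * q x * q3 + 8 * q x * deriv q x - 4 * \<kappa>0 * q x * deriv q x - 8 * x * q x ^ 2
      - 8 * x ^ 2 * q x * deriv q x - 8 * q x ^ 3 - 24 * x * q x ^ 2 * deriv q x - 12 * q x ^ 3 * deriv q x
      + 16 * \<kappa>inf * q x * deriv q x = deriv \<Phi> x"
    by (rule DERIV_imp_deriv[symmetric])
  also have "deriv \<Phi> x = deriv (\<lambda>_. 0) x"
    using \<Phi> by (rule deriv_cong_ev) auto
  finally have 1: "2 * q x * q3 + 8 * q x * deriv q x - 4 * \<kappa>0 * q x * deriv q x - 8 * x * q x ^ 2
      - 8 * x ^ 2 * q x * deriv q x - 8 * q x ^ 3 - 24 * x * q x ^ 2 * deriv q x - 12 * q x ^ 3 * deriv q x
      + 16 * \<kappa>inf * q x * deriv q x = 0" by simp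
  have 2: "2 * q x * deriv (deriv q) x - deriv q x ^ 2 + 4 * q x ^ 2 + \<kappa>0 ^ 2 - 2 * \<kappa>0 * q x ^ 2
      - 4 * x ^ 2 * q x ^ 2 - 8 * x * q x ^ 3 - 3 * q x ^ 4 + 8 * \<kappa>inf * q x ^ 2 = 0"
    using eventually_nhds_x_imp_x[OF \<Phi>] by (simp add: \<Phi>_def)
  have "2 * regularising_condition \<kappa>0 q x =
      2 * (q x ^ 2 * q3 - 2 * q x * deriv q x * deriv (deriv q) x + deriv q x ^ 3
     - 4 * x * q x ^ 3 - 4 * q x ^ 4 - 4 * x * q x ^ 3 * deriv q x - 3 * q x ^ 4 * deriv q x - \<kappa>0 ^ 2 * deriv q x)"
    by (simp add: regularising_condition_def q3_def eval_nat_numeral)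
  \<comment> \<open>Twice the condition is q \<Phi>' - 2 q' \<Phi>, a combination in which
    \<kappa>inf cancels; equation \<open>1\<close> is \<Phi>' = 0 and \<open>2\<close> is \<Phi> =
    0.\<close>
  also have "\<dots> = 0"
    using 1 2 by algebra
  finally show ?thesis by simp
qed

lemma PIV_is_regularising_bg_system:
  "PIV_is_regularising (alphaIV \<kappa>0 \<kappa>inf) (betaIV \<kappa>0) (bg_system \<kappa>0)"
proof -
  have "regularised D (specialise (bg_system \<kappa>0) w) \<longleftrightarrow> (\<forall>x\<in>D. regularising_condition \<kappa>0 w x = 0)"
    if "admissible (bg_system \<kappa>0) D w" for D w
  proof -
    interpret cascade \<kappa>0 D w
      using that by unfold_locales (auto simp: admissible_def)
    show ?thesis by (rule regularised_iff)
  qed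
  moreover have "\<forall>\<^sub>\<approx>x\<in>D. regularising_condition \<kappa>0 w x = 0"
    if "solves_PIV (alphaIV \<kappa>0 \<kappa>inf) (betaIV \<kappa>0) D w" for D w
    using solves_PIV_cosparse[OF that] by (rule eventually_mono) (rule PIV_imp_condition)
  moreover have "\<exists>n. regularising_condition \<kappa>0 \<in> diff_poly n"
    using regularising_condition_diff_poly by blast
  ultimately show ?thesis
    unfolding PIV_is_regularising_def using regularising_condition_nontrivial[of \<kappa>0]
    by (intro exI[of _ "{regularising_condition \<kappa>0}"]) simp
qed

text \<open>Hamilton's first equation q' = 4 q z_4 - (q^2 + 2 x q + \<kappa>0), solved for z_4. The
  substitution is therefore a blow-up chart at the moving point (\<open>q\<close>,
  \<open>shift\<close>), with the roles of the two chart coordinates exchanged.\<close>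

definition shift :: "complex \<Rightarrow> (complex \<Rightarrow> complex) \<Rightarrow> complex \<Rightarrow> complex" where
  "shift \<kappa>0 q x = x / 2 + q x / 4 + (\<kappa>0 + deriv q x) / (4 * q x)"

lemma rational_overI:
  assumes "\<And>x. degrees_le N (n x) \<and> degrees_le N (d x)"
    and "\<And>i j. (\<lambda>x. coeff (coeff (n x) j) i) meromorphic_on D" "\<And>i j. (\<lambda>x. coeff (coeff (d x) j) i) meromorphic_on D"
    and "\<And>x. d x \<noteq> 0 \<and> (\<forall>y z. f x y z = ev (n x) y z / ev (d x) y z)"
  shows "rational_over D f"
  unfolding rational_over_def using assms by (intro exI[of _ n] exI[of _ d] exI[of _ N]) (auto intro: always_eventually)

subsection \<open>The transformation of the Okamoto system\<close>

lemma transforms_bg_system: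
  assumes q: "solves_PIV (alphaIV \<kappa>0 \<kappa>inf) (betaIV \<kappa>0) D q"
  shows "transforms D (\<lambda>x y z. z + q x) (\<lambda>x y z. y * z + shift \<kappa>0 q x)
           (hamiltonian_system (okamoto_H \<kappa>0 \<kappa>inf)) (specialise (bg_system \<kappa>0) q)"
  unfolding transforms_def
  using solves_PIV_cosparse[OF q]
proof (rule eventually_mono)
  fix x assume "\<forall>\<^sub>F y in nhds x. q analytic_on {y} \<and> q y \<noteq> 0 \<and>
      deriv (deriv q) y = (deriv q y)\<^sup>2 / (2 * q y) + 3 / 2 * q y ^ 3 + 4 * y * (q y)\<^sup>2
          + 2 * (y\<^sup>2 - alphaIV \<kappa>0 \<kappa>inf) * q y + betaIV \<kappa>0 / q y"
  from eventually_nhds_x_imp_x[OF this] have an: "q analytic_on {x}" and nz: "q x \<noteq> 0"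
    and PIV: "deriv (deriv q) x = (deriv q x)\<^sup>2 / (2 * q x) + 3 / 2 * q x ^ 3 + 4 * x * (q x)\<^sup>2
          + 2 * (x\<^sup>2 - alphaIV \<kappa>0 \<kappa>inf) * q x + betaIV \<kappa>0 / q x" by auto
  have q1: "(q has_field_derivative deriv q x) (at x)"
    by (intro DERIV_analytic an)
  have q2: "(deriv q has_field_derivative deriv (deriv q) x) (at x)"
    by (intro DERIV_analytic analytic_deriv an)
  have H1: "fst (hamiltonian_system (okamoto_H \<kappa>0 \<kappa>inf)) x y z = 4 * y * z - (y\<^sup>2 + 2 * x * y + \<kappa>0)" for y z
    unfolding hamiltonian_system_def okamoto_H_def fst_conv
    by (rule DERIV_imp_deriv) (auto intro!: derivative_eq_intros simp: algebra_simps)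
  have H2: "snd (hamiltonian_system (okamoto_H \<kappa>0 \<kappa>inf)) x y z = - (2 * z\<^sup>2 - (2 * y + 2 * x) * z + \<kappa>inf)" for y z
    unfolding hamiltonian_system_def okamoto_H_def snd_conv neg_equal_iff_equal
    by (rule DERIV_imp_deriv) (auto intro!: derivative_eq_intros simp: algebra_simps)
  have Y: "deriv (\<lambda>t. z + q t) x = deriv q x" "deriv (\<lambda>t. z + q x) y = 0" "deriv (\<lambda>t. t + q x) z = 1" for y z
    using q1 by (auto intro!: DERIV_imp_deriv derivative_eq_intros)
  have shift1: "(shift \<kappa>0 q has_field_derivative
      1 / 2 + deriv q x / 4 + (deriv (deriv q) x * q x - (\<kappa>0 + deriv q x) * deriv q x) / (4 * q x ^ 2)) (at x)"
    unfolding shift_def[abs_def]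
    by (rule derivative_eq_intros refl q1 q2 | use nz in \<open>simp add: field_simps power2_eq_square\<close>)+
  have Z: "deriv (\<lambda>t. y * z + shift \<kappa>0 q t) x =
        1 / 2 + deriv q x / 4 + (deriv (deriv q) x * q x - (\<kappa>0 + deriv q x) * deriv q x) / (4 * q x ^ 2)"
      "deriv (\<lambda>t. t * z + shift \<kappa>0 q x) y = z" "deriv (\<lambda>t. y * t + shift \<kappa>0 q x) z = y" for y z
    using shift1 by (auto intro!: DERIV_imp_deriv derivative_eq_intros)
  define P where "P = (\<lambda>y z. fst (specialise (bg_system \<kappa>0) q) x y z)"
  define Q where "Q = (\<lambda>y z. snd (specialise (bg_system \<kappa>0) q) x y z)"
  define \<mu> where "\<mu> = (\<kappa>0 + deriv q x - q x ^ 2) / q x"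
  define \<gamma> where "\<gamma> = shift \<kappa>0 q x"
  have P: "P y z = - 6 * y^2 * z - 4 * q x * y^2 + 3 * y * z - 2 * \<mu> * y + 2 * \<gamma>" for y z
    using nz by (simp add: P_def specialise_def bg_system_def ev_def \<mu>_def \<gamma>_def shift_def field_simps eval_nat_numeral)
  have Q: "Q y z = 4 * y * z^2 + 4 * q x * y * z - z^2 + \<mu> * z" for y z
    using nz by (simp add: Q_def specialise_def bg_system_def ev_def \<mu>_def field_simps eval_nat_numeral)
  have \<mu>: "\<kappa>0 + deriv q x = \<mu> * q x + q x ^ 2"
    using nz by (simp add: \<mu>_def)
  have \<gamma>: "4 * \<gamma> = 2 * x + 2 * q x + \<mu>"
  proof -
    have "4 * \<gamma> = 2 * x + q x + (\<kappa>0 + deriv q x) / q x"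
      using nz unfolding \<gamma>_def shift_def \<mu> by (simp add: distrib_left)
    thus ?thesis using nz unfolding \<mu> by (simp add: add_divide_distrib power2_eq_square)
  qed
  \<comment> \<open>This is Hamilton's second equation for the pair (q, \<gamma>), the part of the
    chain rule that does not involve \<open>y\<close> and \<open>z\<close>. It is the only place in
    the transformation where the Painleve equation is used, and \<kappa>inf drops out here.\<close>
  have residual: "1 / 2 + deriv q x / 4 + (deriv (deriv q) x * q x - (\<kappa>0 + deriv q x) * deriv q x) / (4 * q x ^ 2) =
      - 2 * \<gamma> ^ 2 + 2 * (q x + x) * \<gamma> - \<kappa>inf" (is "?L = ?R")
  proof -
    have 1: "8 * q x ^ 2 * ?L = 4 * q x ^ 2 + 2 * deriv q x * q x ^ 2
        + 2 * (deriv (deriv q) x * q x - (\<kappa>0 + deriv q x) * deriv q x)"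
      using nz by (simp add: distrib_left)
    have "2 * q x * deriv (deriv q) x - deriv q x ^ 2 + 4 * q x ^ 2 + \<kappa>0 ^ 2 - 2 * \<kappa>0 * q x ^ 2
        - 4 * x ^ 2 * q x ^ 2 - 8 * x * q x ^ 3 - 3 * q x ^ 4 + 8 * \<kappa>inf * q x ^ 2 = 0"
      by (rule PIV_polynomial[OF nz PIV[unfolded alphaIV_def betaIV_def]])
    moreover have "4 * q x * \<gamma> = 2 * x * q x + q x ^ 2 + \<kappa>0 + deriv q x"
      using \<mu> \<gamma> by algebra
    ultimately have "8 * q x ^ 2 * ?L = 8 * q x ^ 2 * ?R"
      unfolding 1 by algebra
    thus ?thesis using nz by simp
  qed
  have "fst (hamiltonian_system (okamoto_H \<kappa>0 \<kappa>inf)) x (z + q x) (y * z + \<gamma>) = deriv q x + 0 * P y z + 1 * Q y z" for y z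
    unfolding H1 Q using \<mu> \<gamma> by algebra
  moreover have "snd (hamiltonian_system (okamoto_H \<kappa>0 \<kappa>inf)) x (z + q x) (y * z + \<gamma>) =
      (- 2 * \<gamma> ^ 2 + 2 * (q x + x) * \<gamma> - \<kappa>inf) + z * P y z + y * Q y z" for y z
    unfolding H2 P Q using \<gamma> by algebra
  moreover have "generically (\<lambda>y z. True)"
    unfolding generically_def by (intro exI[of _ 1]) auto
  ultimately show "generically (\<lambda>y z.
        fst (hamiltonian_system (okamoto_H \<kappa>0 \<kappa>inf)) x (z + q x) (y * z + shift \<kappa>0 q x) =
          deriv (\<lambda>t. z + q t) x + deriv (\<lambda>t. z + q x) y * fst (specialise (bg_system \<kappa>0) q) x y z
            + deriv (\<lambda>t. t + q x) z * snd (specialise (bg_system \<kappa>0) q) x y z \<and>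
        snd (hamiltonian_system (okamoto_H \<kappa>0 \<kappa>inf)) x (z + q x) (y * z + shift \<kappa>0 q x) =
          deriv (\<lambda>t. y * z + shift \<kappa>0 q t) x + deriv (\<lambda>t. t * z + shift \<kappa>0 q x) y * fst (specialise (bg_system \<kappa>0) q) x y z
            + deriv (\<lambda>t. y * t + shift \<kappa>0 q x) z * snd (specialise (bg_system \<kappa>0) q) x y z)"
    unfolding Y Z residual unfolding \<gamma>_def[symmetric]
    by (simp add: P_def Q_def)
qed

lemma shift_meromorphic: "q meromorphic_on D \<Longrightarrow> shift \<kappa>0 q meromorphic_on D"
  unfolding shift_def[abs_def] by (intro meromorphic_intros)

lemma birationally_equivalent_bg_system:
  assumes q: "solves_PIV (alphaIV \<kappa>0 \<kappa>inf) (betaIV \<kappa>0) D q"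
  shows "birationally_equivalent D (hamiltonian_system (okamoto_H \<kappa>0 \<kappa>inf)) (specialise (bg_system \<kappa>0) q)"
proof -
  have mero: "q meromorphic_on D" "shift \<kappa>0 q meromorphic_on D"
    using q by (auto simp: solves_PIV_def intro: shift_meromorphic)
  define Y :: xyz_fun where "Y = (\<lambda>x y z. z + q x)"
  define Z :: xyz_fun where "Z = (\<lambda>x y z. y * z + shift \<kappa>0 q x)"
  define U :: xyz_fun where "U = (\<lambda>x y z. (z - shift \<kappa>0 q x) / (y - q x))"
  define V :: xyz_fun where "V = (\<lambda>x y z. y - q x)"
  note defs = Y_def Z_def U_def V_def
  have rat: "rational_over D Y" "rational_over D Z" "rational_over D U" "rational_over D V"
  proof -
    show "rational_over D Y"
    proof (rule rational_overI[of 1 "\<lambda>x. [:[:q x:], [:1:]:]" "\<lambda>x. [:[:1:]:]"])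
      show "(\<lambda>x. coeff (coeff [:[:q x:], [:1:]:] j) i) meromorphic_on D" "(\<lambda>x. coeff (coeff [:[:1:]:] j) i) meromorphic_on D" for i j
        using nat_cases_3[of i] nat_cases_3[of j] by (auto intro!: meromorphic_intros mero)
    qed (auto simp: defs ev_def degrees_le_def coeff_pCons split: nat.split intro!: degree_le)
    show "rational_over D Z"
    proof (rule rational_overI[of 1 "\<lambda>x. [:[:shift \<kappa>0 q x:], [:0, 1:]:]" "\<lambda>x. [:[:1:]:]"])
      show "(\<lambda>x. coeff (coeff [:[:shift \<kappa>0 q x:], [:0, 1:]:] j) i) meromorphic_on D" "(\<lambda>x. coeff (coeff [:[:1:]:] j) i) meromorphic_on D" for i j
        using nat_cases_3[of i] nat_cases_3[of j] by (auto intro!: meromorphic_intros mero)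
    qed (auto simp: defs ev_def degrees_le_def coeff_pCons split: nat.split intro!: degree_le)
    show "rational_over D U"
    proof (rule rational_overI[of 1 "\<lambda>x. [:[:- shift \<kappa>0 q x:], [:1:]:]" "\<lambda>x. [:[:- q x, 1:]:]"])
      show "(\<lambda>x. coeff (coeff [:[:- shift \<kappa>0 q x:], [:1:]:] j) i) meromorphic_on D" "(\<lambda>x. coeff (coeff [:[:- q x, 1:]:] j) i) meromorphic_on D" for i j
        using nat_cases_3[of i] nat_cases_3[of j] by (auto intro!: meromorphic_intros mero)
    qed (auto simp: defs ev_def degrees_le_def coeff_pCons split: nat.split intro!: degree_le)
    show "rational_over D V"
    proof (rule rational_overI[of 1 "\<lambda>x. [:[:- q x, 1:]:]" "\<lambda>x. [:[:1:]:]"])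
      show "(\<lambda>x. coeff (coeff [:[:- q x, 1:]:] j) i) meromorphic_on D" "(\<lambda>x. coeff (coeff [:[:1:]:] j) i) meromorphic_on D" for i j
        using nat_cases_3[of i] nat_cases_3[of j] by (auto intro!: meromorphic_intros mero)
    qed (auto simp: defs ev_def degrees_le_def coeff_pCons split: nat.split intro!: degree_le)
  qed
  \<comment> \<open>The inverse divides by y_4 - q = z, so the two compositions are the identity off
    \<open>z = 0\<close> and off \<open>y = q x\<close>, respectively.\<close>
  have "generically (\<lambda>y z. U x (Y x y z) (Z x y z) = y \<and> V x (Y x y z) (Z x y z) = z)" for x
    by (rule generically_mono[OF generically_nz[of "\<lambda>y z. z"]]) (auto simp: defs intro!: nzI[of _ 0 1] polyfun_intros)
  moreover have "generically (\<lambda>y z. Y x (U x y z) (V x y z) = y \<and> Z x (U x y z) (V x y z) = z)" for x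
    by (rule generically_mono[OF generically_nz[of "\<lambda>y z. y - q x"]])
       (auto simp: defs intro!: nzI[of _ "q x + 1" 0] polyfun_intros)
  ultimately show ?thesis
    unfolding birationally_equivalent_def using rat transforms_bg_system[OF q]
    by (intro exI[of _ Y] exI[of _ Z] exI[of _ U] exI[of _ V]) (auto intro: always_eventually simp: defs)
qed

theorem proposition3p5:
  fixes \<kappa>0 \<kappa>inf :: complex
  shows "\<exists>S :: jet_system. \<forall>D q. solves_PIV (alphaIV \<kappa>0 \<kappa>inf) (betaIV \<kappa>0) D q \<longrightarrow>
           transforms D
             (\<lambda>x y z. z + q x)
             (\<lambda>x y z. y * z + x / 2 + q x / 4 + (\<kappa>0 + deriv q x) / (4 * q x))
             (hamiltonian_system (okamoto_H \<kappa>0 \<kappa>inf)) (specialise S q) \<and>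
           bureau_guillot_PIV \<kappa>0 \<kappa>inf S D q"
proof (intro exI[of _ "bg_system \<kappa>0"] allI impI conjI)
  fix D q assume q: "solves_PIV (alphaIV \<kappa>0 \<kappa>inf) (betaIV \<kappa>0) D q"
  show "transforms D (\<lambda>x y z. z + q x) (\<lambda>x y z. y * z + x / 2 + q x / 4 + (\<kappa>0 + deriv q x) / (4 * q x))
          (hamiltonian_system (okamoto_H \<kappa>0 \<kappa>inf)) (specialise (bg_system \<kappa>0) q)"
    using transforms_bg_system[OF q] by (simp add: shift_def add.assoc)
  have mero: "q meromorphic_on D"
    using q by (simp add: solves_PIV_def)
  have "\<forall>\<^sub>\<approx>x\<in>D. denP (bg_system \<kappa>0) q x \<noteq> 0 \<and> denQ (bg_system \<kappa>0) q x \<noteq> 0"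
    using q by (auto simp: solves_PIV_def bg_system_def elim: eventually_mono)
  moreover have "(\<lambda>x. coeff (coeff (p q x) j) i) meromorphic_on D" if "p \<in> jet_polys (bg_system \<kappa>0)" for p i j
    using that nat_cases_3[of i] nat_cases_3[of j]
    by (auto simp: jet_polys_def bg_system_def intro!: meromorphic_intros mero)
  ultimately show "bureau_guillot_PIV \<kappa>0 \<kappa>inf (bg_system \<kappa>0) D q"
    unfolding bureau_guillot_PIV_def
    using birationally_equivalent_bg_system[OF q] jet_rational_bg_system PIV_is_regularising_bg_system by blast
qed

end
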